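(* Let $d\in\mathbb{N}$. For any $\varepsilon>0$, there is a function $f\in B^{0,b+1/\min\{2,p,q\}-\varepsilon}_{p,q}(\mathbb{R}^d)$ such that $f\notin\mathbf{B}^{0,b}_{p,q}(\mathbb{R}^d)$ in any of the following cases: (a) $\frac{2d}{d+1}<p<\infty$, $0<q\le\infty$, $b>-1/q$, and $p=\min\{2,p,q\}$; (b) $1<p<\infty$, $0<q\le\infty$, $b>-1/q$, and $2=\min\{2,p,q\}$; (c) $1<p<\infty$, $0<q\le\infty$, $b>-1/q$, and $q=\min\{2,p,q\}$.
   Context: Convention: $1/\infty=0$. $\mathbf{B}^{0,b}_{p,q}(\mathbb{R}^d)$ is the set of $f\in L_p(\mathbb{R}^d)$ with finite quasi-norm $\|f\|_{L_p(\mathbb{R}^d)}+\left(\int_0^1((1-\log t)^b\omega_k(f,t)_p)^q\frac{dt}{t}\right)^{1/q}$ (supremum over $0<t<1$ if $q=\infty$), where $k\in\mathbb{N}$ is fixed (different $k$ give equivalent quasi-norms), $\omega_k(f,t)_p=\sup_{|h|\le t}\|\Delta_h^kf\|_{L_p(\mathbb{R}^d)}$, $\Delta^1_hf(x)=f(x+h)-f(x)$, $\Delta_h^{k+1}=\Delta_h^1\Delta_h^k$. Let $\varphi_0\in\mathcal{S}(\mathbb{R}^d)$ with $\operatorname{supp}\varphi_0\subset\{|x|\le2\}$, $\varphi_0(x)=1$ if $|x|\le1$, and $\varphi_j(x)=\varphi_0(2^{-j}x)-\varphi_0(2^{-j+1}x)$ for $j\in\mathbb{N}$. $B^{s,b}_{p,q}(\mathbb{R}^d)$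 ($s,b\in\mathbb{R}$) is the set of tempered distributions $f$ with $\|f\|_{B^{s,b}_{p,q}(\mathbb{R}^d)}=\left(\sum_{j=0}^\infty(2^{js}(1+j)^b\|(\varphi_j\widehat f)^\vee\|_{L_p(\mathbb{R}^d)})^q\right)^{1/q}<\infty$ (supremum if $q=\infty$); it does not depend on $\varphi_0$, up to equivalent quasi-norms. *)

theory Defs
  imports "HOL-Analysis.Analysis"
begin

text \<open>
  All quasi-norms take values in \<^typ>\<open>ennreal\<close>, so that finiteness is a meaningful condition.
  The integrability exponent p is a positive real and q is a positive extended real
  (so 1 / \<infinity> = 0 holds in \<^typ>\<open>ereal\<close>). Functions are complex-valued.
\<close>

text \<open>The power of an extended nonnegative real; only meant for exponents r > 0.\<close>

definition epowr :: "ennreal \<Rightarrow> real \<Rightarrow> ennreal" where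
  "epowr x r = (if x = top then top else ennreal (enn2real x powr r))"

definition Lp_norm :: "real \<Rightarrow> ('a::euclidean_space \<Rightarrow> complex) \<Rightarrow> ennreal" where
  "Lp_norm p f = epowr (\<integral>\<^sup>+ x. ennreal (norm (f x) powr p) \<partial>lborel) (1 / p)"

definition Lp_space :: "real \<Rightarrow> ('a::euclidean_space \<Rightarrow> complex) set" where
  "Lp_space p = {f \<in> borel_measurable lborel. Lp_norm p f < top}"


subsection \<open>Besov spaces of logarithmic smoothness defined by differences\<close>

fun diff_op :: "nat \<Rightarrow> 'a::euclidean_space \<Rightarrow> ('a \<Rightarrow> complex) \<Rightarrow> 'a \<Rightarrow> complex" where
  "diff_op 0 h f = f"
| "diff_op (Suc k) h f = (\<lambda>x. diff_op k h f (x + h) - diff_op k h f x)"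

definition modulus_smooth ::
    "nat \<Rightarrow> real \<Rightarrow> ('a::euclidean_space \<Rightarrow> complex) \<Rightarrow> real \<Rightarrow> ennreal" where
  "modulus_smooth k p f t = (SUP h\<in>{h. norm h \<le> t}. Lp_norm p (diff_op k h f))"

definition log_diff_seminorm ::
    "nat \<Rightarrow> real \<Rightarrow> real \<Rightarrow> ereal \<Rightarrow> ('a::euclidean_space \<Rightarrow> complex) \<Rightarrow> ennreal" where
  "log_diff_seminorm k b p q f =
     (if q = \<infinity>
      then (SUP t\<in>{0<..<1}. ennreal ((1 - ln t) powr b) * modulus_smooth k p f t)
      else epowr
        (\<integral>\<^sup>+ t\<in>{0<..<1}.
           epowr (ennreal ((1 - ln t) powr b) * modulus_smooth k p f t) (real_of_ereal q)
             * ennreal (1 / t) \<partial>lborel)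
        (1 / real_of_ereal q))"

text \<open>The order k \<ge> 1 of the differences is a parameter.\<close>

definition besov_diff ::
    "nat \<Rightarrow> real \<Rightarrow> real \<Rightarrow> ereal \<Rightarrow> ('a::euclidean_space \<Rightarrow> complex) set" where
  "besov_diff k b p q =
     {f \<in> Lp_space p. Lp_norm p f + log_diff_seminorm k b p q f < top}"


subsection \<open>Schwartz functions and tempered distributions\<close>

text \<open>Iterated directional derivatives; the directions are taken from \<^const>\<open>Basis\<close>, so a list of
  length n corresponds to a partial derivative of order n.\<close>

fun partials :: "'a::euclidean_space list \<Rightarrow> ('a \<Rightarrow> complex) \<Rightarrow> 'a \<Rightarrow> complex" where
  "partials [] f = f"
| "partials (v # vs) f = (\<lambda>x. frechet_derivative (partials vs f) (at x) v)"

definition smooth_fun :: "('a::euclidean_space \<Rightarrow> complex) \<Rightarrow> bool" where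
  "smooth_fun f \<longleftrightarrow>
     (\<forall>vs. set vs \<subseteq> Basis \<longrightarrow> (\<forall>x. (partials vs f) differentiable (at x)))"

definition schwartz :: "('a::euclidean_space \<Rightarrow> complex) set" where
  "schwartz = {f. smooth_fun f \<and>
     (\<forall>N vs. set vs \<subseteq> Basis \<longrightarrow>
        bounded (range (\<lambda>x. (1 + norm x) ^ N *\<^sub>R partials vs f x)))}"

definition schwartz_seminorm :: "nat \<Rightarrow> ('a::euclidean_space \<Rightarrow> complex) \<Rightarrow> real" where
  "schwartz_seminorm N f =
     (SUP (vs, x)\<in>{vs. set vs \<subseteq> Basis \<and> length vs \<le> N} \<times> UNIV.
        (1 + norm x) ^ N * norm (partials vs f x))"

text \<open>A distribution is represented by a functional on all functions; only its values on
  \<^const>\<open>schwartz\<close> are relevant. Continuity is expressed by domination by a Schwartz seminorm.\<close>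

definition tempered_distribution :: "(('a::euclidean_space \<Rightarrow> complex) \<Rightarrow> complex) \<Rightarrow> bool" where
  "tempered_distribution T \<longleftrightarrow>
     (\<forall>f\<in>schwartz. \<forall>g\<in>schwartz. T (\<lambda>x. f x + g x) = T f + T g) \<and>
     (\<forall>c. \<forall>f\<in>schwartz. T (\<lambda>x. c * f x) = c * T f) \<and>
     (\<exists>C N. \<forall>f\<in>schwartz. norm (T f) \<le> C * schwartz_seminorm N f)"

definition represents ::
    "('a::euclidean_space \<Rightarrow> complex) \<Rightarrow> (('a \<Rightarrow> complex) \<Rightarrow> complex) \<Rightarrow> bool" where
  "represents g T \<longleftrightarrow>
     g \<in> borel_measurable lborel \<and>
     (\<forall>\<psi>\<in>schwartz. integrable lborel (\<lambda>x. g x * \<psi> x) \<and>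
                   T \<psi> = (\<integral>x. g x * \<psi> x \<partial>lborel))"

text \<open>Functions representing a given distribution agree almost everywhere, so the infimum below is
  their common norm, and it is top if the distribution is not given by a function.\<close>

definition dist_Lp_norm :: "real \<Rightarrow> (('a::euclidean_space \<Rightarrow> complex) \<Rightarrow> complex) \<Rightarrow> ennreal" where
  "dist_Lp_norm p T = (INF g\<in>{g. represents g T}. Lp_norm p g)"

text \<open>Fourier transform with the unitary normalisation and kernel exp (- i x \<xi>).\<close>

definition fourier :: "('a::euclidean_space \<Rightarrow> complex) \<Rightarrow> 'a \<Rightarrow> complex" where
  "fourier \<psi> \<xi> =
     complex_of_real ((2 * pi) powr (- real DIM('a) / 2)) *
       (\<integral>x. cis (- (x \<bullet> \<xi>)) * \<psi> x \<partial>lborel)"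

definition inv_fourier :: "('a::euclidean_space \<Rightarrow> complex) \<Rightarrow> 'a \<Rightarrow> complex" where
  "inv_fourier \<psi> x =
     complex_of_real ((2 * pi) powr (- real DIM('a) / 2)) *
       (\<integral>\<xi>. cis (x \<bullet> \<xi>) * \<psi> \<xi> \<partial>lborel)"

definition dist_fourier ::
    "(('a::euclidean_space \<Rightarrow> complex) \<Rightarrow> complex) \<Rightarrow> ('a \<Rightarrow> complex) \<Rightarrow> complex" where
  "dist_fourier T = (\<lambda>\<psi>. T (fourier \<psi>))"

definition dist_inv_fourier ::
    "(('a::euclidean_space \<Rightarrow> complex) \<Rightarrow> complex) \<Rightarrow> ('a \<Rightarrow> complex) \<Rightarrow> complex" where
  "dist_inv_fourier T = (\<lambda>\<psi>. T (inv_fourier \<psi>))"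

definition dist_mult ::
    "('a::euclidean_space \<Rightarrow> complex) \<Rightarrow> (('a \<Rightarrow> complex) \<Rightarrow> complex) \<Rightarrow> ('a \<Rightarrow> complex) \<Rightarrow> complex" where
  "dist_mult \<phi> T = (\<lambda>\<psi>. T (\<lambda>x. \<phi> x * \<psi> x))"


subsection \<open>Besov spaces of logarithmic smoothness defined by Fourier decomposition\<close>

definition dyadic_generator :: "('a::euclidean_space \<Rightarrow> complex) \<Rightarrow> bool" where
  "dyadic_generator \<phi>0 \<longleftrightarrow>
     \<phi>0 \<in> schwartz \<and> closure {x. \<phi>0 x \<noteq> 0} \<subseteq> {x. norm x \<le> 2} \<and> (\<forall>x. norm x \<le> 1 \<longrightarrow> \<phi>0 x = 1)"

definition dyadic :: "('a::euclidean_space \<Rightarrow> complex) \<Rightarrow> nat \<Rightarrow> 'a \<Rightarrow> complex" where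
  "dyadic \<phi>0 j =
     (if j = 0 then \<phi>0
      else (\<lambda>x. \<phi>0 (2 powr (- real j) *\<^sub>R x) - \<phi>0 (2 powr (- real j + 1) *\<^sub>R x)))"

definition besov_norm ::
    "('a::euclidean_space \<Rightarrow> complex) \<Rightarrow> real \<Rightarrow> real \<Rightarrow> real \<Rightarrow> ereal \<Rightarrow>
     (('a \<Rightarrow> complex) \<Rightarrow> complex) \<Rightarrow> ennreal" where
  "besov_norm \<phi>0 s b p q T =
     (let a = (\<lambda>j::nat. ennreal (2 powr (real j * s) * (1 + real j) powr b) *
                 dist_Lp_norm p (dist_inv_fourier (dist_mult (dyadic \<phi>0 j) (dist_fourier T))))
      in if q = \<infinity> then (SUP j. a j)
         else epowr (\<Sum>j. epowr (a j) (real_of_ereal q)) (1 / real_of_ereal q))"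

definition besov ::
    "('a::euclidean_space \<Rightarrow> complex) \<Rightarrow> real \<Rightarrow> real \<Rightarrow> real \<Rightarrow> ereal \<Rightarrow>
     (('a \<Rightarrow> complex) \<Rightarrow> complex) set" where
  "besov \<phi>0 s b p q = {T. tempered_distribution T \<and> besov_norm \<phi>0 s b p q T < top}"

text \<open>A function belongs to the Besov space if it is (the density of) a regular tempered
  distribution that does.\<close>

definition besov_fun ::
    "('a::euclidean_space \<Rightarrow> complex) \<Rightarrow> real \<Rightarrow> real \<Rightarrow> real \<Rightarrow> ereal \<Rightarrow> ('a \<Rightarrow> complex) set" where
  "besov_fun \<phi>0 s b p q = {f. \<exists>T\<in>besov \<phi>0 s b p q. represents f T}"

end

(*
  The extremal function is a lacunary series f = sum_j a_j exp(i lam_j x_1) psi(x - rho_j e_1), where psi is a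
  product of Fejer kernels, so that each term has a compactly supported Fourier transform lying in the
  dyadic annulus 2^j < |xi| < 2^(j+1).  Only the terms j = i and j = i - 1 contribute to the i-th
  Littlewood-Paley piece, whose norm is therefore at most a constant times a_i + a_(i-1).

  The indices are grouped into blocks 2^n <= j < 2^(n+1), and the frequencies are chosen so that a single
  step h_n of size about 2^(-2^n) gives lam_j h_n = pi modulo 2 pi for all j in the n-th block.
  Pairing the k-th difference of f along h_n with the conjugate of the block leaves, by orthogonality,
  only the diagonal, in which nothing cancels.  By duality the L_p norm of the difference
  is at least (sum of a_j over the block) / (L_p' norm of the unweighted block).  The positions rho_j decide
  the L_p' norm: waves at distinct integers behave as if disjoint (case p), waves at a common centre obey
  the square function bound (case 2), and in case q each block keeps a single wave.
  The difference seminorm then sees a whole block at all scales t >= h_n.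
*)

theory Submission
  imports Defs "HOL-Library.Discrete_Functions"
begin

text \<open>The coefficients come from a balance. If the unweighted block \<open>n\<close> has
  \<open>L_p'\<close> norm of order \<open>N n\<close>, duality leaves the block sum divided by
  \<open>N n\<close>, and this should be \<open>2 powr (- (n * \<beta>))\<close> with
  \<open>\<beta> = b + 1/q - \<delta>\<close>: the scales belonging to block \<open>n\<close> have
  logarithmic length of order \<open>2 ^ n\<close>, so for finite \<open>q\<close> the block
  contributes about \<open>2 powr (n * \<delta> * q)\<close> to the integral, which is unbounded.
  With \<mu> the minimum of 2, \<open>p\<close>, \<open>q\<close>, cases p and 2 have
  \<open>N n = 2 powr (n * (1 - 1/\<mu>))\<close>, which forces coefficients of order
  \<open>j powr (- (\<beta> + 1/\<mu>))\<close>; in case q, \<open>N n = 1\<close> and the order is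
  \<open>j powr (- \<beta>)\<close> on powers of two only. The Besov sum then converges because
  \<delta> < \<epsilon>. Membership in \<open>besov_diff\<close> is refuted through the seminorm
  alone, so f enters merely as an everywhere convergent series of at most quadratic growth. This
  follows from coefficients at most 1 and centres that tend to infinity, which is why even the
  common centre of case 2 moves from block to block. Fejer kernels serve as envelopes because both
  their decay and their bounded spectrum can be checked by explicit integrals.\<close>

section \<open>Integration over Euclidean space: products, affine maps, Fubini\<close>

lemma has_integral_prod_Basis:
  fixes F :: "'a::euclidean_space \<Rightarrow> real \<Rightarrow> 'c::{real_normed_field,banach,second_countable_topology}"
  assumes int: "\<And>b. b \<in> Basis \<Longrightarrow> integrable lborel (F b)"
  shows "has_bochner_integral lborel (\<lambda>x::'a. \<Prod>b\<in>Basis. F b (x \<bullet> b))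
    (\<Prod>b\<in>Basis. integral\<^sup>L lborel (F b))"
proof -
  interpret P: product_sigma_finite "\<lambda>_::'a. lborel :: real measure" ..
  have [measurable]: "b \<in> Basis \<Longrightarrow> F b \<in> borel_measurable borel" for b
    using borel_measurable_integrable[OF int, of b] by simp
  have coord: "(\<Prod>b\<in>Basis. F b ((\<Sum>c\<in>Basis. g c *\<^sub>R c) \<bullet> b)) = (\<Prod>b\<in>Basis. F b (g b))" for g :: "'a \<Rightarrow> real"
    by (intro prod.cong) auto
  have m: "(\<lambda>g. \<Sum>b\<in>Basis. g b *\<^sub>R b) \<in> measurable (\<Pi>\<^sub>M b\<in>(Basis::'a set). (lborel :: real measure)) borel"
    by measurable
  have "has_bochner_integral (\<Pi>\<^sub>M b\<in>(Basis::'a set). lborel) (\<lambda>g. \<Prod>b\<in>Basis. F b (g b))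
      (\<Prod>b\<in>Basis. integral\<^sup>L lborel (F b))"
    unfolding has_bochner_integral_iff
    using P.product_integrable_prod[of Basis F] P.product_integral_prod[of Basis F] int by auto
  then show ?thesis
    unfolding lborel_eq[where 'a='a]
    by (intro has_bochner_integral_distr[OF _ m]) (auto simp: coord)
qed

lemmas integrable_prod_Basis = has_integral_prod_Basis[THEN integrable.intros]
lemmas integral_prod_Basis = has_integral_prod_Basis[THEN has_bochner_integral_integral_eq]

lemma lborel_has_integral_affine:
  fixes f :: "'a::euclidean_space \<Rightarrow> 'c::{banach,second_countable_topology}"
  assumes "has_bochner_integral lborel f I" "c \<noteq> 0"
  shows "has_bochner_integral lborel (\<lambda>x. f (t + c *\<^sub>R x)) (inverse (\<bar>c\<bar> ^ DIM('a)) *\<^sub>R I)"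
proof -
  have "has_bochner_integral (density (distr lborel borel (\<lambda>x. t + c *\<^sub>R x)) (\<lambda>_. ennreal (\<bar>c\<bar>^DIM('a)))) f I"
    using assms by (subst (asm) lborel_affine[of c t]) auto
  then have "has_bochner_integral (distr lborel borel (\<lambda>x. t + c *\<^sub>R x)) (\<lambda>x. \<bar>c\<bar>^DIM('a) *\<^sub>R f x) I"
    using assms(1) borel_measurable_has_bochner_integral[OF assms(1)]
    by (auto simp: has_bochner_integral_iff integrable_density integral_density)
  then have "has_bochner_integral lborel (\<lambda>x. \<bar>c\<bar>^DIM('a) *\<^sub>R f (t + c *\<^sub>R x)) I"
    using borel_measurable_has_bochner_integral[OF assms(1)]
    by (auto simp: has_bochner_integral_iff integrable_distr_eq integral_distr)
  from has_bochner_integral_scaleR_right[OF this, of "inverse (\<bar>c\<bar> ^ DIM('a))"] assms(2)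
  show ?thesis by (simp add: field_simps)
qed

lemma
  fixes f :: "'a::euclidean_space \<Rightarrow> 'c::{banach,second_countable_topology}"
  assumes "integrable lborel f"
  shows lborel_integrable_shift: "integrable lborel (\<lambda>x. f (x + t))"
    and lborel_integral_shift: "(\<integral>x. f (x + t) \<partial>lborel) = integral\<^sup>L lborel f"
  using lborel_has_integral_affine[of f "integral\<^sup>L lborel f" 1 t] assms
  by (auto simp: has_bochner_integral_iff add.commute)

lemma lborel_integral_reflect:
  fixes f :: "'a::euclidean_space \<Rightarrow> 'c::{banach,second_countable_topology}"
  assumes "integrable lborel f"
  shows "(\<integral>x. f (t - x) \<partial>lborel) = integral\<^sup>L lborel f"
  using lborel_has_integral_affine[of f "integral\<^sup>L lborel f" "-1" t] assms
  by (auto simp: has_bochner_integral_iff)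

text \<open>The majorant need not be a tensor product: only its slice integrals have to factor as
  \<open>A x * c\<close>. This covers kernels such as \<open>A x * B (y - x)\<close>, the form met
  when convolutions are exchanged with integrals.\<close>

lemma integrable_pair_bound:
  fixes F :: "'a::euclidean_space \<times> 'b::euclidean_space \<Rightarrow> 'c::{banach,second_countable_topology}"
  assumes [measurable]: "F \<in> borel_measurable (lborel \<Otimes>\<^sub>M lborel)"
    and bd: "\<And>x y. norm (F (x, y)) \<le> H x y"
    and H: "\<And>x. integrable lborel (H x)" "\<And>x. (\<integral>y. H x y \<partial>lborel) = A x * c"
    and A: "integrable lborel A"
  shows "integrable (lborel \<Otimes>\<^sub>M lborel) F"
proof (rule lborel_pair.Fubini_integrable)
  have slice: "integrable lborel (\<lambda>y. F (x, y))" for x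
    by (rule Bochner_Integration.integrable_bound[OF H(1)[of x]]) (auto intro: order_trans[OF bd abs_ge_self])
  then show "AE x in lborel. integrable lborel (\<lambda>y. F (x, y))" by simp
  have "norm (\<integral>y. norm (F (x, y)) \<partial>lborel) \<le> norm (A x * c)" for x
  proof -
    have "(\<integral>y. norm (F (x, y)) \<partial>lborel) \<le> (\<integral>y. H x y \<partial>lborel)"
      by (intro integral_mono bd H integrable_norm slice)
    then show ?thesis using H(2) by simp
  qed
  then show "integrable lborel (\<lambda>x. \<integral>y. norm (F (x, y)) \<partial>lborel)"
    by (intro Bochner_Integration.integrable_bound[OF integrable_mult_left[OF A, of c]]) auto
qed simp

subsection \<open>The Fejer kernel on the line\<close>

definition decay :: "real \<Rightarrow> real" where
  "decay t = 1 / (1 + \<bar>t\<bar>)\<^sup>2"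

lemma decay_pos: "0 < decay t" and decay_le_1: "decay t \<le> 1"
  unfolding decay_def by (auto simp: divide_le_eq one_le_power add_pos_nonneg)

lemma decay_measurable [measurable]: "decay \<in> borel_measurable borel"
  unfolding decay_def by measurable

lemma integrable_decay: "integrable lborel decay"
proof -
  have pos: "has_bochner_integral lborel (\<lambda>x. decay x * indicator {0..} x) 1"
  proof -
    have "(\<integral>\<^sup>+x. ennreal (1 / (1 + x)\<^sup>2) * indicator {0..} x \<partial>lborel) = ennreal (0 - (- 1 / (1 + 0)))"
    proof (rule nn_integral_FTC_atLeast)
      show "((\<lambda>x. - 1 / (1 + x)) has_real_derivative 1 / (1 + x)\<^sup>2) (at x)" if "0 \<le> x" for x :: real
        using that by (auto intro!: derivative_eq_intros simp: power2_eq_square)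
      show "((\<lambda>x::real. - 1 / (1 + x)) \<longlongrightarrow> 0) at_top"
        by (intro real_tendsto_divide_at_top[OF tendsto_const] filterlim_tendsto_add_at_top[OF tendsto_const] filterlim_ident)
    qed auto
    also have "(\<integral>\<^sup>+x. ennreal (1 / (1 + x)\<^sup>2) * indicator {0..} x \<partial>lborel) =
        (\<integral>\<^sup>+x. ennreal (decay x * indicator {0..} x) \<partial>lborel)"
      by (intro nn_integral_cong) (auto simp: decay_def split: split_indicator)
    finally show ?thesis
      by (intro has_bochner_integral_nn_integral) (auto intro!: mult_nonneg_nonneg decay_pos[THEN less_imp_le])
  qed
  have "has_bochner_integral lborel decay (2 *\<^sub>R 1)"
    by (rule has_bochner_integral_even_function)
      (use pos in \<open>auto simp: decay_def mult.commute\<close>)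
  then show ?thesis by (rule integrable.intros)
qed

text \<open>This is \<open>(sin (r * t / 2) / (r * t / 2))\<^sup>2\<close>, whose Fourier transform
  is a tent supported in \<open>[-r, r]\<close>.\<close>

definition fejer :: "real \<Rightarrow> real \<Rightarrow> real" where
  "fejer r t = (if t = 0 then 1 else 2 * (1 - cos (r * t)) / (r * t)\<^sup>2)"

lemma one_minus_cos_le: "1 - cos x \<le> x\<^sup>2 / (2::real)"
proof -
  have "1 - cos x = 2 * (sin (x/2))\<^sup>2"
    using cos_double_sin[of "x/2"] by simp
  also have "(sin (x/2))\<^sup>2 \<le> (x/2)\<^sup>2"
    by (subst abs_le_square_iff[symmetric]) (rule abs_sin_x_le_abs_x)
  finally show ?thesis by (simp add: power2_eq_square)
qed

lemma fejer_measurable [measurable]: "fejer r \<in> borel_measurable borel"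
  unfolding fejer_def by measurable

lemma fejer_nonneg: "0 \<le> fejer r t"
  unfolding fejer_def by simp

lemma fejer_le_1: "r \<noteq> 0 \<Longrightarrow> fejer r t \<le> 1"
  using one_minus_cos_le[of "r * t"] unfolding fejer_def by (auto simp: divide_le_eq)

text \<open>For \<open>|t| \<le> 1\<close> the kernel is at most 1 while \<open>decay t\<close> is
  at least 1/4; further out it is at most \<open>4 / (r * t)\<^sup>2\<close> while
  \<open>decay t\<close> is at least \<open>1 / (4 * t\<^sup>2)\<close>. The second regime produces
  16, and \<open>r \<le> 1\<close> lets the same constant serve the first.\<close>

lemma fejer_le_decay:
  assumes "0 < r" "r \<le> 1"
  shows "fejer r t \<le> 16 / r\<^sup>2 * decay t"
proof (cases "\<bar>t\<bar> \<le> 1")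
  case True
  have "4 / r\<^sup>2 \<ge> 1 * 4"
    using assms by (simp add: field_simps power_le_one)
  moreover have "(1 + \<bar>t\<bar>)\<^sup>2 \<le> 2\<^sup>2"
    using True by (intro power_mono) auto
  then have "decay t \<ge> 1 / 4"
    unfolding decay_def by (simp add: field_simps add_pos_nonneg)
  then have "16 / r\<^sup>2 * decay t \<ge> 16 / r\<^sup>2 * (1/4)"
    by (intro mult_left_mono) auto
  with \<open>4 / r\<^sup>2 \<ge> 1 * 4\<close> have "16 / r\<^sup>2 * decay t \<ge> 1" by simp
  then show ?thesis using fejer_le_1[of r t] assms by linarith
next
  case False
  then have "(1 + \<bar>t\<bar>)\<^sup>2 \<le> (2 * \<bar>t\<bar>)\<^sup>2"
    by (intro power_mono) auto
  then have "1 / (4 * t\<^sup>2) \<le> decay t"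
    unfolding decay_def by (intro divide_left_mono) (use False in \<open>auto simp: power_mult_distrib intro!: mult_pos_pos zero_less_power add_pos_nonneg\<close>)
  then have "16 / r\<^sup>2 * decay t \<ge> 16 / r\<^sup>2 * (1 / (4 * t\<^sup>2))"
    using assms by (intro mult_left_mono) auto
  also have "16 / r\<^sup>2 * (1 / (4 * t\<^sup>2)) = 4 / (r * t)\<^sup>2"
    by (simp add: power_mult_distrib)
  also have "\<dots> \<ge> fejer r t"
  proof -
    have *: "2 * (1 - c) \<le> 4" if "-1 \<le> c" for c :: real
      using that by simp
    have "2 * (1 - cos (r * t)) / (r * t)\<^sup>2 \<le> 4 / (r * t)\<^sup>2"
      
    proof (rule divide_right_mono)
      show "2 * (1 - cos (r * t)) \<le> 4"
        by (rule *[OF cos_ge_minus_one])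
    qed (rule zero_le_power2)
    then show ?thesis using False by (auto simp: fejer_def)
  qed
  finally show ?thesis .
qed

lemma integrable_fejer: "0 < r \<Longrightarrow> r \<le> 1 \<Longrightarrow> integrable lborel (fejer r)"
  by (rule Bochner_Integration.integrable_bound[OF integrable_mult_right[OF integrable_decay, of "16/r\<^sup>2"]])
    (auto simp: fejer_nonneg simp del: times_divide_eq_left intro: order_trans[OF fejer_le_decay abs_ge_self])

text \<open>By scaling, the integral of \<open>(1 - cos (a t)) / t\<^sup>2\<close> is proportional to \<open>\<bar>a\<bar>\<close>; the constant
  does not matter for the vanishing of the Fourier transform of the Fejer kernel.\<close>

definition cosquot :: "real \<Rightarrow> real \<Rightarrow> real" where
  "cosquot a t = (if t = 0 then a\<^sup>2 / 2 else (1 - cos (a * t)) / t\<^sup>2)"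

lemma cosquot_fejer: "cosquot 1 t = fejer 1 t / 2"
  by (auto simp: cosquot_def fejer_def)

lemma cosquot_scale: "cosquot a t = a\<^sup>2 * cosquot 1 (a * t)"
  by (auto simp: cosquot_def power_mult_distrib)

lemma scale_square: "a \<noteq> 0 \<Longrightarrow> a\<^sup>2 * (inverse \<bar>a\<bar> * c) = \<bar>a\<bar> * c" for a c :: real
  by (cases "a > 0") (auto simp: power2_eq_square)

lemma has_integral_cosquot: "has_bochner_integral lborel (cosquot a) (\<bar>a\<bar> * integral\<^sup>L lborel (cosquot 1))"
proof (cases "a = 0")
  case True
  then have "cosquot a = (\<lambda>_. 0)" by (auto simp: cosquot_def fun_eq_iff)
  then show ?thesis using True by (auto simp: has_bochner_integral_iff)
next
  case False
  have "integrable lborel (cosquot 1)"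
    unfolding cosquot_fejer using integrable_fejer[of 1] by auto
  then have "has_bochner_integral lborel (\<lambda>t. cosquot 1 (0 + a * t)) (integral\<^sup>L lborel (cosquot 1) /\<^sub>R \<bar>a\<bar>)"
    using lborel_has_bochner_integral_real_affine_iff[OF False, of "cosquot 1" "integral\<^sup>L lborel (cosquot 1)" 0]
    by (simp add: has_bochner_integral_iff)
  from has_bochner_integral_mult_right[of "a\<^sup>2", OF this]
  show ?thesis using False
    by (subst cosquot_scale[abs_def]) (simp add: scale_square)
qed

text \<open>Product-to-sum turns the modulated kernel into a second difference of
  \<open>cosquot\<close> in the frequency. Its integral is thus a multiple of
  \<open>|r + \<xi>| + |r - \<xi>| - 2 * |\<xi>|\<close>, a tent that is zero once
  \<open>|\<xi>| \<ge> r\<close>.\<close>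

lemma fejer_cos:
  assumes "r \<noteq> 0"
  shows "fejer r t * cos (t * \<xi>) = (cosquot (r + \<xi>) t + cosquot (r - \<xi>) t - 2 * cosquot \<xi> t) / r\<^sup>2"
proof (cases "t = 0")
  case True
  then show ?thesis using assms by (simp add: fejer_def cosquot_def field_simps power2_eq_square)
next
  case False
  have "cos ((r + \<xi>) * t) + cos ((r - \<xi>) * t) = 2 * cos (r * t) * cos (t * \<xi>)"
    by (simp add: algebra_simps cos_add cos_diff)
  then have *: "2 * (1 - cos (r * t)) * cos (t * \<xi>) =
      (1 - cos ((r + \<xi>) * t)) + (1 - cos ((r - \<xi>) * t)) - 2 * (1 - cos (\<xi> * t))"
    by (simp add: algebra_simps)
  have "fejer r t * cos (t * \<xi>) = (2 * (1 - cos (r * t)) * cos (t * \<xi>)) / t\<^sup>2 / r\<^sup>2"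
    using False by (simp add: fejer_def power_mult_distrib)
  also have "\<dots> = (cosquot (r + \<xi>) t + cosquot (r - \<xi>) t - 2 * cosquot \<xi> t) / r\<^sup>2"
    unfolding * using False by (simp add: cosquot_def add_divide_distrib diff_divide_distrib)
  finally show ?thesis .
qed

lemma fejer_even: "fejer r (- t) = fejer r t"
  by (simp add: fejer_def)

lemma integrable_cis_mult:
  fixes f :: "'a::euclidean_space \<Rightarrow> complex"
  assumes "integrable lborel f" "\<theta> \<in> borel_measurable borel"
  shows "integrable lborel (\<lambda>x. cis (\<theta> x) * f x)" "integrable lborel (\<lambda>x. f x * cis (\<theta> x))"
proof -
  have [measurable]: "f \<in> borel_measurable borel" "\<theta> \<in> borel_measurable borel"
    using borel_measurable_integrable[OF assms(1)] assms(2) by auto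
  have [measurable]: "cis \<in> borel_measurable borel"
    by (intro borel_measurable_continuous_onI continuous_intros)
  show "integrable lborel (\<lambda>x. cis (\<theta> x) * f x)"
    by (rule Bochner_Integration.integrable_bound[OF assms(1)]) (auto simp: norm_mult)
  then show "integrable lborel (\<lambda>x. f x * cis (\<theta> x))" by (simp add: mult.commute)
qed

lemma fourier_fejer:
  assumes "0 < r" "r \<le> 1" "\<bar>\<xi>\<bar> \<ge> r"
  shows "(\<integral>t. complex_of_real (fejer r t) * cis (t * \<xi>) \<partial>lborel) = 0"
proof -
  let ?I = "\<integral>t. complex_of_real (fejer r t) * cis (t * \<xi>) \<partial>lborel"
  let ?J = "\<integral>t. complex_of_real (fejer r t) * cis (- t * \<xi>) \<partial>lborel"
  have int: "integrable lborel (\<lambda>t. complex_of_real (fejer r t) * cis (t * \<xi>))" for \<xi>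
    by (intro integrable_cis_mult integrable_of_real integrable_fejer assms) auto
  \<comment> \<open>The kernel is even, so reflection replaces the exponential by its conjugate and
    only the cosine integral is left.\<close>
  have "?I = ?J"
    using lborel_integral_reflect[OF int[of \<xi>], of 0] by (simp add: fejer_even)
  moreover have "?I + ?J = (\<integral>t. complex_of_real (2 * (fejer r t * cos (t * \<xi>))) \<partial>lborel)"
  proof -
    have "?I + ?J = (\<integral>t. complex_of_real (fejer r t) * cis (t * \<xi>) + complex_of_real (fejer r t) * cis (- t * \<xi>) \<partial>lborel)"
      using int[of \<xi>] int[of "-\<xi>"] by (intro Bochner_Integration.integral_add[symmetric]) auto
    also have "\<dots> = (\<integral>t. complex_of_real (2 * (fejer r t * cos (t * \<xi>))) \<partial>lborel)"
      by (intro Bochner_Integration.integral_cong) (auto simp: complex_eq_iff)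
    finally show ?thesis .
  qed
  moreover have "(\<integral>t. fejer r t * cos (t * \<xi>) \<partial>lborel) = 0"
  proof -
    have "has_bochner_integral lborel (\<lambda>t. fejer r t * cos (t * \<xi>))
      ((\<bar>r + \<xi>\<bar> * integral\<^sup>L lborel (cosquot 1) + \<bar>r - \<xi>\<bar> * integral\<^sup>L lborel (cosquot 1)
        - 2 * (\<bar>\<xi>\<bar> * integral\<^sup>L lborel (cosquot 1))) / r\<^sup>2)"
      unfolding fejer_cos[OF less_imp_neq[OF assms(1), symmetric]]
      by (intro has_bochner_integral_divide has_bochner_integral_diff has_bochner_integral_add
          has_bochner_integral_mult_right has_integral_cosquot)
    moreover have "\<bar>r + \<xi>\<bar> + \<bar>r - \<xi>\<bar> - 2 * \<bar>\<xi>\<bar> = 0"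
      using assms by linarith
    then have "\<bar>r + \<xi>\<bar> * c + \<bar>r - \<xi>\<bar> * c - 2 * (\<bar>\<xi>\<bar> * c) = 0" for c :: real
      by (metis (no_types) distrib_right left_diff_distrib mult.assoc mult_zero_left)
    ultimately show ?thesis by (simp add: has_bochner_integral_iff)
  qed
  ultimately have "?I + ?I = 0"
    by (simp only: integral_complex_of_real integral_mult_right_zero) simp
  then show ?thesis by simp
qed

lemma fourier_fejer_shift:
  assumes "0 < r" "r \<le> 1" "\<bar>\<xi>\<bar> \<ge> r"
  shows "(\<integral>t. complex_of_real (fejer r (t - \<alpha>)) * cis (t * \<xi>) \<partial>lborel) = 0"
proof -
  have "integrable lborel (\<lambda>t. complex_of_real (fejer r (t - \<alpha>)) * cis (t * \<xi>))"
    using lborel_integrable_shift[OF integrable_fejer, of r "-\<alpha>"] assms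
    by (intro integrable_cis_mult integrable_of_real) auto
  from lborel_integral_shift[OF this, of \<alpha>]
  have "(\<integral>t. complex_of_real (fejer r (t - \<alpha>)) * cis (t * \<xi>) \<partial>lborel) =
      (\<integral>t. cis (\<alpha> * \<xi>) * (complex_of_real (fejer r t) * cis (t * \<xi>)) \<partial>lborel)"
    unfolding distrib_right cis_mult[symmetric] by (simp only: add_diff_cancel_right' mult.left_commute[of "cis (\<alpha> * \<xi>)"] mult.commute[of _ "cis (\<alpha> * \<xi>)"])
  then show ?thesis using fourier_fejer[OF assms] by simp
qed

text \<open>The inverse transform of the tent. It writes a Fejer kernel as a superposition of
  frequencies of modulus at most \<open>r\<close>, so that a product of two kernels becomes a
  mixture of modulations of one of them.\<close>

lemma fejer_repr:
  assumes "r \<noteq> 0"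
  shows "(\<integral>y. indicator {0..1} y *\<^sub>R (2 * (1 - y) * cos (r * t * y)) \<partial>lborel) = fejer r t"
proof (cases "t = 0")
  case True
  have "(\<integral>y. indicator {0..1} y *\<^sub>R (2 * (1 - y) * cos (r * t * y)) \<partial>lborel) = (2 * 1 - 1\<^sup>2) - (2 * 0 - 0\<^sup>2 :: real)"
    using True by (intro integral_FTC_Icc)
      (auto intro!: derivative_eq_intros continuous_intros simp: has_real_derivative_iff_has_vector_derivative[symmetric])
  then show ?thesis using True by (simp add: fejer_def)
next
  case False
  define c where "c = r * t"
  have c: "c \<noteq> 0" using False assms by (simp add: c_def)
  let ?F = "\<lambda>y. 2 * (1 - y) * sin (c * y) / c - 2 * cos (c * y) / c\<^sup>2"
  have "(\<integral>y. indicator {0..1} y *\<^sub>R (2 * (1 - y) * cos (c * y)) \<partial>lborel) = ?F 1 - ?F 0"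
    using c by (intro integral_FTC_Icc)
      (auto intro!: derivative_eq_intros continuous_intros simp: has_real_derivative_iff_has_vector_derivative[symmetric]
         field_simps power2_eq_square)
  then show ?thesis using False c by (simp add: fejer_def c_def[symmetric] field_simps)
qed

text \<open>Once the second kernel is expanded by \<open>fejer_repr\<close>, the parameter
  \<open>y\<close> moves the frequency to \<open>\<xi> + r * y\<close> and
  \<open>\<xi> - r * y\<close>. Both still have modulus at least \<open>2 * r - r\<close>, where the
  first kernel has no spectrum.\<close>

lemma fourier_fejer_prod:
  assumes r: "0 < r" "r \<le> 1" and \<xi>: "\<bar>\<xi>\<bar> \<ge> 2 * r"
  shows "(\<integral>t. complex_of_real (fejer r (t - \<alpha>) * fejer r (t - \<beta>)) * cis (t * \<xi>) \<partial>lborel) = 0"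
proof -
  define K where "K y t = complex_of_real (indicator {0..1} y * (2 * (1 - y) * cos (r * (t - \<beta>) * y)) *
     fejer r (t - \<alpha>)) * cis (t * \<xi>)" for y t :: real
  have [measurable]: "cis \<in> borel_measurable borel"
    by (intro borel_measurable_continuous_onI continuous_intros)
  have sh: "integrable lborel (\<lambda>t. fejer r (t - \<alpha>))"
    using lborel_integrable_shift[OF integrable_fejer, of r "-\<alpha>"] r by simp
  have K: "integrable (lborel \<Otimes>\<^sub>M lborel) (case_prod K)"
  proof (rule integrable_pair_bound)
    show "case_prod K \<in> borel_measurable (lborel \<Otimes>\<^sub>M lborel)"
      unfolding K_def by measurable
    show "norm (case_prod K (y, t)) \<le> (2 * indicator {0..1} y) * fejer r (t - \<alpha>)" for y t
    proof -
      have "\<bar>2 * (1 - y) * cos (r * (t - \<beta>) * y)\<bar> \<le> 2 * 1" if "y \<in> {0..1}"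
        unfolding abs_mult using that by (intro mult_mono) auto
      moreover have "norm (K y t) = \<bar>indicator {0..1} y * (2 * (1 - y) * cos (r * (t - \<beta>) * y))\<bar> * fejer r (t - \<alpha>)"
        unfolding K_def norm_mult norm_of_real norm_cis
        by (simp only: abs_mult abs_of_nonneg[OF fejer_nonneg] mult_1_right)
      ultimately have "norm (K y t) \<le> (2 * indicator {0..1} y) * fejer r (t - \<alpha>)"
        by (simp only:) (intro mult_right_mono fejer_nonneg, auto split: split_indicator)
      then show ?thesis by simp
    qed
    show "integrable lborel (\<lambda>t. (2 * indicator {0..1} y) * fejer r (t - \<alpha>))" for y :: real
      by (intro integrable_mult_right sh)
    show "(\<integral>t. (2 * indicator {0..1} y) * fejer r (t - \<alpha>) \<partial>lborel) = 2 * indicator {0..1} y * (\<integral>t. fejer r (t - \<alpha>) \<partial>lborel)" for y :: real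
      using sh by simp
    show "integrable lborel (\<lambda>y::real. 2 * indicator {0..1} y :: real)"
      by (intro integrable_mult_right integrable_real_indicator) auto
  qed
  have "(\<integral>t. K y t \<partial>lborel) = 0" for y
  proof (cases "y \<in> {0..1}")
    case True
    then have y: "0 \<le> r * y" "r * y \<le> r" using r by (auto simp: mult_le_cancel_left1)
    let ?g = "\<lambda>\<xi> t. complex_of_real (fejer r (t - \<alpha>)) * cis (t * \<xi>)"
    have int: "integrable lborel (?g \<xi>)" for \<xi>
      by (intro integrable_cis_mult integrable_of_real sh) auto
    have eq: "K y t = complex_of_real (1 - y) * (cis (- r * \<beta> * y) * ?g (\<xi> + r * y) t + cis (r * \<beta> * y) * ?g (\<xi> - r * y) t)" for t
    proof -
      have c: "complex_of_real (2 * cos \<theta>) = cis \<theta> + cis (- \<theta>)" for \<theta>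
        by (simp add: complex_eq_iff)
      have "K y t = complex_of_real (1 - y) * (complex_of_real (2 * cos (r * (t - \<beta>) * y)) * ?g \<xi> t)"
        using True by (simp add: K_def)
      also have "complex_of_real (2 * cos (r * (t - \<beta>) * y)) * ?g \<xi> t =
          complex_of_real (fejer r (t - \<alpha>)) * (cis (r * (t - \<beta>) * y) * cis (t * \<xi>) + cis (- (r * (t - \<beta>) * y)) * cis (t * \<xi>))"
        unfolding c by (simp add: algebra_simps)
      also have "\<dots> = cis (- r * \<beta> * y) * ?g (\<xi> + r * y) t + cis (r * \<beta> * y) * ?g (\<xi> - r * y) t"
        by (simp add: cis_mult algebra_simps)
      finally show ?thesis .
    qed
    have "r \<le> \<bar>\<xi> + r * y\<bar>" "r \<le> \<bar>\<xi> - r * y\<bar>"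
      using \<xi> y by (auto simp: abs_if split: if_splits)
    then show ?thesis
      unfolding eq using int fourier_fejer_shift[OF r] by simp
  qed (simp add: K_def)
  then have "(\<integral>y. (\<integral>t. K y t \<partial>lborel) \<partial>lborel) = 0" by simp
  then have "(\<integral>t. (\<integral>y. K y t \<partial>lborel) \<partial>lborel) = 0"
    using lborel_pair.Fubini_integral[OF K] by simp
  moreover have "(\<integral>y. K y t \<partial>lborel) = complex_of_real (fejer r (t - \<alpha>) * fejer r (t - \<beta>)) * cis (t * \<xi>)" for t
  proof -
    have "(\<integral>y. K y t \<partial>lborel) = (\<integral>y. (complex_of_real (fejer r (t - \<alpha>)) * cis (t * \<xi>)) *
       complex_of_real (indicator {0..1} y *\<^sub>R (2 * (1 - y) * cos (r * (t - \<beta>) * y))) \<partial>lborel)"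
      by (intro Bochner_Integration.integral_cong) (auto simp: K_def)
    also have "\<dots> = (complex_of_real (fejer r (t - \<alpha>)) * cis (t * \<xi>)) * 
        (\<integral>y. complex_of_real (indicator {0..1} y *\<^sub>R (2 * (1 - y) * cos (r * (t - \<beta>) * y))) \<partial>lborel)"
      by (rule integral_mult_right_zero)
    also have "(\<integral>y. complex_of_real (indicator {0..1} y *\<^sub>R (2 * (1 - y) * cos (r * (t - \<beta>) * y))) \<partial>lborel)
       = complex_of_real (fejer r (t - \<beta>))"
      using fejer_repr[of r "t - \<beta>"] r by (subst integral_complex_of_real) simp
    finally show ?thesis by simp
  qed
  ultimately show ?thesis by simp
qed

subsection \<open>Decay weights and band-limited envelopes\<close>

text \<open>Peetre's inequality \<open>1 + |t| \<le> (1 + |s|) * (1 + |s - t|)\<close>, squared: a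
  shift costs only a polynomial factor in its length.\<close>

lemma decay_shift: "decay s \<le> decay t * (1 + \<bar>s - t\<bar>)\<^sup>2"
proof -
  have "\<bar>t\<bar> \<le> \<bar>s\<bar> + \<bar>s - t\<bar>" by linarith
  also have "\<dots> \<le> \<bar>s\<bar> + \<bar>s - t\<bar> + \<bar>s\<bar> * \<bar>s - t\<bar>" by simp
  finally have "1 + \<bar>t\<bar> \<le> (1 + \<bar>s\<bar>) * (1 + \<bar>s - t\<bar>)"
    by (simp add: distrib_left distrib_right)
  then have "(1 + \<bar>t\<bar>)\<^sup>2 \<le> (1 + \<bar>s\<bar>)\<^sup>2 * (1 + \<bar>s - t\<bar>)\<^sup>2"
    unfolding power_mult_distrib[symmetric] by (intro power_mono) auto
  then show ?thesis
    unfolding decay_def by (simp add: field_simps add_pos_nonneg)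
qed

text \<open>\<open>1 + |s - t|\<close> is below \<open>A + B\<close>, and
  \<open>A\<^sup>2 + B\<^sup>2\<close> divided by \<open>A\<^sup>2 * B\<^sup>2\<close> is
  \<open>1 / A\<^sup>2 + 1 / B\<^sup>2\<close>. The separation of two bumps is thereby extracted as
  a factor, and an integrable function remains.\<close>

lemma decay_mult_le: "decay s * decay t \<le> 2 * decay (s - t) * (decay s + decay t)"
proof -
  define A B where "A = 1 + \<bar>s\<bar>" and "B = 1 + \<bar>t\<bar>"
  have pos: "0 < A" "0 < B" by (auto simp: A_def B_def add_pos_nonneg)
  have "(1 + \<bar>s - t\<bar>)\<^sup>2 \<le> (A + B)\<^sup>2"
    by (intro power_mono) (auto simp: A_def B_def)
  also have "\<dots> \<le> 2 * (A\<^sup>2 + B\<^sup>2)"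
    using sum_squares_bound[of A B] by (simp add: power2_sum)
  finally have le: "(1 + \<bar>s - t\<bar>)\<^sup>2 \<le> 2 * (A\<^sup>2 + B\<^sup>2)" .
  have "decay s * decay t = (1 + \<bar>s - t\<bar>)\<^sup>2 * (decay (s - t) * (1 / A\<^sup>2) * (1 / B\<^sup>2))"
    by (simp add: decay_def A_def[symmetric] B_def[symmetric] add_pos_nonneg)
  also have "\<dots> \<le> 2 * (A\<^sup>2 + B\<^sup>2) * (decay (s - t) * (1 / A\<^sup>2) * (1 / B\<^sup>2))"
    using le by (intro mult_right_mono) (auto intro!: divide_nonneg_nonneg less_imp_le[OF decay_pos])
  also have "\<dots> = 2 * decay (s - t) * (1 / A\<^sup>2 + 1 / B\<^sup>2)"
    using pos by (simp add: field_simps)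
  finally show ?thesis by (simp add: decay_def A_def B_def)
qed

lemma summable_decay: "summable (\<lambda>n. decay (real n))"
proof -
  have "summable (\<lambda>n. inverse ((real (Suc n))\<^sup>2))"
    using inverse_power_summable[of 2, where 'a=real] by (subst summable_Suc_iff) simp
  then show ?thesis by (simp add: decay_def inverse_eq_divide)
qed

text \<open>On each side of \<open>t\<close> the integers are counted injectively by
  \<open>\<lfloor>t\<rfloor> - j\<close> or \<open>j - \<lceil>t\<rceil>\<close>, which are lower
  bounds for their distance to \<open>t\<close>. The two sides account for the factor 2.\<close>

lemma sum_decay_le:
  assumes "finite S"
  shows "(\<Sum>j\<in>S. decay (t - real j)) \<le> 2 * (\<Sum>n. decay (real n))"
proof -
  have mono: "decay u \<le> decay v" if "\<bar>v\<bar> \<le> \<bar>u\<bar>" for u v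
    unfolding decay_def using that by (intro divide_left_mono power_mono mult_pos_pos) (auto simp: add_pos_nonneg)
  have part: "(\<Sum>j\<in>A. decay (t - real j)) \<le> (\<Sum>n. decay (real n))"
    if "finite A" "inj_on g A" "\<And>j. j \<in> A \<Longrightarrow> real (g j) \<le> \<bar>t - real j\<bar>" for A and g :: "nat \<Rightarrow> nat"
  proof -
    have "(\<Sum>j\<in>A. decay (t - real j)) \<le> (\<Sum>j\<in>A. decay (real (g j)))"
      by (intro sum_mono mono) (use that(3) in auto)
    also have "\<dots> = (\<Sum>n\<in>g ` A. decay (real n))"
      using that(2) by (simp add: sum.reindex)
    also have "\<dots> \<le> (\<Sum>n. decay (real n))"
      using that(1) by (intro sum_le_suminf summable_decay) (auto intro: less_imp_le[OF decay_pos])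
    finally show ?thesis .
  qed
  have "(\<Sum>j\<in>S. decay (t - real j)) = (\<Sum>j\<in>{j\<in>S. real j \<le> t}. decay (t - real j)) + (\<Sum>j\<in>{j\<in>S. \<not> real j \<le> t}. decay (t - real j))"
    using assms by (subst sum.union_disjoint[symmetric]) (auto intro!: sum.cong)
  also have "(\<Sum>j\<in>{j\<in>S. real j \<le> t}. decay (t - real j)) \<le> (\<Sum>n. decay (real n))"
  proof (rule part)
    show "inj_on (\<lambda>j. nat (\<lfloor>t\<rfloor> - int j)) {j\<in>S. real j \<le> t}"
      by (auto simp: inj_on_def le_floor_iff nat_eq_iff2 eq_nat_nat_iff)
    show "real (nat (\<lfloor>t\<rfloor> - int j)) \<le> \<bar>t - real j\<bar>" if "j \<in> {j\<in>S. real j \<le> t}" for j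
      using that of_int_floor_le[of t] by (auto simp: of_nat_nat le_floor_iff)
  qed (use assms in auto)
  also have "(\<Sum>j\<in>{j\<in>S. \<not> real j \<le> t}. decay (t - real j)) \<le> (\<Sum>n. decay (real n))"
  proof (rule part)
    have *: "\<lceil>t\<rceil> \<le> int j" if "\<not> real j \<le> t" for j
      using that by (simp add: ceiling_le_iff)
    show "inj_on (\<lambda>j. nat (int j - \<lceil>t\<rceil>)) {j\<in>S. \<not> real j \<le> t}"
      using * by (auto simp: inj_on_def eq_nat_nat_iff)
    show "real (nat (int j - \<lceil>t\<rceil>)) \<le> \<bar>t - real j\<bar>" if "j \<in> {j\<in>S. \<not> real j \<le> t}" for j
      using that *[of j] le_of_int_ceiling[of t] by (auto simp: of_nat_nat)
  qed (use assms in auto)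
  finally show ?thesis by simp
qed

section \<open>Product weights and band-limited envelopes in several dimensions\<close>

text \<open>A product over coordinates rather than a power of the norm, so that integrals split and
  a translation along a basis vector affects one factor only.\<close>

definition weight :: "'a::euclidean_space \<Rightarrow> real" where
  "weight x = (\<Prod>b\<in>Basis. decay (x \<bullet> b))"

lemma weight_pos: "0 < weight x"
  unfolding weight_def by (intro prod_pos decay_pos)

lemma weight_le_1: "weight x \<le> 1"
  unfolding weight_def by (intro prod_le_1) (auto intro: decay_le_1 less_imp_le[OF decay_pos])

lemma weight_measurable [measurable]: "weight \<in> borel_measurable borel"
  unfolding weight_def by measurable

lemma integrable_weight: "integrable lborel weight"
  unfolding weight_def by (intro integrable_prod_Basis integrable_decay)

lemma weight_shift: "weight x \<le> weight y * (1 + norm (x - y)) ^ (2 * DIM('a))" for x y :: "'a::euclidean_space"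
proof -
  have "weight x \<le> (\<Prod>b\<in>(Basis::'a set). decay (y \<bullet> b) * (1 + norm (x - y))\<^sup>2)"
    unfolding weight_def
  proof (intro prod_mono conjI)
    fix b :: 'a assume b: "b \<in> Basis"
    have "decay (x \<bullet> b) \<le> decay (y \<bullet> b) * (1 + \<bar>(x - y) \<bullet> b\<bar>)\<^sup>2"
      using decay_shift[of "x \<bullet> b" "y \<bullet> b"] by (simp add: inner_diff_left)
    also have "\<dots> \<le> decay (y \<bullet> b) * (1 + norm (x - y))\<^sup>2"
      using Basis_le_norm[OF b, of "x - y"] by (intro mult_left_mono power_mono) (auto intro: less_imp_le[OF decay_pos])
    finally show "decay (x \<bullet> b) \<le> decay (y \<bullet> b) * (1 + norm (x - y))\<^sup>2" .
  qed (auto intro: less_imp_le[OF decay_pos])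
  also have "\<dots> = weight y * (1 + norm (x - y)) ^ (2 * DIM('a))"
    by (simp add: weight_def prod.distrib power_mult)
  finally show ?thesis .
qed

text \<open>Peetre's inequality from the origin, where the weight is 1. It turns polynomial decay
  into an integrable majorant.\<close>

lemma inverse_power_le_weight: "1 / (1 + norm x) ^ (2 * DIM('a)) \<le> weight x" for x :: "'a::euclidean_space"
  using weight_shift[of 0 x] zero_less_power[of "1 + norm x" "2 * DIM('a)"]
  by (simp add: weight_def[of 0] decay_def divide_le_eq add_pos_nonneg)

lemma
  fixes v :: "'a::euclidean_space"
  shows integrable_weight_shift: "integrable lborel (\<lambda>x. weight (x - v))"
    and integral_weight_shift: "(\<integral>x. weight (x - v) \<partial>lborel) = integral\<^sup>L lborel (weight :: 'a \<Rightarrow> real)"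
  using lborel_integrable_shift[OF integrable_weight, of "- v"] lborel_integral_shift[OF integrable_weight, of "- v"]
  by simp_all

lemma weight_axis:
  fixes e :: "'a::euclidean_space"
  assumes "e \<in> Basis"
  shows "weight (x - y *\<^sub>R e) = decay (x \<bullet> e - y) * (\<Prod>b\<in>Basis - {e}. decay (x \<bullet> b))"
proof -
  have "weight (x - y *\<^sub>R e) = decay ((x - y *\<^sub>R e) \<bullet> e) * (\<Prod>b\<in>Basis - {e}. decay ((x - y *\<^sub>R e) \<bullet> b))"
    unfolding weight_def using assms by (intro prod.remove) auto
  also have "(\<Prod>b\<in>Basis - {e}. decay ((x - y *\<^sub>R e) \<bullet> b)) = (\<Prod>b\<in>Basis - {e}. decay (x \<bullet> b))"
    using assms by (intro prod.cong) (auto simp: inner_diff_left inner_Basis)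
  finally show ?thesis using assms by (simp add: inner_diff_left)
qed

text \<open>Behind pointwise convergence of the series: at the price of quadratic growth in
  \<open>x\<close>, a bump centred at \<open>y *\<^sub>R e\<close> is as small as
  \<open>decay y\<close>.\<close>

lemma weight_axis_le:
  assumes "e \<in> Basis"
  shows "weight (x - y *\<^sub>R e) \<le> decay y * (1 + norm x)\<^sup>2"
proof -
  have "(\<Prod>b\<in>Basis - {e}. decay (x \<bullet> b)) \<le> 1"
    by (intro prod_le_1) (auto intro: decay_le_1 less_imp_le[OF decay_pos])
  then have "weight (x - y *\<^sub>R e) \<le> decay (x \<bullet> e - y) * 1"
    unfolding weight_axis[OF assms] by (intro mult_left_mono) (auto intro: less_imp_le[OF decay_pos])
  also have "decay (x \<bullet> e - y) = decay (y - x \<bullet> e)"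
    by (simp add: decay_def abs_minus_commute)
  also have "decay (y - x \<bullet> e) * 1 \<le> decay y * (1 + \<bar>x \<bullet> e\<bar>)\<^sup>2"
    using decay_shift[of "y - x \<bullet> e" y] by simp
  also have "\<dots> \<le> decay y * (1 + norm x)\<^sup>2"
    using Basis_le_norm[OF assms, of x] by (intro mult_left_mono power_mono) (auto intro: less_imp_le[OF decay_pos])
  finally show ?thesis .
qed

text \<open>This is \<open>decay_mult_le\<close> in the coordinate \<open>e\<close>; the other
  coordinates give the same factor \<open>R \<le> 1\<close> twice, and one copy is dropped.\<close>

lemma weight_mult_axis_le:
  fixes e :: "'a::euclidean_space"
  assumes "e \<in> Basis"
  shows "weight (x - y *\<^sub>R e) * weight (x - z *\<^sub>R e)
    \<le> 2 * decay (y - z) * (weight (x - y *\<^sub>R e) + weight (x - z *\<^sub>R e))"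
proof -
  define R where "R = (\<Prod>b\<in>Basis - {e}. decay (x \<bullet> b))"
  have R: "0 \<le> R" "R \<le> 1"
    unfolding R_def by (auto intro!: prod_nonneg prod_le_1 decay_le_1 less_imp_le[OF decay_pos])
  define s t where "s = x \<bullet> e - y" and "t = x \<bullet> e - z"
  have "decay (s - t) = decay (y - z)"
    by (simp add: decay_def s_def t_def abs_minus_commute)
  then have "decay s * decay t * (R * R) \<le> (2 * decay (y - z) * (decay s + decay t)) * (R * 1)"
    using decay_mult_le[of s t] R
    by (intro mult_mono[OF _ mult_left_mono])
      (auto intro!: mult_nonneg_nonneg add_nonneg_nonneg less_imp_le[OF decay_pos])
  then show ?thesis
    unfolding weight_axis[OF assms] R_def[symmetric] s_def[symmetric] t_def[symmetric]
    by (simp add: algebra_simps)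
qed

text \<open>The width is chosen such that the Fourier transform is supported in the ball of radius \<open>1/4\<close>.\<close>

definition envelope :: "'a::euclidean_space \<Rightarrow> real" where
  "envelope x = (\<Prod>b\<in>Basis. fejer (1 / (4 * real DIM('a))) (x \<bullet> b))"

lemma envelope_width: "0 < 1 / (4 * real DIM('a::euclidean_space))" "1 / (4 * real DIM('a)) \<le> 1"
  using DIM_positive[where 'a='a] by (auto simp: field_simps simp del: DIM_positive)

lemma envelope_nonneg: "0 \<le> envelope x"
  unfolding envelope_def by (intro prod_nonneg) (auto intro: fejer_nonneg)

lemma envelope_le_1: "envelope x \<le> 1"
  unfolding envelope_def by (intro prod_le_1) (auto intro: fejer_nonneg fejer_le_1)

lemma envelope_measurable [measurable]: "envelope \<in> borel_measurable borel"
  unfolding envelope_def by measurable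

lemma envelope_le_weight: "\<exists>C>0. \<forall>x::'a::euclidean_space. envelope x \<le> C * weight x"
proof (intro exI conjI allI)
  let ?r = "1 / (4 * real DIM('a))"
  show "0 < (16 / ?r\<^sup>2) ^ DIM('a)"
    using envelope_width(1)[where 'a='a] by (intro zero_less_power divide_pos_pos) auto
  fix x :: 'a
  have "envelope x \<le> (\<Prod>b\<in>(Basis::'a set). 16 / ?r\<^sup>2 * decay (x \<bullet> b))"
    unfolding envelope_def by (intro prod_mono conjI fejer_nonneg fejer_le_decay envelope_width)
  then show "envelope x \<le> (16 / ?r\<^sup>2) ^ DIM('a) * weight x"
    by (simp add: prod.distrib weight_def del: times_divide_eq_left)
qed

lemma integrable_envelope: "integrable lborel (envelope :: 'a::euclidean_space \<Rightarrow> real)"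
  unfolding envelope_def by (intro integrable_prod_Basis integrable_fejer envelope_width)

lemma
  fixes v :: "'a::euclidean_space"
  shows integrable_envelope_shift: "integrable lborel (\<lambda>x. envelope (x - v))"
    and integral_envelope_shift: "(\<integral>x. envelope (x - v) \<partial>lborel) = integral\<^sup>L lborel (envelope :: 'a \<Rightarrow> real)"
  using lborel_integrable_shift[OF integrable_envelope, of "- v"] lborel_integral_shift[OF integrable_envelope, of "- v"]
  by simp_all

lemma integrable_envelope_mult: "integrable lborel (\<lambda>x. envelope (x - u) * envelope (x - v))"
  by (rule Bochner_Integration.integrable_bound[OF integrable_envelope_shift[of u]])
    (auto simp: abs_mult envelope_nonneg intro!: mult_left_le envelope_le_1)

lemma prod_cis: "(\<Prod>b\<in>A. cis (f b)) = cis (\<Sum>b\<in>A. f b)"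
  by (induction A rule: infinite_finite_induct) (auto simp: cis_mult)

lemma cis_inner: "cis (x \<bullet> \<zeta>) = (\<Prod>b\<in>Basis. cis ((x \<bullet> b) * (\<zeta> \<bullet> b)))"
  unfolding prod_cis by (simp add: euclidean_inner[of x \<zeta>])

lemma large_coordinate:
  fixes \<zeta> :: "'a::euclidean_space"
  assumes "norm \<zeta> \<ge> c"
  shows "\<exists>b\<in>Basis. \<bar>\<zeta> \<bullet> b\<bar> \<ge> c / DIM('a)"
proof (rule ccontr)
  assume "\<not> ?thesis"
  then have "(\<Sum>b\<in>(Basis::'a set). \<bar>\<zeta> \<bullet> b\<bar>) < (\<Sum>b\<in>(Basis::'a set). c / DIM('a))"
    by (intro sum_strict_mono) auto
  then show False using norm_le_l1[of \<zeta>] assms by simp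
qed

lemma cis_measurable [measurable]: "cis \<in> borel_measurable borel"
  by (intro borel_measurable_continuous_onI continuous_intros)

text \<open>The norm is at most the sum of the moduli of the coordinates, so some coordinate of
  \<zeta> reaches the width \<open>1 / (4 * DIM('a))\<close>, and the factor for that coordinate
  already integrates to 0.\<close>

lemma fourier_envelope:
  fixes \<zeta> :: "'a::euclidean_space"
  assumes "norm \<zeta> \<ge> 1/4"
  shows "(\<integral>x. complex_of_real (envelope (x - v)) * cis (x \<bullet> \<zeta>) \<partial>lborel) = 0"
proof -
  let ?r = "1 / (4 * real DIM('a))"
  let ?F = "\<lambda>b t. complex_of_real (fejer ?r (t - v \<bullet> b)) * cis (t * (\<zeta> \<bullet> b))"
  have int: "integrable lborel (?F b)" for b
    using lborel_integrable_shift[OF integrable_fejer, of ?r "- (v \<bullet> b)"] envelope_width[where 'a='a]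
    by (intro integrable_cis_mult integrable_of_real) auto
  obtain b where b: "b \<in> Basis" "\<bar>\<zeta> \<bullet> b\<bar> \<ge> ?r"
    using large_coordinate[OF assms] by (auto simp: mult.commute)
  have "(\<integral>x. complex_of_real (envelope (x - v)) * cis (x \<bullet> \<zeta>) \<partial>lborel) = (\<integral>x. (\<Prod>b\<in>Basis. ?F b (x \<bullet> b)) \<partial>lborel)"
    by (simp add: envelope_def cis_inner prod.distrib inner_diff_left)
  also have "\<dots> = (\<Prod>b\<in>Basis. integral\<^sup>L lborel (?F b))"
    by (intro integral_prod_Basis int)
  also have "\<dots> = 0"
    using b fourier_fejer_shift[OF envelope_width[where 'a='a], of "\<zeta> \<bullet> b"] by auto
  finally show ?thesis .
qed

text \<open>Spectra add under multiplication, which doubles the radius.\<close>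

lemma fourier_envelope_mult:
  fixes \<zeta> :: "'a::euclidean_space"
  assumes "norm \<zeta> \<ge> 1/2"
  shows "(\<integral>x. complex_of_real (envelope (x - u) * envelope (x - v)) * cis (x \<bullet> \<zeta>) \<partial>lborel) = 0"
proof -
  let ?r = "1 / (4 * real DIM('a))"
  let ?F = "\<lambda>b t. complex_of_real (fejer ?r (t - u \<bullet> b) * fejer ?r (t - v \<bullet> b)) * cis (t * (\<zeta> \<bullet> b))"
  have int: "integrable lborel (?F b)" for b
  proof -
    have "integrable lborel (\<lambda>t. fejer ?r (t - u \<bullet> b))"
      using lborel_integrable_shift[OF integrable_fejer, of ?r "- (u \<bullet> b)"] envelope_width[where 'a='a] by simp
    then have "integrable lborel (\<lambda>t. fejer ?r (t - u \<bullet> b) * fejer ?r (t - v \<bullet> b))"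
      using envelope_width(1)[where 'a='a]
      by (rule_tac Bochner_Integration.integrable_bound)
        (auto simp: abs_mult abs_of_nonneg[OF fejer_nonneg] intro!: mult_left_le fejer_le_1 fejer_nonneg AE_I2)
    then show ?thesis
      by (intro integrable_cis_mult integrable_of_real) auto
  qed
  obtain b where b: "b \<in> Basis" "\<bar>\<zeta> \<bullet> b\<bar> \<ge> 2 * ?r"
    using large_coordinate[OF assms] by (auto simp: mult.commute)
  have "(\<integral>x. complex_of_real (envelope (x - u) * envelope (x - v)) * cis (x \<bullet> \<zeta>) \<partial>lborel)
      = (\<integral>x. (\<Prod>b\<in>Basis. ?F b (x \<bullet> b)) \<partial>lborel)"
    by (simp add: envelope_def cis_inner prod.distrib inner_diff_left)
  also have "\<dots> = (\<Prod>b\<in>Basis. integral\<^sup>L lborel (?F b))"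
    by (intro integral_prod_Basis int)
  also have "\<dots> = 0"
    using b fourier_fejer_prod[OF envelope_width[where 'a='a], of "\<zeta> \<bullet> b" "u \<bullet> b" "v \<bullet> b"] by auto
  finally show ?thesis .
qed

subsection \<open>Fourier decay of dyadic multipliers\<close>

lemma schwartz_bound:
  assumes "f \<in> schwartz" "set vs \<subseteq> Basis"
  shows "\<exists>C\<ge>0. \<forall>x. (1 + norm x) ^ N * norm (partials vs f x) \<le> C"
proof -
  have "bounded (range (\<lambda>x. (1 + norm x) ^ N *\<^sub>R partials vs f x))"
    using assms by (auto simp: schwartz_def)
  then obtain B where B: "0 < B" "\<forall>x. norm ((1 + norm x) ^ N *\<^sub>R partials vs f x) \<le> B"
    unfolding bounded_pos by auto
  then show ?thesis by (intro exI[of _ B]) auto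
qed

lemma schwartz_differentiable:
  "f \<in> schwartz \<Longrightarrow> set vs \<subseteq> Basis \<Longrightarrow> partials vs f differentiable (at x)"
  by (auto simp: schwartz_def smooth_fun_def)

lemma schwartz_measurable:
  assumes "f \<in> schwartz" "set vs \<subseteq> Basis"
  shows "partials vs f \<in> borel_measurable borel"
  by (intro borel_measurable_continuous_onI continuous_at_imp_continuous_on ballI
      differentiable_imp_continuous_within schwartz_differentiable assms)

lemma schwartz_le_weight:
  fixes f :: "'a::euclidean_space \<Rightarrow> complex"
  assumes "f \<in> schwartz" "set vs \<subseteq> Basis"
  shows "\<exists>C\<ge>0. \<forall>x. (1 + norm x) ^ N * norm (partials vs f x) \<le> C * weight x"
proof -
  obtain C where C: "C \<ge> 0" "\<And>x. (1 + norm x) ^ (2 * DIM('a) + N) * norm (partials vs f x) \<le> C"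
    using schwartz_bound[OF assms, of "2 * DIM('a) + N"] by blast
  have "(1 + norm x) ^ N * norm (partials vs f x) \<le> C * weight x" for x
  proof -
    have pos: "0 < (1 + norm x) ^ (2 * DIM('a))" by (intro zero_less_power) (simp add: add_pos_nonneg)
    have "(1 + norm x) ^ N * norm (partials vs f x) \<le> C * (1 / (1 + norm x) ^ (2 * DIM('a)))"
      using C(2)[of x] pos by (simp add: power_add field_simps)
    also have "\<dots> \<le> C * weight x"
      using C(1) inverse_power_le_weight[of x] by (intro mult_left_mono) auto
    finally show ?thesis .
  qed
  then show ?thesis using C(1) by blast
qed

lemma schwartz_integrable_weighted:
  assumes "f \<in> schwartz" "set vs \<subseteq> Basis"
  shows "integrable lborel (\<lambda>x. (1 + norm x) ^ N * norm (partials vs f x))"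
proof -
  obtain C where C: "C \<ge> 0" "\<And>x. (1 + norm x) ^ N * norm (partials vs f x) \<le> C * weight x"
    using schwartz_le_weight[OF assms] by blast
  have [measurable]: "partials vs f \<in> borel_measurable borel" by (rule schwartz_measurable[OF assms])
  show ?thesis
    by (rule Bochner_Integration.integrable_bound[OF integrable_mult_right[OF integrable_weight, of C]])
      (auto intro: order_trans[OF C(2) abs_ge_self])
qed

lemma schwartz_integrable:
  assumes "f \<in> schwartz" "set vs \<subseteq> Basis"
  shows "integrable lborel (partials vs f)"
  using schwartz_integrable_weighted[OF assms, of 0] schwartz_measurable[OF assms]
  by (simp add: integrable_norm_iff)

text \<open>A real \<open>SUP\<close> dominates its members only over a bounded set. Boundedness
  holds because finitely many lists of basis vectors have length at most \<open>N\<close>, so that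
  their individual bounds can be summed.\<close>

lemma le_schwartz_seminorm:
  fixes f :: "'a::euclidean_space \<Rightarrow> complex"
  assumes "f \<in> schwartz"
  shows "(1 + norm x) ^ N * norm (f x) \<le> schwartz_seminorm N f"
proof -
  let ?V = "{vs. set vs \<subseteq> (Basis :: 'a set) \<and> length vs \<le> N}"
  have fin: "finite ?V" by (intro finite_lists_length_le) auto
  have "\<forall>vs\<in>?V. \<exists>C\<ge>0. \<forall>x. (1 + norm x) ^ N * norm (partials vs f x) \<le> C"
    using schwartz_bound[OF assms] by blast
  from bchoice[OF this] obtain C
    where "\<forall>vs\<in>?V. 0 \<le> C vs \<and> (\<forall>x. (1 + norm x) ^ N * norm (partials vs f x) \<le> C vs)"
    by blast
  then have C: "\<And>vs. vs \<in> ?V \<Longrightarrow> 0 \<le> C vs"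
      "\<And>vs x. vs \<in> ?V \<Longrightarrow> (1 + norm x) ^ N * norm (partials vs f x) \<le> C vs"
    by blast+
  have "C vs \<le> sum C ?V" if "vs \<in> ?V" for vs
    using fin C(1) that by (intro member_le_sum) auto
  then have "bdd_above ((\<lambda>(vs, x). (1 + norm x) ^ N * norm (partials vs f x)) ` (?V \<times> UNIV))"
  proof (intro bdd_aboveI2[where M="sum C ?V"])
    fix vx assume "vx \<in> ?V \<times> (UNIV :: 'a set)"
    then obtain vs x where "vx = (vs, x)" "vs \<in> ?V" by blast
    then show "(case vx of (vs, x) \<Rightarrow> (1 + norm x) ^ N * norm (partials vs f x)) \<le> sum C ?V"
      using order_trans[OF C(2)[of vs x] \<open>\<And>vs. vs \<in> ?V \<Longrightarrow> C vs \<le> sum C ?V\<close>[of vs]] by simp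
  qed
  from cSUP_upper[OF _ this, of "([], x)"] show ?thesis
    by (simp add: schwartz_seminorm_def)
qed

section \<open>Fourier transforms of Schwartz functions, uniformly under dilation\<close>

text \<open>\<open>fourier\<close> without its normalising constant. Evaluated at
  \<open>x - y\<close> it is the convolution kernel of a Fourier multiplier.\<close>

definition ft :: "('a::euclidean_space \<Rightarrow> complex) \<Rightarrow> 'a \<Rightarrow> complex" where
  "ft F z = (\<integral>\<xi>. F \<xi> * cis (- (z \<bullet> \<xi>)) \<partial>lborel)"

lemma ft_measurable [measurable]:
  assumes [measurable]: "F \<in> borel_measurable borel"
  shows "ft F \<in> borel_measurable borel"
  unfolding ft_def by measurable

lemma ft_integrand: "integrable lborel F \<Longrightarrow> integrable lborel (\<lambda>\<xi>. F \<xi> * cis (- (z \<bullet> \<xi>)))"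
  by (intro integrable_cis_mult) auto

lemma norm_ft_le: "norm (ft F z) \<le> (\<integral>\<xi>. norm (F \<xi>) \<partial>lborel)"
  unfolding ft_def by (rule order_trans[OF integral_norm_bound]) (simp add: norm_mult)

lemma cis_difference_quotient:
  "(\<lambda>n. (cis (inverse (real (Suc n)) * c) - 1) / inverse (real (Suc n))) \<longlonglongrightarrow> \<i> * c"
proof -
  have "((\<lambda>z. exp (\<i> * c * z)) has_field_derivative \<i> * c) (at 0)"
    by (auto intro!: derivative_eq_intros)
  then have lim: "((\<lambda>h. (exp (\<i> * c * h) - 1) / h) \<longlongrightarrow> \<i> * c) (at 0)"
    by (simp add: has_field_derivative_iff)
  have "filterlim (\<lambda>n. complex_of_real (inverse (real (Suc n)))) (at 0) sequentially"
    unfolding filterlim_at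
    using tendsto_of_real[OF LIMSEQ_inverse_real_of_nat, where 'a=complex] by (auto simp del: of_nat_Suc)
  from filterlim_compose[OF lim this] show ?thesis
    by (simp add: cis_conv_exp mult_ac del: of_nat_Suc)
qed

text \<open>Difference quotients take the place of integration by parts: translation invariance
  gives their transforms exactly, as \<open>(cis (h * (z \<bullet> b)) - 1) / h\<close> times
  \<open>ft F z\<close>, and dominated convergence passes to the derivative.\<close>

lemma ft_partial:
  fixes F :: "'a::euclidean_space \<Rightarrow> complex"
  assumes diff: "\<And>x. F differentiable (at x)" and b: "b \<in> Basis"
    and D[measurable]: "(\<lambda>x. frechet_derivative F (at x) b) \<in> borel_measurable borel"
    and F: "integrable lborel F"
    and bd: "\<And>x. (1 + norm x) ^ (2 * DIM('a)) * norm (frechet_derivative F (at x) b) \<le> C"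
  shows "ft (\<lambda>x. frechet_derivative F (at x) b) z = \<i> * complex_of_real (z \<bullet> b) * ft F z"
proof -
  define D where "D x = frechet_derivative F (at x)" for x
  have D: "(F has_derivative D x) (at x)" for x
    using diff[of x] by (simp add: frechet_derivative_works[symmetric] D_def)
  define h where "h n = inverse (real (Suc n))" for n
  have h: "0 < h n" "h n \<le> 1" for n by (auto simp: h_def inverse_le_1_iff)
  define q where "q n \<xi> = (F (\<xi> + h n *\<^sub>R b) - F \<xi>) / h n" for n \<xi>
  have Fm [measurable]: "F \<in> borel_measurable borel" using borel_measurable_integrable[OF F] by simp
  have qm [measurable]: "q n \<in> borel_measurable borel" for n unfolding q_def by measurable
  have nb: "norm b = 1" using b by simp
  have C: "0 \<le> C" by (rule order_trans[OF _ bd[of 0]]) simp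
  define W where "W x = C * 2 ^ (2 * DIM('a)) * weight x" for x :: 'a
  have q_le: "norm (q n \<xi>) \<le> W \<xi>" for n \<xi>
  proof -
    \<comment> \<open>A step of length at most 1 changes \<open>1 + norm \<xi>\<close> by at most a
      factor 2; this is the source of \<open>2 ^ (2 * DIM('a))\<close>.\<close>
    define B where "B = C * 2 ^ (2 * DIM('a)) / (1 + norm \<xi>) ^ (2 * DIM('a))"
    have Db: "norm (D (\<xi> + s *\<^sub>R b) b) \<le> B" if s: "0 \<le> s" "s \<le> 1" for s
    proof -
      have "norm \<xi> \<le> norm (\<xi> + s *\<^sub>R b) + norm (s *\<^sub>R b)"
        by (metis add_diff_cancel norm_triangle_ineq4)
      then have "1 + norm \<xi> \<le> 2 * (1 + norm (\<xi> + s *\<^sub>R b))"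
      proof -
        have "norm (s *\<^sub>R b) = s" using s nb by simp
        moreover have "1 + x \<le> 2 * (1 + y)" if "x \<le> y + s" "0 \<le> y" for x y unfolding distrib_left using that s by linarith
        ultimately show ?thesis using \<open>norm \<xi> \<le> _\<close> by (metis norm_ge_zero)
      qed
      then have "(1 + norm \<xi>) ^ (2 * DIM('a)) \<le> 2 ^ (2 * DIM('a)) * (1 + norm (\<xi> + s *\<^sub>R b)) ^ (2 * DIM('a))"
        unfolding power_mult_distrib[symmetric] by (intro power_mono) auto
      then have "(1 + norm \<xi>) ^ (2 * DIM('a)) * norm (D (\<xi> + s *\<^sub>R b) b) \<le>
          2 ^ (2 * DIM('a)) * ((1 + norm (\<xi> + s *\<^sub>R b)) ^ (2 * DIM('a)) * norm (D (\<xi> + s *\<^sub>R b) b))"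
        unfolding mult.assoc[symmetric] by (intro mult_right_mono) auto
      also have "\<dots> \<le> 2 ^ (2 * DIM('a)) * C"
        using bd[of "\<xi> + s *\<^sub>R b"] by (intro mult_left_mono) (auto simp: D_def)
      finally show ?thesis
        unfolding B_def using zero_less_power[of "1 + norm \<xi>" "2 * DIM('a)"]
        by (simp add: pos_le_divide_eq add_pos_nonneg mult.commute)
    qed
    have "norm (F (\<xi> + h n *\<^sub>R b) - F (\<xi> + 0 *\<^sub>R b)) \<le> B * norm (h n - 0)"
    proof (rule differentiable_bound[where S="{0..1}" and f'="\<lambda>s t. D (\<xi> + s *\<^sub>R b) (t *\<^sub>R b)"])
      fix s :: real assume s: "s \<in> {0..1}"
      show "((\<lambda>s. F (\<xi> + s *\<^sub>R b)) has_derivative (\<lambda>t. D (\<xi> + s *\<^sub>R b) (t *\<^sub>R b))) (at s within {0..1})"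
        by (rule has_derivative_compose[OF _ D]) (auto intro!: derivative_eq_intros)
      show "onorm (\<lambda>t. D (\<xi> + s *\<^sub>R b) (t *\<^sub>R b)) \<le> B"
      proof (rule onorm_le)
        fix t :: real
        have "D (\<xi> + s *\<^sub>R b) (t *\<^sub>R b) = t *\<^sub>R D (\<xi> + s *\<^sub>R b) b"
          using has_derivative_bounded_linear[OF D, of "\<xi> + s *\<^sub>R b"] by (simp add: linear_simps)
        then show "norm (D (\<xi> + s *\<^sub>R b) (t *\<^sub>R b)) \<le> B * norm t"
          using mult_right_mono[OF Db[of s], of "\<bar>t\<bar>"] s by (simp add: mult.commute)
      qed
    qed (use h[of n] in auto)
    then have "norm (q n \<xi>) \<le> B"
      using h[of n] by (simp add: q_def norm_divide divide_le_eq)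
    also have "B \<le> W \<xi>"
      unfolding B_def W_def using mult_left_mono[OF inverse_power_le_weight[of \<xi>], of "C * 2 ^ (2 * DIM('a))"] C
      by simp
    finally show ?thesis .
  qed
  have q_lim: "(\<lambda>n. q n \<xi>) \<longlonglongrightarrow> D \<xi> b" for \<xi>
  proof -
    have lim: "((\<lambda>y. norm (F (\<xi> + y) - F \<xi> - D \<xi> y) / norm y) \<longlongrightarrow> 0) (at 0)"
      using D[of \<xi>] by (simp add: has_derivative_at)
    have "filterlim (\<lambda>n. h n *\<^sub>R b) (at 0) sequentially"
      unfolding filterlim_at h_def
      using tendsto_scaleR[OF LIMSEQ_inverse_real_of_nat tendsto_const[of b]] nb by (auto simp del: of_nat_Suc)
    from filterlim_compose[OF lim this]
    have "(\<lambda>n. norm (F (\<xi> + h n *\<^sub>R b) - F \<xi> - D \<xi> (h n *\<^sub>R b)) / norm (h n *\<^sub>R b)) \<longlonglongrightarrow> 0" .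
    moreover have "norm (F (\<xi> + h n *\<^sub>R b) - F \<xi> - D \<xi> (h n *\<^sub>R b)) / norm (h n *\<^sub>R b) = norm (q n \<xi> - D \<xi> b)" for n
    proof -
      have "D \<xi> (h n *\<^sub>R b) = h n *\<^sub>R D \<xi> b"
        using has_derivative_bounded_linear[OF D, of \<xi>] by (simp add: linear_simps)
      then have "q n \<xi> - D \<xi> b = (F (\<xi> + h n *\<^sub>R b) - F \<xi> - D \<xi> (h n *\<^sub>R b)) / h n"
        using h(1)[of n] by (simp add: q_def scaleR_conv_of_real diff_divide_distrib)
      then show ?thesis using h(1)[of n] nb by (simp add: norm_divide)
    qed
    ultimately show ?thesis
      by (simp add: tendsto_norm_zero_iff LIM_zero_iff)
  qed
  have "(\<lambda>n. ft (q n) z) \<longlonglongrightarrow> ft (\<lambda>x. D x b) z"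
    unfolding ft_def
  proof (rule integral_dominated_convergence[where w=W])
    show "integrable lborel W" unfolding W_def by (intro integrable_mult_right integrable_weight)
    show "AE \<xi> in lborel. (\<lambda>n. q n \<xi> * cis (- (z \<bullet> \<xi>))) \<longlonglongrightarrow> D \<xi> b * cis (- (z \<bullet> \<xi>))"
      by (intro AE_I2 tendsto_intros q_lim)
    show "AE \<xi> in lborel. norm (q n \<xi> * cis (- (z \<bullet> \<xi>))) \<le> W \<xi>" for n
      using q_le by (simp add: norm_mult)
    have "(\<lambda>x. D x b) \<in> borel_measurable borel" unfolding D_def by measurable
    then show "(\<lambda>\<xi>. D \<xi> b * cis (- (z \<bullet> \<xi>))) \<in> borel_measurable lborel" by measurable
  qed measurable
  moreover have "ft (q n) z = (cis (h n * (z \<bullet> b)) - 1) / h n * ft F z" for n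
  proof -
    let ?G = "\<lambda>\<xi>. F \<xi> * cis (- (z \<bullet> \<xi>))"
    have G: "integrable lborel ?G" by (rule ft_integrand[OF F])
    have "ft (q n) z = (\<integral>\<xi>. (cis (h n * (z \<bullet> b)) * ?G (\<xi> + h n *\<^sub>R b) - ?G \<xi>) / h n \<partial>lborel)"
      unfolding ft_def q_def
    proof (intro Bochner_Integration.integral_cong refl)
      fix \<xi>
      have "cis (h n * (z \<bullet> b)) * cis (- (z \<bullet> (\<xi> + h n *\<^sub>R b))) = cis (- (z \<bullet> \<xi>))"
        by (simp add: cis_mult inner_add_right)
      then show "(F (\<xi> + h n *\<^sub>R b) - F \<xi>) / complex_of_real (h n) * cis (- (z \<bullet> \<xi>)) =
        (cis (h n * (z \<bullet> b)) * (F (\<xi> + h n *\<^sub>R b) * cis (- (z \<bullet> (\<xi> + h n *\<^sub>R b)))) - F \<xi> * cis (- (z \<bullet> \<xi>))) / complex_of_real (h n)"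
        by (simp add: mult.left_commute[of "cis (h n * (z \<bullet> b))"] left_diff_distrib)
    qed
    also have "\<dots> = (cis (h n * (z \<bullet> b)) * (\<integral>\<xi>. ?G (\<xi> + h n *\<^sub>R b) \<partial>lborel) - (\<integral>\<xi>. ?G \<xi> \<partial>lborel)) / h n"
      using G lborel_integrable_shift[OF G, of "h n *\<^sub>R b"] by simp
    also have "\<dots> = (cis (h n * (z \<bullet> b)) - 1) / h n * ft F z"
      unfolding lborel_integral_shift[OF G] by (simp add: ft_def left_diff_distrib)
    finally show ?thesis .
  qed
  then have "(\<lambda>n. ft (q n) z) \<longlonglongrightarrow> \<i> * complex_of_real (z \<bullet> b) * ft F z"
    using tendsto_mult_right[OF cis_difference_quotient[of "z \<bullet> b"], of "ft F z"]
    by (simp add: h_def del: of_nat_Suc)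
  ultimately show ?thesis
    unfolding D_def by (rule LIMSEQ_unique)
qed

lemma ft_partials_replicate:
  fixes f :: "'a::euclidean_space \<Rightarrow> complex"
  assumes f: "f \<in> schwartz" and b: "b \<in> Basis"
  shows "ft (partials (replicate n b) f) z = (\<i> * complex_of_real (z \<bullet> b)) ^ n * ft f z"
proof (induction n)
  case (Suc n)
  have s: "set (replicate m b) \<subseteq> Basis" for m using b by (cases m) auto
  obtain C where C: "\<And>x. (1 + norm x) ^ (2 * DIM('a)) * norm (partials (replicate (Suc n) b) f x) \<le> C"
    using schwartz_bound[OF f s] by blast
  have "ft (partials (replicate (Suc n) b) f) z = \<i> * complex_of_real (z \<bullet> b) * ft (partials (replicate n b) f) z"
    unfolding replicate_Suc partials.simps
    by (rule ft_partial[OF schwartz_differentiable[OF f s] b _ schwartz_integrable[OF f s]])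
      (use C schwartz_measurable[OF f s, of "Suc n"] in auto)
  then show ?case using Suc by simp
qed simp

text \<open>Differentiating \<open>n\<close> times in a coordinate with
  \<open>|z \<bullet> b| \<ge> norm z / DIM('a)\<close> gains the whole power. The coordinate
  depends on \<open>z\<close>, hence the sum over \<open>Basis\<close> in the bound.\<close>

lemma ft_schwartz_decay:
  fixes f :: "'a::euclidean_space \<Rightarrow> complex"
  assumes f: "f \<in> schwartz"
  shows "\<exists>C. \<forall>z. (1 + norm z) ^ n * norm (ft f z) \<le> C"
proof -
  define A where "A b = (\<integral>\<xi>. norm (partials (replicate n b) f \<xi>) \<partial>lborel)" for b
  have A0: "0 \<le> A b" for b unfolding A_def by simp
  define I where "I = (\<integral>\<xi>. norm (f \<xi>) \<partial>lborel)"
  have I0: "0 \<le> I" unfolding I_def by simp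
  let ?d = "real DIM('a)"
  have "(1 + norm z) ^ n * norm (ft f z) \<le> 2 ^ n * I + (2 * ?d) ^ n * sum A Basis" for z
  proof (cases "norm z \<le> 1")
    case True
    then have "(1 + norm z) ^ n * norm (ft f z) \<le> 2 ^ n * I"
      using norm_ft_le[of f z] by (intro mult_mono power_mono) (auto simp: I_def)
    moreover have "0 \<le> (2 * ?d) ^ n * sum A Basis"
      by (intro mult_nonneg_nonneg sum_nonneg A0) auto
    ultimately show ?thesis by linarith
  next
    case False
    obtain b where b: "b \<in> Basis" "norm z / ?d \<le> \<bar>z \<bullet> b\<bar>"
      using large_coordinate[of "norm z" z] by auto
    have "1 + norm z \<le> 2 * ?d * \<bar>z \<bullet> b\<bar>"
      using False b(2) DIM_positive[where 'a='a] by (simp add: field_simps del: DIM_positive)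
    then have "(1 + norm z) ^ n * norm (ft f z) \<le> (2 * ?d * \<bar>z \<bullet> b\<bar>) ^ n * norm (ft f z)"
      by (intro mult_right_mono power_mono) auto
    also have "\<dots> = (2 * ?d) ^ n * norm (ft (partials (replicate n b) f) z)"
      unfolding ft_partials_replicate[OF f b(1)] by (simp add: norm_mult norm_power power_mult_distrib)
    also have "\<dots> \<le> (2 * ?d) ^ n * sum A Basis"
      using norm_ft_le[of "partials (replicate n b) f" z] member_le_sum[OF b(1), of A] A0
      by (intro mult_left_mono) (auto simp: A_def)
    also have "\<dots> \<le> 2 ^ n * I + (2 * ?d) ^ n * sum A Basis" using I0 by simp
    finally show ?thesis .
  qed
  then show ?thesis by blast
qed

lemma ft_schwartz_integrable:
  fixes f :: "'a::euclidean_space \<Rightarrow> complex"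
  assumes f: "f \<in> schwartz"
  shows "integrable lborel (\<lambda>z. (1 + norm z) ^ n * norm (ft f z))"
proof -
  obtain C where C: "\<And>z. (1 + norm z) ^ (2 * DIM('a) + n) * norm (ft f z) \<le> C"
    using ft_schwartz_decay[OF f] by blast
  have C0: "0 \<le> C" by (rule order_trans[OF _ C[of 0]]) simp
  have [measurable]: "ft f \<in> borel_measurable borel"
    using schwartz_measurable[OF f, of "[]"] by (intro ft_measurable) simp
  have "(1 + norm z) ^ n * norm (ft f z) \<le> C * weight z" for z
  proof -
    have pos: "0 < (1 + norm z) ^ (2 * DIM('a))" by (intro zero_less_power) (simp add: add_pos_nonneg)
    have "(1 + norm z) ^ n * norm (ft f z) \<le> C * (1 / (1 + norm z) ^ (2 * DIM('a)))"
      using C[of z] pos by (simp add: power_add field_simps)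
    also have "\<dots> \<le> C * weight z"
      using C0 inverse_power_le_weight[of z] by (intro mult_left_mono) auto
    finally show ?thesis .
  qed
  then show ?thesis
    by (intro Bochner_Integration.integrable_bound[OF integrable_mult_right[OF integrable_weight, of C]])
      (auto intro: order_trans[OF _ abs_ge_self])
qed

lemma ft_scale:
  fixes F :: "'a::euclidean_space \<Rightarrow> complex"
  assumes F: "integrable lborel F" and c: "0 < c"
  shows "integrable lborel (\<lambda>\<xi>. F (c *\<^sub>R \<xi>))" "ft (\<lambda>\<xi>. F (c *\<^sub>R \<xi>)) z = inverse (c ^ DIM('a)) *\<^sub>R ft F (z /\<^sub>R c)"
proof -
  have "has_bochner_integral lborel (\<lambda>\<xi>. F (0 + c *\<^sub>R \<xi>)) (inverse (\<bar>c\<bar> ^ DIM('a)) *\<^sub>R integral\<^sup>L lborel F)"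
    using F c by (intro lborel_has_integral_affine) (auto simp: has_bochner_integral_iff)
  then show "integrable lborel (\<lambda>\<xi>. F (c *\<^sub>R \<xi>))" by (simp add: has_bochner_integral_iff)
  let ?G = "\<lambda>\<xi>. F \<xi> * cis (- ((z /\<^sub>R c) \<bullet> \<xi>))"
  have "has_bochner_integral lborel (\<lambda>\<xi>. ?G (0 + c *\<^sub>R \<xi>)) (inverse (\<bar>c\<bar> ^ DIM('a)) *\<^sub>R integral\<^sup>L lborel ?G)"
    using ft_integrand[OF F, of "z /\<^sub>R c"] c by (intro lborel_has_integral_affine) (auto simp: has_bochner_integral_iff)
  then show "ft (\<lambda>\<xi>. F (c *\<^sub>R \<xi>)) z = inverse (c ^ DIM('a)) *\<^sub>R ft F (z /\<^sub>R c)"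
    using c by (simp add: has_bochner_integral_iff ft_def mult.assoc[symmetric])
qed

text \<open>Dilating \<open>f\<close> by \<open>c \<le> 1\<close> concentrates its transform without
  changing the \<open>L_1\<close> norm, and since \<open>norm z \<le> norm (z /\<^sub>R c)\<close>
  the weighted norm can only drop. The bound is therefore uniform in \<open>c\<close>.\<close>

lemma ft_scale_integral:
  fixes f :: "'a::euclidean_space \<Rightarrow> complex"
  assumes f: "f \<in> schwartz" and c: "0 < c" "c \<le> 1"
  shows "integrable lborel (\<lambda>z. (1 + norm z) ^ n * norm (ft (\<lambda>\<xi>. f (c *\<^sub>R \<xi>)) z))"
    and "(\<integral>z. (1 + norm z) ^ n * norm (ft (\<lambda>\<xi>. f (c *\<^sub>R \<xi>)) z) \<partial>lborel)
      \<le> (\<integral>z. (1 + norm z) ^ n * norm (ft f z) \<partial>lborel)"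
proof -
  have F: "integrable lborel f" using schwartz_integrable[OF f, of "[]"] by simp
  have fm [measurable]: "f \<in> borel_measurable borel" using borel_measurable_integrable[OF F] by simp
  let ?G = "\<lambda>z. (1 + norm z) ^ n * norm (ft f z)"
  have "has_bochner_integral lborel (\<lambda>z. ?G (0 + inverse c *\<^sub>R z)) (inverse (\<bar>inverse c\<bar> ^ DIM('a)) *\<^sub>R integral\<^sup>L lborel ?G)"
    using c by (intro lborel_has_integral_affine) (auto simp: has_bochner_integral_iff ft_schwartz_integrable[OF f])
  from has_bochner_integral_mult_right[of "inverse (c ^ DIM('a))", OF this]
  have G: "has_bochner_integral lborel (\<lambda>z. inverse (c ^ DIM('a)) * ?G (z /\<^sub>R c)) (integral\<^sup>L lborel ?G)"
    using c by (simp add: power_inverse mult.assoc[symmetric])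
  have le: "(1 + norm z) ^ n * norm (ft (\<lambda>\<xi>. f (c *\<^sub>R \<xi>)) z) \<le> inverse (c ^ DIM('a)) * ?G (z /\<^sub>R c)" for z
  proof -
    have "norm z \<le> norm (z /\<^sub>R c)"
      using c mult_right_mono[of c 1 "norm z"] by (simp add: field_simps)
    then have "(1 + norm z) ^ n * norm (ft f (z /\<^sub>R c)) \<le> ?G (z /\<^sub>R c)"
      by (intro mult_right_mono power_mono) auto
    then have "inverse (c ^ DIM('a)) * ((1 + norm z) ^ n * norm (ft f (z /\<^sub>R c))) \<le> inverse (c ^ DIM('a)) * ?G (z /\<^sub>R c)"
      using c by (intro mult_left_mono) auto
    then show ?thesis
      unfolding ft_scale(2)[OF F c(1)] using c by (simp add: mult.left_commute)
  qed
  have [measurable]: "ft (\<lambda>\<xi>. f (c *\<^sub>R \<xi>)) \<in> borel_measurable borel"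
    by (intro ft_measurable) measurable
  show int: "integrable lborel (\<lambda>z. (1 + norm z) ^ n * norm (ft (\<lambda>\<xi>. f (c *\<^sub>R \<xi>)) z))"
  proof (rule Bochner_Integration.integrable_bound[OF integrable.intros[OF G]])
    show "AE z in lborel. norm ((1 + norm z) ^ n * norm (ft (\<lambda>\<xi>. f (c *\<^sub>R \<xi>)) z))
        \<le> norm (inverse (c ^ DIM('a)) * ?G (z /\<^sub>R c))"
      using order_trans[OF le abs_ge_self] by (intro AE_I2) (simp only: real_norm_def abs_mult abs_norm_cancel power_abs abs_of_nonneg[OF add_nonneg_nonneg[OF zero_le_one norm_ge_zero]])
  qed measurable
  show "(\<integral>z. (1 + norm z) ^ n * norm (ft (\<lambda>\<xi>. f (c *\<^sub>R \<xi>)) z) \<partial>lborel)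
      \<le> (\<integral>z. (1 + norm z) ^ n * norm (ft f z) \<partial>lborel)"
    unfolding has_bochner_integral_integral_eq[OF G, symmetric]
    by (rule integral_mono[OF int integrable.intros[OF G] le])
qed

lemma dyadic_integrable:
  fixes \<phi>0 :: "'a::euclidean_space \<Rightarrow> complex"
  assumes "\<phi>0 \<in> schwartz"
  shows "integrable lborel (dyadic \<phi>0 j)"
proof -
  have "integrable lborel \<phi>0" using schwartz_integrable[OF assms, of "[]"] by simp
  then show ?thesis
    unfolding dyadic_def by (auto intro!: Bochner_Integration.integrable_diff ft_scale(1))
qed

lemma ft_dyadic_bound:
  fixes \<phi>0 :: "'a::euclidean_space \<Rightarrow> complex"
  assumes f: "\<phi>0 \<in> schwartz"
  shows "\<exists>C. \<forall>j. integrable lborel (\<lambda>z. (1 + norm z) ^ n * norm (ft (dyadic \<phi>0 j) z)) \<and>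
     (\<integral>z. (1 + norm z) ^ n * norm (ft (dyadic \<phi>0 j) z) \<partial>lborel) \<le> C"
proof (intro exI allI)
  fix j :: nat
  let ?B = "\<integral>z. (1 + norm z) ^ n * norm (ft \<phi>0 z) \<partial>lborel"
  let ?I = "\<lambda>f z. (1 + norm z) ^ n * norm (ft f z)"
  have B0: "0 \<le> ?B" by simp
  have F: "integrable lborel \<phi>0" using schwartz_integrable[OF f, of "[]"] by simp
  show "integrable lborel (?I (dyadic \<phi>0 j)) \<and> (\<integral>z. ?I (dyadic \<phi>0 j) z \<partial>lborel) \<le> 2 * ?B"
  proof (cases "j = 0")
    case True
    then show ?thesis using ft_schwartz_integrable[OF f, of n] B0 by (simp add: dyadic_def)
  next
    case False
    define c d :: real where "c = 2 powr - real j" and "d = 2 powr (- real j + 1)"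
    have c: "0 < c" "c \<le> 1" by (auto simp: c_def powr_minus inverse_le_1_iff ge_one_powr_ge_zero)
    \<comment> \<open>Here \<open>j \<ge> 1\<close> keeps the larger of the two dilation factors at
      most 1.\<close>
    have d: "0 < d" "d \<le> 1" using False powr_mono[of "- real j + 1" 0 2] by (auto simp: d_def)
    have eq: "dyadic \<phi>0 j = (\<lambda>x. \<phi>0 (c *\<^sub>R x) - \<phi>0 (d *\<^sub>R x))"
      using False by (simp add: dyadic_def c_def d_def)
    have ft: "ft (dyadic \<phi>0 j) z = ft (\<lambda>x. \<phi>0 (c *\<^sub>R x)) z - ft (\<lambda>x. \<phi>0 (d *\<^sub>R x)) z" for z
      unfolding eq ft_def left_diff_distrib
      by (intro Bochner_Integration.integral_diff ft_integrand ft_scale(1) F c d)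
    have le: "?I (dyadic \<phi>0 j) z \<le> ?I (\<lambda>x. \<phi>0 (c *\<^sub>R x)) z + ?I (\<lambda>x. \<phi>0 (d *\<^sub>R x)) z" for z
      unfolding ft distrib_left[symmetric] by (intro mult_left_mono norm_triangle_ineq4) auto
    note cd = ft_scale_integral[OF f c, of n] ft_scale_integral[OF f d, of n]
    have [measurable]: "ft (dyadic \<phi>0 j) \<in> borel_measurable borel"
      using borel_measurable_integrable[OF dyadic_integrable[OF f]] by (intro ft_measurable) simp
    have int: "integrable lborel (?I (dyadic \<phi>0 j))"
      by (rule Bochner_Integration.integrable_bound[OF Bochner_Integration.integrable_add[OF cd(1,3)]])
        (auto intro!: AE_I2 le)
    moreover have "(\<integral>z. ?I (dyadic \<phi>0 j) z \<partial>lborel) \<le> ?B + ?B"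
    proof -
      have "(\<integral>z. ?I (dyadic \<phi>0 j) z \<partial>lborel) \<le> (\<integral>z. ?I (\<lambda>x. \<phi>0 (c *\<^sub>R x)) z + ?I (\<lambda>x. \<phi>0 (d *\<^sub>R x)) z \<partial>lborel)"
        by (rule integral_mono[OF int Bochner_Integration.integrable_add[OF cd(1,3)] le])
      then show ?thesis using cd by simp
    qed
    ultimately show ?thesis by simp
  qed
qed

text \<open>For \<open>i < j\<close> every argument of \<open>\<phi>0\<close> lies outside its
  support; for \<open>i \<ge> j + 2\<close> both arguments lie where \<open>\<phi>0\<close> is 1,
  and the difference cancels.\<close>

lemma dyadic_vanishes:
  fixes \<phi>0 :: "'a::euclidean_space \<Rightarrow> complex"
  assumes gen: "dyadic_generator \<phi>0" and \<xi>: "2 ^ j < norm \<xi>" "norm \<xi> < 2 ^ Suc j" and i: "i \<noteq> j" "i \<noteq> Suc j"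
  shows "dyadic \<phi>0 i \<xi> = 0"
proof -
  have out: "\<phi>0 x = 0" if "norm x > 2" for x
    using gen that closure_subset[of "{x. \<phi>0 x \<noteq> 0}"] by (force simp: dyadic_generator_def)
  have in1: "\<phi>0 x = 1" if "norm x \<le> 1" for x
    using gen that by (auto simp: dyadic_generator_def)
  have sc: "norm (2 powr - real i *\<^sub>R \<xi>) = norm \<xi> / 2 ^ i"
    "norm (2 powr (- real i + 1) *\<^sub>R \<xi>) = 2 * norm \<xi> / 2 ^ i"
    by (simp_all add: powr_diff powr_minus powr_realpow divide_inverse mult.commute)
  show ?thesis
  proof (cases "i < j")
    case True
    then have "(2::real) * 2 ^ i \<le> 2 ^ j"
      using power_increasing[of "Suc i" j "2::real"] by simp
    then have "2 * 2 ^ i < norm \<xi>" using \<xi> by linarith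
    then have "norm \<xi> > 2" "norm \<xi> / 2 ^ i > 2" "2 * norm \<xi> / 2 ^ i > 2"
      using one_le_power[of "2::real" i] by (auto simp: less_divide_eq, linarith+)
    then show ?thesis
      using out[of "2 powr (- real i) *\<^sub>R \<xi>"] out[of "2 powr (- real i + 1) *\<^sub>R \<xi>"] out[of \<xi>]
      unfolding dyadic_def sc by simp
  next
    case False
    then have "Suc (Suc j) \<le> i" using i by auto
    then have "(2::real) * 2 ^ Suc j \<le> 2 ^ i"
      using power_increasing[of "Suc (Suc j)" i "2::real"] by simp
    then have "2 * norm \<xi> \<le> 2 ^ i" using \<xi> by linarith
    moreover from this have "norm \<xi> \<le> 2 ^ i" using norm_ge_zero[of \<xi>] by linarith
    ultimately have "norm \<xi> / 2 ^ i \<le> 1" "2 * norm \<xi> / 2 ^ i \<le> 1"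
      by (simp_all add: divide_le_eq)
    then show ?thesis
      using \<open>Suc (Suc j) \<le> i\<close> in1[of "2 powr (- real i) *\<^sub>R \<xi>"] in1[of "2 powr (- real i + 1) *\<^sub>R \<xi>"]
      unfolding dyadic_def sc by simp
  qed
qed

subsection \<open>Lacunary series of modulated envelopes\<close>

lemma epowr_ennreal: "0 \<le> x \<Longrightarrow> epowr (ennreal x) r = ennreal (x powr r)"
  by (simp add: epowr_def)

lemma epowr_top [simp]: "epowr top r = top"
  by (simp add: epowr_def)

lemma epowr_mono:
  assumes "x \<le> y" "0 \<le> r"
  shows "epowr x r \<le> epowr y r"
proof (cases y)
  case (real s)
  with assms obtain t where "x = ennreal t" "0 \<le> t" by (cases x) (auto simp: top_unique)
  then show ?thesis using real assms by (auto simp: epowr_ennreal intro!: ennreal_leI powr_mono2)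
qed simp

text \<open>The second summand turns the frequencies of a block \<open>2 ^ n \<le> j < 2 ^ (n + 1)\<close> into odd
  multiples of a common number.\<close>

definition freq :: "nat \<Rightarrow> real" where
  "freq j = 2 ^ j + 2 ^ (2 ^ floor_log j) / 4"

text \<open>The margin 1/2 at both ends exceeds the spectral radius 1/4 of the envelope, so a
  modulated envelope keeps its spectrum strictly inside the annulus.\<close>

lemma freq_bounds: "2 ^ j + 1 / 2 \<le> freq j" "freq j \<le> 2 ^ Suc j - 1 / 2"
proof -
  have "(2::real) ^ 1 \<le> 2 ^ (2 ^ floor_log j)"
    by (intro power_increasing) auto
  then show "2 ^ j + 1 / 2 \<le> freq j" by (simp add: freq_def)
  have "(2::real) ^ (2 ^ floor_log j) / 4 \<le> 2 ^ j / 2"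
  \<comment> \<open>\<open>floor_log 0 = 0\<close>, so at \<open>j = 0\<close> both sides equal
    1/2.\<close>
  proof (cases "j = 0")
    case False
    then have "(2::real) ^ (2 ^ floor_log j) \<le> 2 ^ j"
      by (intro power_increasing floor_log_exp2_le) auto
    moreover have "(0::real) \<le> 2 ^ j" by simp
    ultimately show ?thesis by linarith
  qed simp
  moreover have "(1::real) \<le> 2 ^ j" by simp
  ultimately show "freq j \<le> 2 ^ Suc j - 1 / 2" unfolding freq_def power_Suc by linarith
qed

text \<open>1/2 is the threshold in \<open>fourier_envelope_mult\<close>: distinct waves are
  orthogonal wherever their envelopes are centred.\<close>

lemma freq_gap:
  assumes "j \<noteq> l"
  shows "\<bar>freq j - freq l\<bar> \<ge> 1 / 2"
proof -
  have *: "freq l - freq j \<ge> 1 / 2" if "j < l" for j l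
    using freq_bounds[of j] freq_bounds[of l] power_increasing[of "Suc j" l "2::real"] that by auto
  show ?thesis using *[of j l] *[of l j] assms by (cases "j < l") auto
qed

lemma one_plus_norm_le: "1 + norm x \<le> (1 + norm y) * (1 + norm (x - y))"
proof -
  have "norm x \<le> norm y + norm (x - y)" by (metis add.commute diff_add_cancel norm_triangle_ineq)
  also have "\<dots> \<le> norm y + norm (x - y) + norm y * norm (x - y)" by simp
  finally show ?thesis by (simp add: distrib_left distrib_right)
qed

text \<open>The condition on \<open>\<rho>\<close> makes the centres escape at least linearly, so
  that with \<open>a j \<le> 1\<close> the series converges everywhere. The factor 2 leaves room for
  centres \<open>2 ^ floor_log j\<close>, constant on blocks.\<close>

locale lacunary =
  fixes e :: "'a::euclidean_space" and a \<rho> :: "nat \<Rightarrow> real"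
  assumes e: "e \<in> Basis"
    and a_nonneg: "0 \<le> a j" and a_le_1: "a j \<le> 1"
    and \<rho>: "1 + real j \<le> 2 * (1 + \<bar>\<rho> j\<bar>)"
begin

definition wave :: "nat \<Rightarrow> 'a \<Rightarrow> complex" where
  "wave j x = cis (freq j * (x \<bullet> e)) * complex_of_real (envelope (x - \<rho> j *\<^sub>R e))"

definition series :: "'a \<Rightarrow> complex" where
  "series x = (\<Sum>j. complex_of_real (a j) * wave j x)"

definition functional :: "('a \<Rightarrow> complex) \<Rightarrow> complex" where
  "functional \<eta> = (\<integral>x. series x * \<eta> x \<partial>lborel)"

lemma norm_wave: "norm (wave j x) = envelope (x - \<rho> j *\<^sub>R e)"
  by (simp add: wave_def norm_mult envelope_nonneg)

lemma wave_measurable [measurable]: "wave j \<in> borel_measurable borel"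
  unfolding wave_def by measurable

lemma series_measurable [measurable]: "series \<in> borel_measurable borel"
  unfolding series_def by measurable

lemma decay_\<rho>_le: "decay (\<rho> j) \<le> 4 * decay (real j)"
proof -
  have "(1 + real j)\<^sup>2 \<le> (2 * (1 + \<bar>\<rho> j\<bar>))\<^sup>2"
    using \<rho>[of j] by (intro power_mono) auto
  then have "(1 + real j)\<^sup>2 \<le> 4 * (1 + \<bar>\<rho> j\<bar>)\<^sup>2"
    unfolding power_mult_distrib by simp
  then show ?thesis
    unfolding decay_def by (simp add: pos_divide_le_eq pos_le_divide_eq add_pos_nonneg)
qed

lemma summable_decay_\<rho>: "summable (\<lambda>j. decay (\<rho> j))"
  by (rule summable_comparison_test'[OF summable_mult[OF summable_decay, of 4]])
    (use decay_\<rho>_le in \<open>auto simp: less_imp_le[OF decay_pos]\<close>)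

lemma wave_bound: "\<exists>C>0. \<forall>j x. norm (complex_of_real (a j) * wave j x) \<le> C * decay (\<rho> j) * (1 + norm x)\<^sup>2"
proof -
  obtain C where C: "C > 0" "\<And>x::'a. envelope x \<le> C * weight x" using envelope_le_weight by blast
  have "norm (complex_of_real (a j) * wave j x) \<le> C * decay (\<rho> j) * (1 + norm x)\<^sup>2" for j x
  proof -
    have "norm (complex_of_real (a j) * wave j x) \<le> 1 * envelope (x - \<rho> j *\<^sub>R e)"
      unfolding norm_mult norm_wave using a_nonneg a_le_1 by (intro mult_right_mono) (auto intro: envelope_nonneg)
    also have "\<dots> \<le> C * weight (x - \<rho> j *\<^sub>R e)" using C(2) by simp
    also have "\<dots> \<le> C * (decay (\<rho> j) * (1 + norm x)\<^sup>2)"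
      using C(1) weight_axis_le[OF e] by (intro mult_left_mono) auto
    finally show ?thesis by simp
  qed
  then show ?thesis using C(1) by blast
qed

lemma summable_wave: "summable (\<lambda>j. norm (complex_of_real (a j) * wave j x))"
proof -
  obtain C where C: "\<And>j x. norm (complex_of_real (a j) * wave j x) \<le> C * decay (\<rho> j) * (1 + norm x)\<^sup>2"
    using wave_bound by blast
  show ?thesis
    by (rule summable_comparison_test'[OF summable_mult2[OF summable_mult[OF summable_decay_\<rho>, of C], of "(1 + norm x)\<^sup>2"]])
      (use C in auto)
qed

lemma series_bound: "\<exists>C\<ge>0. \<forall>x. norm (series x) \<le> C * (1 + norm x)\<^sup>2"
proof -
  obtain C where C: "C > 0" "\<And>j x. norm (complex_of_real (a j) * wave j x) \<le> C * decay (\<rho> j) * (1 + norm x)\<^sup>2"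
    using wave_bound by blast
  have "norm (series x) \<le> C * (\<Sum>j. decay (\<rho> j)) * (1 + norm x)\<^sup>2" for x
  proof -
    have "norm (series x) \<le> (\<Sum>j. norm (complex_of_real (a j) * wave j x))"
      unfolding series_def by (rule summable_norm[OF summable_wave])
    also have "\<dots> \<le> (\<Sum>j. C * decay (\<rho> j) * (1 + norm x)\<^sup>2)"
      by (intro suminf_le summable_wave C summable_mult2 summable_mult summable_decay_\<rho>)
    also have "\<dots> = C * (\<Sum>j. decay (\<rho> j)) * (1 + norm x)\<^sup>2"
      by (simp add: suminf_mult suminf_mult2[symmetric] summable_mult summable_decay_\<rho>)
    finally show ?thesis .
  qed
  moreover have "0 \<le> C * (\<Sum>j. decay (\<rho> j))"
    using C(1) by (intro mult_nonneg_nonneg suminf_nonneg summable_decay_\<rho>) (auto intro: less_imp_le[OF decay_pos])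
  ultimately show ?thesis by blast
qed

text \<open>Termwise integration. The majorants \<open>g j\<close> may vary with \<open>j\<close> as
  long as they share the mass \<open>M\<close>; in \<open>wave_correlation\<close> they are sums of
  two translates of the weight.\<close>

lemma
  fixes H :: "'a \<Rightarrow> complex"
  assumes [measurable]: "H \<in> borel_measurable borel"
    and summ: "summable c"
    and le: "\<And>j x. norm (complex_of_real (a j) * wave j x * H x) \<le> c j * g j x"
    and g: "\<And>j. integrable lborel (g j)" "\<And>j. (\<integral>x. g j x \<partial>lborel) = M"
  shows series_integrable: "integrable lborel (\<lambda>x. series x * H x)"
    and series_integral: "(\<lambda>j. complex_of_real (a j) * (\<integral>x. wave j x * H x \<partial>lborel)) sums (\<integral>x. series x * H x \<partial>lborel)"
proof -
  let ?f = "\<lambda>j x. complex_of_real (a j) * wave j x * H x"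
  have int: "integrable lborel (?f j)" for j
    by (rule Bochner_Integration.integrable_bound[OF integrable_mult_right[OF g(1), of "c j" j]])
      (auto simp del: norm_mult intro!: AE_I2 order_trans[OF le abs_ge_self])
  have sum: "summable (\<lambda>j. norm (?f j x))" for x
    using summable_mult2[OF summable_wave[of x], of "norm (H x)"] by (simp add: norm_mult)
  have sumint: "summable (\<lambda>j. \<integral>x. norm (?f j x) \<partial>lborel)"
  proof (rule summable_comparison_test')
    show "summable (\<lambda>j. c j * M)"
      by (intro summable_mult2 summ)
    show "norm (\<integral>x. norm (?f j x) \<partial>lborel) \<le> c j * M" for j
    proof -
      have "(\<integral>x. norm (?f j x) \<partial>lborel) \<le> (\<integral>x. c j * g j x \<partial>lborel)"
        by (intro integral_mono integrable_norm int integrable_mult_right g le)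
      then show ?thesis using g(2) by simp
    qed
  qed
  have eq: "(\<Sum>j. ?f j x) = series x * H x" for x
    unfolding series_def by (rule suminf_mult2[symmetric]) (rule summable_norm_cancel[OF summable_wave])
  show "integrable lborel (\<lambda>x. series x * H x)"
    using integrable_suminf[OF int _ sumint] sum by (simp add: eq)
  show "(\<lambda>j. complex_of_real (a j) * (\<integral>x. wave j x * H x \<partial>lborel)) sums (\<integral>x. series x * H x \<partial>lborel)"
    using sums_integral[OF int _ sumint] sum unfolding eq by (simp add: mult.assoc)
qed

lemma
  fixes H :: "'a \<Rightarrow> complex"
  assumes [measurable]: "H \<in> borel_measurable borel"
    and H: "integrable lborel (\<lambda>x. (1 + norm x)\<^sup>2 * norm (H x))"
  shows series_integrable_weighted: "integrable lborel (\<lambda>x. series x * H x)"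
    and series_integral_weighted: "(\<lambda>j. complex_of_real (a j) * (\<integral>x. wave j x * H x \<partial>lborel)) sums (\<integral>x. series x * H x \<partial>lborel)"
proof -
  obtain C where C: "C > 0" "\<And>j x. norm (complex_of_real (a j) * wave j x) \<le> C * decay (\<rho> j) * (1 + norm x)\<^sup>2"
    using wave_bound by blast
  have le: "norm (complex_of_real (a j) * wave j x * H x) \<le> C * decay (\<rho> j) * ((1 + norm x)\<^sup>2 * norm (H x))" for j x
    using mult_right_mono[OF C(2)[of j x], of "norm (H x)"] by (simp add: norm_mult mult_ac)
  note * = assms(1) summable_mult[OF summable_decay_\<rho>, of C] le H refl
  show "integrable lborel (\<lambda>x. series x * H x)" by (rule series_integrable[OF *])
  show "(\<lambda>j. complex_of_real (a j) * (\<integral>x. wave j x * H x \<partial>lborel)) sums (\<integral>x. series x * H x \<partial>lborel)"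
    by (rule series_integral[OF *])
qed

text \<open>With the translation moved onto the wave, the product of the terms \<open>j\<close> and
  \<open>l\<close> is two shifted envelopes times the frequency \<open>freq j - freq l\<close>. Its
  integral is 0 for \<open>j \<noteq> l\<close>, so the diagonal term is the whole sum.\<close>

lemma wave_correlation:
  "has_bochner_integral lborel (\<lambda>x. series (x + u *\<^sub>R e) * cnj (wave l x))
    (complex_of_real (a l * (\<integral>x. envelope (x - \<rho> l *\<^sub>R e) * envelope (x - (\<rho> l + u) *\<^sub>R e) \<partial>lborel)) * cis (freq l * u))"
proof -
  let ?z = "\<rho> l + u"
  define H where "H x = cnj (wave l (x - u *\<^sub>R e))" for x
  have [measurable]: "H \<in> borel_measurable borel"
    unfolding H_def wave_def cis_cnj complex_cnj_mult complex_cnj_complex_of_real by measurable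
  obtain C where C: "C > 0" "\<And>x::'a. envelope x \<le> C * weight x" using envelope_le_weight by blast
  have H_eq: "norm (H x) = envelope (x - ?z *\<^sub>R e)" for x
    by (simp add: H_def norm_wave scaleR_add_left algebra_simps)
  let ?g = "\<lambda>j x. weight (x - \<rho> j *\<^sub>R e) + weight (x - ?z *\<^sub>R e)"
  have le: "norm (complex_of_real (a j) * wave j x * H x) \<le> C * C * (2 * (1 + \<bar>?z\<bar>)\<^sup>2) * decay (\<rho> j) * ?g j x" for j x
  proof -
    have "norm (complex_of_real (a j) * wave j x * H x) \<le> 1 * envelope (x - \<rho> j *\<^sub>R e) * envelope (x - ?z *\<^sub>R e)"
      unfolding norm_mult norm_wave H_eq using a_nonneg a_le_1
      by (intro mult_right_mono) (auto intro: envelope_nonneg)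
    also have "\<dots> \<le> (C * weight (x - \<rho> j *\<^sub>R e)) * (C * weight (x - ?z *\<^sub>R e))"
      unfolding mult_1_left using C(1)
      by (intro mult_mono C(2) envelope_nonneg mult_nonneg_nonneg less_imp_le[OF weight_pos]) auto
    also have "\<dots> = C * C * (weight (x - \<rho> j *\<^sub>R e) * weight (x - ?z *\<^sub>R e))" by simp
    also have "\<dots> \<le> C * C * (2 * decay (\<rho> j - ?z) * ?g j x)"
      using C(1) by (intro mult_left_mono weight_mult_axis_le[OF e]) auto
    \<comment> \<open>Decay in the distance to the fixed \<open>?z\<close> is traded for decay in
      \<open>\<rho> j\<close>, which is summable; the cost depends on \<open>?z\<close>
      alone.\<close>
    also have "\<dots> \<le> C * C * (2 * (decay (\<rho> j) * (1 + \<bar>?z\<bar>)\<^sup>2) * ?g j x)"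
    proof -
      have "decay (\<rho> j - ?z) \<le> decay (\<rho> j) * (1 + \<bar>?z\<bar>)\<^sup>2"
      proof -
        have "\<bar>\<rho> j - ?z - \<rho> j\<bar> = \<bar>?z\<bar>" by linarith
        then show ?thesis using decay_shift[of "\<rho> j - ?z" "\<rho> j"] by (simp only:)
      qed
      then show ?thesis
        using C(1) by (intro mult_left_mono mult_right_mono) (auto intro: add_nonneg_nonneg less_imp_le[OF weight_pos])
    qed
    finally show ?thesis by (simp add: mult_ac)
  qed
  have g: "integrable lborel (?g j)" "(\<integral>x. ?g j x \<partial>lborel) = 2 * integral\<^sup>L lborel (weight :: 'a \<Rightarrow> real)" for j
    using integrable_weight_shift[of "\<rho> j *\<^sub>R e"] integrable_weight_shift[of "?z *\<^sub>R e"]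
      integral_weight_shift[of "\<rho> j *\<^sub>R e"] integral_weight_shift[of "?z *\<^sub>R e"] by auto
  note * = \<open>H \<in> borel_measurable borel\<close> summable_mult[OF summable_decay_\<rho>, of "C * C * (2 * (1 + \<bar>?z\<bar>)\<^sup>2)"] le g
  have int: "integrable lborel (\<lambda>x. series x * H x)" by (rule series_integrable[OF *])
  let ?t = "\<lambda>j. complex_of_real (a j) * (\<integral>x. wave j x * H x \<partial>lborel)"
  have "?t sums (\<integral>x. series x * H x \<partial>lborel)" by (rule series_integral[OF *])
  moreover have wH: "wave j x * H x = cis (freq l * u) *
      (complex_of_real (envelope (x - \<rho> j *\<^sub>R e) * envelope (x - ?z *\<^sub>R e)) * cis (x \<bullet> ((freq j - freq l) *\<^sub>R e)))" for j x
  proof -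
    have "(x - u *\<^sub>R e) \<bullet> e = x \<bullet> e - u" using e by (simp add: inner_diff_left)
    then have c: "cis (freq j * (x \<bullet> e)) * cis (- (freq l * ((x - u *\<^sub>R e) \<bullet> e))) =
        cis (freq l * u) * cis (x \<bullet> ((freq j - freq l) *\<^sub>R e))"
      by (simp only: cis_mult inner_scaleR_right) (rule arg_cong[of _ _ cis], simp add: algebra_simps)
    have v: "x - u *\<^sub>R e - \<rho> l *\<^sub>R e = x - ?z *\<^sub>R e" by (simp add: scaleR_add_left)
    have "wave j x * H x = (cis (freq j * (x \<bullet> e)) * cis (- (freq l * ((x - u *\<^sub>R e) \<bullet> e)))) *
        (complex_of_real (envelope (x - \<rho> j *\<^sub>R e)) * complex_of_real (envelope (x - ?z *\<^sub>R e)))"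
      unfolding wave_def H_def cis_cnj complex_cnj_mult complex_cnj_complex_of_real v by (simp only: mult_ac)
    then show ?thesis unfolding c of_real_mult by (simp only: mult_ac)
  qed
  moreover have "?t sums ?t l"
  proof -
    have "?t j = 0" if "j \<notin> {l}" for j
    proof -
      have "norm ((freq j - freq l) *\<^sub>R e) \<ge> 1 / 2" using freq_gap[of j l] that e by simp
      from fourier_envelope_mult[OF this] show ?thesis unfolding wH by simp
    qed
    then show ?thesis using sums_finite[of "{l}" ?t] by simp
  qed
  ultimately have "(\<integral>x. series x * H x \<partial>lborel) = ?t l" using sums_unique2 by blast
  also have "?t l = complex_of_real (a l) * (cis (freq l * u) * (\<integral>x. complex_of_real (envelope (x - \<rho> l *\<^sub>R e) * envelope (x - ?z *\<^sub>R e)) \<partial>lborel))"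
    unfolding wH by simp
  finally have "(\<integral>x. series x * H x \<partial>lborel) = complex_of_real (a l * (\<integral>x. envelope (x - \<rho> l *\<^sub>R e) * envelope (x - ?z *\<^sub>R e) \<partial>lborel)) * cis (freq l * u)"
    unfolding integral_complex_of_real by simp
  then show ?thesis
    using lborel_integrable_shift[OF int, of "u *\<^sub>R e"] lborel_integral_shift[OF int, of "u *\<^sub>R e"]
    by (simp add: has_bochner_integral_iff H_def)
qed

section \<open>The series as a tempered distribution, and its Littlewood-Paley pieces\<close>

lemma represents_series: "represents series functional"
  unfolding represents_def functional_def
proof (intro conjI ballI refl)
  fix \<psi> :: "'a \<Rightarrow> complex" assume "\<psi> \<in> schwartz"
  then show "integrable lborel (\<lambda>x. series x * \<psi> x)"
    using schwartz_integrable_weighted[of \<psi> "[]" 2] schwartz_measurable[of \<psi> "[]"]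
    by (intro series_integrable_weighted) auto
qed simp

lemma tempered_functional: "tempered_distribution functional"
  unfolding tempered_distribution_def
proof (intro conjI ballI allI)
  have int: "\<psi> \<in> schwartz \<Longrightarrow> integrable lborel (\<lambda>x. series x * \<psi> x)" for \<psi>
    using represents_series by (auto simp: represents_def)
  show "functional (\<lambda>x. f x + g x) = functional f + functional g" if "f \<in> schwartz" "g \<in> schwartz" for f g
    using int[OF that(1)] int[OF that(2)] by (simp add: functional_def distrib_left)
  show "functional (\<lambda>x. c * f x) = c * functional f" for c f
    by (simp add: functional_def mult.left_commute[of _ c])
  obtain C where C: "C \<ge> 0" "\<And>x. norm (series x) \<le> C * (1 + norm x)\<^sup>2"
    using series_bound by blast
  \<comment> \<open>Order 2 pays for the growth of \<open>series\<close>, order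
    \<open>2 * DIM('a)\<close> for an integrable weight.\<close>
  let ?N = "2 + 2 * DIM('a)"
  let ?W = "integral\<^sup>L lborel (weight :: 'a \<Rightarrow> real)"
  have "norm (functional f) \<le> C * ?W * schwartz_seminorm ?N f" if f: "f \<in> schwartz" for f
  proof -
    have le: "norm (series x * f x) \<le> C * schwartz_seminorm ?N f * weight x" for x
    proof -
      have pos: "0 < (1 + norm x) ^ (2 * DIM('a))" by (intro zero_less_power) (simp add: add_pos_nonneg)
      have S: "0 \<le> schwartz_seminorm ?N f"
        by (rule order_trans[OF _ le_schwartz_seminorm[OF f, of 0]]) simp
      have "norm (series x * f x) \<le> C * (1 + norm x)\<^sup>2 * norm (f x)"
        unfolding norm_mult using C by (intro mult_right_mono) auto
      also have "\<dots> = C * ((1 + norm x) ^ ?N * norm (f x)) * (1 / (1 + norm x) ^ (2 * DIM('a)))"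
        using pos unfolding power_add by simp
      also have "\<dots> \<le> C * schwartz_seminorm ?N f * weight x"
        using C(1) S inverse_power_le_weight[of x]
        by (intro mult_mono mult_left_mono le_schwartz_seminorm[OF f]) (auto intro!: mult_nonneg_nonneg)
      finally show ?thesis .
    qed
    have "norm (functional f) \<le> (\<integral>x. C * schwartz_seminorm ?N f * weight (x::'a) \<partial>lborel)"
      unfolding functional_def
      by (rule order_trans[OF integral_norm_bound integral_mono[OF integrable_norm[OF int[OF f]] integrable_mult_right[OF integrable_weight] le]])
    then show ?thesis by (simp add: mult_ac)
  qed
  then show "\<exists>C N. \<forall>f\<in>schwartz. norm (functional f) \<le> C * schwartz_seminorm N f" by blast
qed

text \<open>The multiplier seen from the test function: unfolding the distributional definitions
  applies this operator to \<eta>, and Fubini makes it a convolution with \<open>ft \<phi>\<close>.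
  The constant is squared because both transforms are normalised.\<close>

lemma fourier_dyadic_piece:
  fixes \<phi> \<eta> :: "'a \<Rightarrow> complex"
  assumes \<phi>: "integrable lborel \<phi>" and \<eta>: "integrable lborel \<eta>"
  shows "fourier (\<lambda>\<xi>. \<phi> \<xi> * inv_fourier \<eta> \<xi>) x =
    (complex_of_real ((2 * pi) powr (- real DIM('a) / 2)))\<^sup>2 * (\<integral>y. \<eta> y * ft \<phi> (x - y) \<partial>lborel)"
proof -
  let ?k = "complex_of_real ((2 * pi) powr (- real DIM('a) / 2))"
  have [measurable]: "\<phi> \<in> borel_measurable borel" "\<eta> \<in> borel_measurable borel"
    using borel_measurable_integrable[OF \<phi>] borel_measurable_integrable[OF \<eta>] by auto
  define P where "P \<xi> y = cis (- (\<xi> \<bullet> x)) * \<phi> \<xi> * (cis (\<xi> \<bullet> y) * \<eta> y)" for \<xi> y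
  have P: "integrable (lborel \<Otimes>\<^sub>M lborel) (case_prod P)"
  proof (rule integrable_pair_bound)
    show "case_prod P \<in> borel_measurable (lborel \<Otimes>\<^sub>M lborel)" unfolding P_def by measurable
    show "norm (case_prod P (\<xi>, y)) \<le> norm (\<phi> \<xi>) * norm (\<eta> y)" for \<xi> y
      by (simp add: P_def norm_mult)
    show "integrable lborel (\<lambda>y. norm (\<phi> \<xi>) * norm (\<eta> y))" for \<xi>
      by (intro integrable_mult_right integrable_norm \<eta>)
    show "(\<integral>y. norm (\<phi> \<xi>) * norm (\<eta> y) \<partial>lborel) = norm (\<phi> \<xi>) * (\<integral>y. norm (\<eta> y) \<partial>lborel)" for \<xi>
      by simp
  qed (intro integrable_norm \<phi>)
  have "fourier (\<lambda>\<xi>. \<phi> \<xi> * inv_fourier \<eta> \<xi>) x = ?k * (\<integral>\<xi>. ?k * (\<integral>y. P \<xi> y \<partial>lborel) \<partial>lborel)"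
  proof -
    have "cis (- (x \<bullet> \<xi>)) * (\<phi> \<xi> * inv_fourier \<eta> \<xi>) = ?k * (\<integral>y. P \<xi> y \<partial>lborel)" for \<xi>
      unfolding P_def integral_mult_right_zero inv_fourier_def by (simp add: inner_commute mult_ac)
    then show ?thesis by (simp add: fourier_def inner_commute)
  qed
  also have "\<dots> = ?k\<^sup>2 * (\<integral>\<xi>. (\<integral>y. P \<xi> y \<partial>lborel) \<partial>lborel)"
    by (simp add: power2_eq_square)
  also have "(\<integral>\<xi>. (\<integral>y. P \<xi> y \<partial>lborel) \<partial>lborel) = (\<integral>y. (\<integral>\<xi>. P \<xi> y \<partial>lborel) \<partial>lborel)"
    by (rule lborel_pair.Fubini_integral[OF P, symmetric])
  also have "\<dots> = (\<integral>y. \<eta> y * ft \<phi> (x - y) \<partial>lborel)"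
  proof (intro Bochner_Integration.integral_cong refl)
    fix y
    have "(\<integral>\<xi>. P \<xi> y \<partial>lborel) = (\<integral>\<xi>. \<eta> y * (\<phi> \<xi> * cis (- ((x - y) \<bullet> \<xi>))) \<partial>lborel)"
    proof (intro Bochner_Integration.integral_cong refl)
      fix \<xi>
      have "cis (- (\<xi> \<bullet> x)) * cis (\<xi> \<bullet> y) = cis (- ((x - y) \<bullet> \<xi>))"
        by (simp add: cis_mult inner_diff_left inner_commute[of \<xi>])
      then show "P \<xi> y = \<eta> y * (\<phi> \<xi> * cis (- ((x - y) \<bullet> \<xi>)))"
        unfolding P_def by (metis mult.assoc mult.commute)
    qed
    then show "(\<integral>\<xi>. P \<xi> y \<partial>lborel) = \<eta> y * ft \<phi> (x - y)" by (simp add: ft_def)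
  qed
  finally show ?thesis .
qed

text \<open>Fubini exposes the spectrum: each \<xi> contributes \<open>\<phi> \<xi>\<close> times
  the transform of the envelope at \<open>freq j *\<^sub>R e - \<xi>\<close>, and one of the two
  factors always vanishes.\<close>

lemma wave_mult_ft:
  fixes \<phi> :: "'a \<Rightarrow> complex"
  assumes \<phi>: "integrable lborel \<phi>"
    and van: "\<And>\<xi>. norm (freq j *\<^sub>R e - \<xi>) < 1 / 4 \<Longrightarrow> \<phi> \<xi> = 0"
  shows "(\<integral>x. wave j x * ft \<phi> (x - y) \<partial>lborel) = 0"
proof -
  have [measurable]: "\<phi> \<in> borel_measurable borel"
    using borel_measurable_integrable[OF \<phi>] by auto
  define P where "P x \<xi> = wave j x * (\<phi> \<xi> * cis (- ((x - y) \<bullet> \<xi>)))" for x \<xi>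
  have env: "integrable lborel (\<lambda>x. envelope (x - \<rho> j *\<^sub>R e))" by (rule integrable_envelope_shift)
  have P: "integrable (lborel \<Otimes>\<^sub>M lborel) (case_prod P)"
  proof (rule integrable_pair_bound)
    show "case_prod P \<in> borel_measurable (lborel \<Otimes>\<^sub>M lborel)" unfolding P_def by measurable
    show "norm (case_prod P (x, \<xi>)) \<le> envelope (x - \<rho> j *\<^sub>R e) * norm (\<phi> \<xi>)" for x \<xi>
      by (simp add: P_def norm_mult norm_wave)
    show "integrable lborel (\<lambda>\<xi>. envelope (x - \<rho> j *\<^sub>R e) * norm (\<phi> \<xi>))" for x
      by (intro integrable_mult_right integrable_norm \<phi>)
    show "(\<integral>\<xi>. envelope (x - \<rho> j *\<^sub>R e) * norm (\<phi> \<xi>) \<partial>lborel) = envelope (x - \<rho> j *\<^sub>R e) * (\<integral>\<xi>. norm (\<phi> \<xi>) \<partial>lborel)" for x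
      by simp
  qed (rule env)
  have "(\<integral>x. wave j x * ft \<phi> (x - y) \<partial>lborel) = (\<integral>x. (\<integral>\<xi>. P x \<xi> \<partial>lborel) \<partial>lborel)"
    unfolding P_def ft_def by simp
  also have "\<dots> = (\<integral>\<xi>. (\<integral>x. P x \<xi> \<partial>lborel) \<partial>lborel)"
    by (rule lborel_pair.Fubini_integral[OF P, symmetric])
  also have "\<dots> = 0"
  proof -
    have "(\<integral>x. P x \<xi> \<partial>lborel) = 0" for \<xi>
    proof (cases "norm (freq j *\<^sub>R e - \<xi>) < 1 / 4")
      case True
      then show ?thesis by (simp add: P_def van)
    next
      case False
      have "P x \<xi> = (\<phi> \<xi> * cis (y \<bullet> \<xi>)) * (complex_of_real (envelope (x - \<rho> j *\<^sub>R e)) * cis (x \<bullet> (freq j *\<^sub>R e - \<xi>)))" for x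
      proof -
        have "cis (freq j * (x \<bullet> e)) * cis (- ((x - y) \<bullet> \<xi>)) = cis (y \<bullet> \<xi>) * cis (x \<bullet> (freq j *\<^sub>R e - \<xi>))"
          by (simp add: cis_mult inner_diff_left inner_diff_right algebra_simps)
        then have "wave j x * cis (- ((x - y) \<bullet> \<xi>)) = cis (y \<bullet> \<xi>) * (complex_of_real (envelope (x - \<rho> j *\<^sub>R e)) * cis (x \<bullet> (freq j *\<^sub>R e - \<xi>)))"
          unfolding wave_def by (metis mult.assoc mult.commute)
        then show ?thesis
          unfolding P_def by (metis mult.assoc mult.commute)
      qed
      then have "(\<integral>x. P x \<xi> \<partial>lborel) = (\<phi> \<xi> * cis (y \<bullet> \<xi>)) * (\<integral>x. complex_of_real (envelope (x - \<rho> j *\<^sub>R e)) * cis (x \<bullet> (freq j *\<^sub>R e - \<xi>)) \<partial>lborel)"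
        by simp
      then show ?thesis using fourier_envelope[of "freq j *\<^sub>R e - \<xi>" "\<rho> j *\<^sub>R e"] False by simp
    qed
    then show ?thesis by simp
  qed
  finally show ?thesis .
qed

lemma wave_mult_dyadic:
  assumes gen: "dyadic_generator \<phi>0" and i: "i \<noteq> j" "i \<noteq> Suc j"
  shows "(\<integral>x. wave j x * ft (dyadic \<phi>0 i) (x - y) \<partial>lborel) = 0"
proof (rule wave_mult_ft)
  show "integrable lborel (dyadic \<phi>0 i)"
    using gen by (intro dyadic_integrable) (simp add: dyadic_generator_def)
  fix \<xi> assume "norm (freq j *\<^sub>R e - \<xi>) < 1 / 4"
  moreover have "norm (freq j *\<^sub>R e) = freq j"
  proof -
    have "(0::real) < 2 ^ j" by simp
    then have "0 < freq j" using freq_bounds(1)[of j] by linarith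
    then show ?thesis using e by simp
  qed
  ultimately have "\<bar>norm \<xi> - freq j\<bar> < 1 / 4"
    using norm_triangle_ineq3[of "freq j *\<^sub>R e" \<xi>] by linarith
  then show "dyadic \<phi>0 i \<xi> = 0"
    using freq_bounds[of j] by (intro dyadic_vanishes[OF gen _ _ i]) linarith+
qed

text \<open>Peetre's inequality carries the weight from \<open>x\<close> to \<open>y\<close> and
  charges \<open>(1 + norm (x - y)) ^ (2 * DIM('a))\<close> to the kernel. The constant is common to
  all kernels and waves.\<close>

lemma wave_conv_bound:
  "\<exists>C\<ge>0. \<forall>K j y. K \<in> borel_measurable borel \<longrightarrow> integrable lborel (\<lambda>z. (1 + norm z) ^ (2 * DIM('a)) * norm (K z)) \<longrightarrow>
    norm (\<integral>x. wave j x * K (x - y) \<partial>lborel) \<le>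
      C * weight (y - \<rho> j *\<^sub>R e) * (\<integral>z. (1 + norm z) ^ (2 * DIM('a)) * norm (K z) \<partial>lborel)"
proof -
  obtain C where C: "C > 0" "\<And>x::'a. envelope x \<le> C * weight x" using envelope_le_weight by blast
  {
    fix K :: "'a \<Rightarrow> complex" and j y
    assume [measurable]: "K \<in> borel_measurable borel"
      and int: "integrable lborel (\<lambda>z. (1 + norm z) ^ (2 * DIM('a)) * norm (K z))"
    let ?G = "\<lambda>z. (1 + norm z) ^ (2 * DIM('a)) * norm (K z)"
    let ?c = "C * weight (y - \<rho> j *\<^sub>R e)"
    have le: "norm (wave j x * K (x - y)) \<le> ?c * ?G (x - y)" for x
    proof -
      have "envelope (x - \<rho> j *\<^sub>R e) \<le> C * (weight (y - \<rho> j *\<^sub>R e) * (1 + norm ((x - \<rho> j *\<^sub>R e) - (y - \<rho> j *\<^sub>R e))) ^ (2 * DIM('a)))"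
        using C by (intro order_trans[OF C(2)] mult_left_mono weight_shift) auto
      from mult_right_mono[OF this, of "norm (K (x - y))"]
      show ?thesis by (simp add: norm_mult norm_wave mult_ac)
    qed
    have G: "integrable lborel (\<lambda>x. ?c * ?G (x - y))"
      using lborel_integrable_shift[OF int, of "- y"] by (intro integrable_mult_right) simp
    have "integrable lborel (\<lambda>x. wave j x * K (x - y))"
      by (rule Bochner_Integration.integrable_bound[OF G]) (auto simp del: norm_mult intro!: AE_I2 order_trans[OF le abs_ge_self])
    then have "norm (\<integral>x. wave j x * K (x - y) \<partial>lborel) \<le> (\<integral>x. ?c * ?G (x - y) \<partial>lborel)"
      by (intro order_trans[OF integral_norm_bound] integral_mono integrable_norm G le)
    also have "\<dots> = ?c * integral\<^sup>L lborel ?G"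
      using lborel_integral_shift[OF int, of "- y"] by simp
    finally have "norm (\<integral>x. wave j x * K (x - y) \<partial>lborel) \<le> ?c * integral\<^sup>L lborel ?G" .
  }
  then show ?thesis using C(1) by (intro exI[of _ C]) auto
qed

definition piece :: "('a \<Rightarrow> complex) \<Rightarrow> 'a \<Rightarrow> complex" where
  "piece \<phi> y = (complex_of_real ((2 * pi) powr (- real DIM('a) / 2)))\<^sup>2 * (\<integral>x. series x * ft \<phi> (x - y) \<partial>lborel)"

text \<open>Fubini moves the convolution of \<open>fourier_dyadic_piece\<close> from the test
  function to the series. The quadratic growth of \<open>series\<close> at \<open>x\<close> is split
  by Peetre between \<eta> at \<open>y\<close> and the kernel at \<open>x - y\<close>.\<close>

lemma represents_piece:
  fixes \<phi> :: "'a \<Rightarrow> complex"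
  assumes \<phi>: "integrable lborel \<phi>" and K: "integrable lborel (\<lambda>z. (1 + norm z)\<^sup>2 * norm (ft \<phi> z))"
  shows "represents (piece \<phi>) (dist_inv_fourier (dist_mult \<phi> (dist_fourier functional)))"
proof -
  let ?k = "complex_of_real ((2 * pi) powr (- real DIM('a) / 2))"
  have [measurable]: "\<phi> \<in> borel_measurable borel"
    using borel_measurable_integrable[OF \<phi>] by auto
  have m: "piece \<phi> \<in> borel_measurable borel" unfolding piece_def by measurable
  obtain C where C: "C \<ge> 0" "\<And>x. norm (series x) \<le> C * (1 + norm x)\<^sup>2"
    using series_bound by blast
  have "integrable lborel (\<lambda>y. piece \<phi> y * \<eta> y) \<and>
      dist_inv_fourier (dist_mult \<phi> (dist_fourier functional)) \<eta> = (\<integral>y. piece \<phi> y * \<eta> y \<partial>lborel)"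
    if \<eta>: "\<eta> \<in> schwartz" for \<eta>
  proof -
    have \<eta>i: "integrable lborel \<eta>" using schwartz_integrable[OF \<eta>, of "[]"] by simp
    have [measurable]: "\<eta> \<in> borel_measurable borel" using borel_measurable_integrable[OF \<eta>i] by simp
    define P where "P y x = \<eta> y * (series x * ft \<phi> (x - y))" for y x
    let ?B = "\<lambda>z. (1 + norm z)\<^sup>2 * norm (ft \<phi> z)"
    let ?A = "\<lambda>y. C * ((1 + norm y)\<^sup>2 * norm (\<eta> y))"
    have P: "integrable (lborel \<Otimes>\<^sub>M lborel) (case_prod P)"
    proof (rule integrable_pair_bound)
      show "case_prod P \<in> borel_measurable (lborel \<Otimes>\<^sub>M lborel)" unfolding P_def by measurable
      show "norm (case_prod P (y, x)) \<le> ?A y * ?B (x - y)" for y x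
      proof -
        have "norm (series x) \<le> C * ((1 + norm y) * (1 + norm (x - y)))\<^sup>2"
          using C(1) by (intro order_trans[OF C(2)] mult_left_mono power_mono one_plus_norm_le) auto
        then have "norm (\<eta> y) * (norm (series x) * norm (ft \<phi> (x - y))) \<le>
            norm (\<eta> y) * (C * ((1 + norm y) * (1 + norm (x - y)))\<^sup>2 * norm (ft \<phi> (x - y)))"
          by (intro mult_left_mono mult_right_mono) auto
        then show ?thesis by (simp add: P_def norm_mult power_mult_distrib mult_ac)
      qed
      show "integrable lborel (\<lambda>x. ?A y * ?B (x - y))" for y
        using lborel_integrable_shift[OF K, of "- y"] by (intro integrable_mult_right) simp
      show "(\<integral>x. ?A y * ?B (x - y) \<partial>lborel) = ?A y * integral\<^sup>L lborel ?B" for y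
        using lborel_integral_shift[OF K, of "- y"] by simp
      show "integrable lborel ?A"
        using schwartz_integrable_weighted[OF \<eta>, of "[]" 2] by (intro integrable_mult_right) simp
    qed
    have eq: "?k\<^sup>2 * (\<integral>x. P y x \<partial>lborel) = piece \<phi> y * \<eta> y" for y
      unfolding P_def piece_def by simp
    have "integrable lborel (\<lambda>y. ?k\<^sup>2 * (\<integral>x. P y x \<partial>lborel))"
      by (intro integrable_mult_right lborel_pair.integrable_fst P)
    then have 1: "integrable lborel (\<lambda>y. piece \<phi> y * \<eta> y)" unfolding eq .
    have "dist_inv_fourier (dist_mult \<phi> (dist_fourier functional)) \<eta> =
        (\<integral>x. series x * (?k\<^sup>2 * (\<integral>y. \<eta> y * ft \<phi> (x - y) \<partial>lborel)) \<partial>lborel)"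
      unfolding dist_inv_fourier_def dist_mult_def dist_fourier_def functional_def fourier_dyadic_piece[OF \<phi> \<eta>i] ..
    also have "\<dots> = (\<integral>x. ?k\<^sup>2 * (\<integral>y. P y x \<partial>lborel) \<partial>lborel)"
    proof -
      have "(\<integral>y. P y x \<partial>lborel) = series x * (\<integral>y. \<eta> y * ft \<phi> (x - y) \<partial>lborel)" for x
        unfolding P_def mult.left_commute[of _ "series x"] by (rule integral_mult_right_zero)
      then show ?thesis by (simp add: mult.left_commute)
    qed
    also have "\<dots> = ?k\<^sup>2 * (\<integral>y. (\<integral>x. P y x \<partial>lborel) \<partial>lborel)"
      by (simp add: lborel_pair.Fubini_integral[OF P])
    also have "\<dots> = (\<integral>y. piece \<phi> y * \<eta> y \<partial>lborel)"
      unfolding eq[symmetric] by simp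
    finally show ?thesis using 1 by simp
  qed
  then show ?thesis using m by (auto simp: represents_def)
qed

lemma piece_bound:
  assumes gen: "dyadic_generator \<phi>0"
  shows "\<exists>C\<ge>0. \<forall>i y. norm (piece (dyadic \<phi>0 i) y) \<le>
    C * (a i + a (i - 1)) * (weight (y - \<rho> i *\<^sub>R e) + weight (y - \<rho> (i - 1) *\<^sub>R e))"
proof -
  have s: "\<phi>0 \<in> schwartz" using gen by (simp add: dyadic_generator_def)
  obtain B where B: "\<And>i. integrable lborel (\<lambda>z. (1 + norm z) ^ (2 * DIM('a)) * norm (ft (dyadic \<phi>0 i) z))"
      "\<And>i. (\<integral>z. (1 + norm z) ^ (2 * DIM('a)) * norm (ft (dyadic \<phi>0 i) z) \<partial>lborel) \<le> B"
    using ft_dyadic_bound[OF s] by blast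
  have B0: "0 \<le> B" by (rule order_trans[OF _ B(2)[of 0]]) simp
  obtain C where C: "C \<ge> 0" "\<And>K j y. K \<in> borel_measurable borel \<Longrightarrow>
     integrable lborel (\<lambda>z. (1 + norm z) ^ (2 * DIM('a)) * norm (K z)) \<Longrightarrow>
     norm (\<integral>x. wave j x * K (x - y) \<partial>lborel) \<le>
      C * weight (y - \<rho> j *\<^sub>R e) * (\<integral>z. (1 + norm z) ^ (2 * DIM('a)) * norm (K z) \<partial>lborel)"
    using wave_conv_bound by blast
  let ?k = "complex_of_real ((2 * pi) powr (- real DIM('a) / 2))"
  let ?D = "(norm ?k)\<^sup>2 * (C * B)"
  have "norm (piece (dyadic \<phi>0 i) y) \<le> ?D * (a i + a (i - 1)) * (weight (y - \<rho> i *\<^sub>R e) + weight (y - \<rho> (i - 1) *\<^sub>R e))" for i y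
  proof -
    let ?K = "ft (dyadic \<phi>0 i)"
    have [measurable]: "?K \<in> borel_measurable borel"
      using borel_measurable_integrable[OF dyadic_integrable[OF s]] by (intro ft_measurable) simp
    have w: "norm (\<integral>x. wave j x * ?K (x - y) \<partial>lborel) \<le> C * B * weight (y - \<rho> j *\<^sub>R e)" for j
    proof -
      have "norm (\<integral>x. wave j x * ?K (x - y) \<partial>lborel) \<le> C * weight (y - \<rho> j *\<^sub>R e) * B"
        by (intro order_trans[OF C(2)[OF _ B(1)]] mult_left_mono B mult_nonneg_nonneg C(1) less_imp_le[OF weight_pos]) auto
      then show ?thesis by (simp add: mult_ac)
    qed
    obtain B2 where "integrable lborel (\<lambda>z. (1 + norm z)\<^sup>2 * norm (?K z))"
      using ft_dyadic_bound[OF s, of 2] by blast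
    from lborel_integrable_shift[OF this, of "- y"]
    have "integrable lborel (\<lambda>x. (1 + norm y)\<^sup>2 * ((1 + norm (x - y))\<^sup>2 * norm (?K (x - y))))"
      by (intro integrable_mult_right) simp
    then have H: "integrable lborel (\<lambda>x. (1 + norm x)\<^sup>2 * norm (?K (x - y)))"
    proof (rule Bochner_Integration.integrable_bound)
      have "(1 + norm x)\<^sup>2 * norm (?K (x - y)) \<le> (1 + norm y)\<^sup>2 * ((1 + norm (x - y))\<^sup>2 * norm (?K (x - y)))" for x
      proof -
        have "(1 + norm x)\<^sup>2 \<le> ((1 + norm y) * (1 + norm (x - y)))\<^sup>2"
          by (intro power_mono one_plus_norm_le) auto
        from mult_right_mono[OF this, of "norm (?K (x - y))"] show ?thesis
          by (simp add: power_mult_distrib mult_ac)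
      qed
      then show "AE x in lborel. norm ((1 + norm x)\<^sup>2 * norm (?K (x - y))) \<le> norm ((1 + norm y)\<^sup>2 * ((1 + norm (x - y))\<^sup>2 * norm (?K (x - y))))"
        by (intro AE_I2) simp
    qed measurable
    let ?t = "\<lambda>j. complex_of_real (a j) * (\<integral>x. wave j x * ?K (x - y) \<partial>lborel)"
    have "?t sums (\<integral>x. series x * ?K (x - y) \<partial>lborel)"
      by (rule series_integral_weighted[OF _ H]) measurable
    moreover have "?t sums (\<Sum>j\<in>{i, i - 1}. ?t j)"
    proof (rule sums_finite)
      fix j assume "j \<notin> {i, i - 1}"
      then have "i \<noteq> j" "i \<noteq> Suc j" by auto
      then show "?t j = 0" using wave_mult_dyadic[OF gen, of i j y] by simp
    qed simp
    ultimately have "(\<integral>x. series x * ?K (x - y) \<partial>lborel) = (\<Sum>j\<in>{i, i - 1}. ?t j)"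
      by (rule sums_unique2)
    then have "norm (piece (dyadic \<phi>0 i) y) = (norm ?k)\<^sup>2 * norm (\<Sum>j\<in>{i, i - 1}. ?t j)"
      by (simp add: piece_def norm_mult norm_power)
    also have "\<dots> \<le> (norm ?k)\<^sup>2 * (\<Sum>j\<in>{i, i - 1}. norm (?t j))"
      by (intro mult_left_mono norm_sum) auto
    \<comment> \<open>For \<open>i = 0\<close> the two indices coincide and the sum has one term,
      which the bound counts twice.\<close>
    also have "(\<Sum>j\<in>{i, i - 1}. norm (?t j)) \<le> norm (?t i) + norm (?t (i - 1))"
      by (cases "i = i - 1") auto
    also have "norm (?t i) + norm (?t (i - 1)) \<le> a i * (C * B * weight (y - \<rho> i *\<^sub>R e)) + a (i - 1) * (C * B * weight (y - \<rho> (i - 1) *\<^sub>R e))"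
      unfolding norm_mult norm_of_real abs_of_nonneg[OF a_nonneg]
      by (intro add_mono mult_left_mono w a_nonneg)
    also have "\<dots> \<le> (C * B) * ((a i + a (i - 1)) * (weight (y - \<rho> i *\<^sub>R e) + weight (y - \<rho> (i - 1) *\<^sub>R e)))"
    proof -
      have "a i * u + a (i - 1) * v \<le> (a i + a (i - 1)) * (u + v)" if "0 \<le> u" "0 \<le> v" for u v
        using that a_nonneg[of i] a_nonneg[of "i - 1"] by (simp add: distrib_left distrib_right)
      then have "(C * B) * (a i * weight (y - \<rho> i *\<^sub>R e) + a (i - 1) * weight (y - \<rho> (i - 1) *\<^sub>R e))
         \<le> (C * B) * ((a i + a (i - 1)) * (weight (y - \<rho> i *\<^sub>R e) + weight (y - \<rho> (i - 1) *\<^sub>R e)))"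
        using C(1) B0 by (intro mult_left_mono) (auto intro: less_imp_le[OF weight_pos])
      then show ?thesis by (simp add: algebra_simps)
    qed
    finally show ?thesis by (simp add: mult_ac mult_left_mono)
  qed
  moreover have "0 \<le> ?D" using C(1) B0 by simp
  ultimately show ?thesis by blast
qed

theorem dyadic_piece_norm_le:
  assumes gen: "dyadic_generator \<phi>0" and p: "1 < p"
  shows "\<exists>C\<ge>0. \<forall>i. dist_Lp_norm p (dist_inv_fourier (dist_mult (dyadic \<phi>0 i) (dist_fourier functional)))
    \<le> ennreal (C * (a i + a (i - 1)))"
proof -
  have s: "\<phi>0 \<in> schwartz" using gen by (simp add: dyadic_generator_def)
  obtain C where C: "C \<ge> 0" "\<And>i y. norm (piece (dyadic \<phi>0 i) y) \<le>
    C * (a i + a (i - 1)) * (weight (y - \<rho> i *\<^sub>R e) + weight (y - \<rho> (i - 1) *\<^sub>R e))"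
    using piece_bound[OF gen] by blast
  let ?W = "integral\<^sup>L lborel (weight :: 'a \<Rightarrow> real)"
  have W0: "0 \<le> ?W" by (simp add: less_imp_le[OF weight_pos])
  have "dist_Lp_norm p (dist_inv_fourier (dist_mult (dyadic \<phi>0 i) (dist_fourier functional)))
      \<le> ennreal (2 * C * ?W powr (1 / p) * (a i + a (i - 1)))" for i
  proof -
    let ?g = "piece (dyadic \<phi>0 i)" and ?A = "a i + a (i - 1)"
    \<comment> \<open>Halving the sum keeps \<open>?w\<close> below 1, whence
      \<open>?w powr p \<le> ?w\<close>: the \<open>L_p\<close> bound reduces to the integral of the
      weight, whatever the centres.\<close>
    let ?w = "\<lambda>y. (weight (y - \<rho> i *\<^sub>R e) + weight (y - \<rho> (i - 1) *\<^sub>R e)) / 2"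
    have A0: "0 \<le> ?A" using a_nonneg by (intro add_nonneg_nonneg)
    have w: "0 \<le> ?w y" "?w y \<le> 1" for y
      using weight_pos[of "y - \<rho> i *\<^sub>R e"] weight_pos[of "y - \<rho> (i - 1) *\<^sub>R e"]
        weight_le_1[of "y - \<rho> i *\<^sub>R e"] weight_le_1[of "y - \<rho> (i - 1) *\<^sub>R e"] by auto
    have rep: "represents ?g (dist_inv_fourier (dist_mult (dyadic \<phi>0 i) (dist_fourier functional)))"
      using ft_dyadic_bound[OF s, of 2] by (intro represents_piece dyadic_integrable[OF s]) blast
    have le: "norm (?g y) powr p \<le> (2 * C * ?A) powr p * ?w y" for y
    proof -
      have "norm (?g y) powr p \<le> (2 * C * ?A * ?w y) powr p"
        using order_trans[OF C(2)[of i y] eq_refl, of "2 * C * ?A * ?w y"] p by (intro powr_mono2) auto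
      also have "\<dots> = (2 * C * ?A) powr p * ?w y powr p"
        using w[of y] C(1) A0 by (intro powr_mult)
      also have "?w y powr p \<le> ?w y powr 1"
        using w[of y] p by (intro powr_mono') auto
      finally show ?thesis using w[of y] by (simp add: mult_left_mono)
    qed
    have intw: "has_bochner_integral lborel ?w ?W"
      using integrable_weight_shift[of "\<rho> i *\<^sub>R e"] integrable_weight_shift[of "\<rho> (i - 1) *\<^sub>R e"]
        integral_weight_shift[of "\<rho> i *\<^sub>R e"] integral_weight_shift[of "\<rho> (i - 1) *\<^sub>R e"]
      by (auto simp: has_bochner_integral_iff)
    have "(\<integral>\<^sup>+y. ennreal (norm (?g y) powr p) \<partial>lborel) \<le> (\<integral>\<^sup>+y. ennreal ((2 * C * ?A) powr p * ?w y) \<partial>lborel)"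
      by (intro nn_integral_mono ennreal_leI le)
    also have "\<dots> = ennreal ((2 * C * ?A) powr p * ?W)"
      using has_bochner_integral_mult_right[of "(2 * C * ?A) powr p", OF intw] w
      by (subst nn_integral_eq_integral) (auto simp: has_bochner_integral_iff intro!: mult_nonneg_nonneg)
    finally have "Lp_norm p ?g \<le> ennreal (((2 * C * ?A) powr p * ?W) powr (1 / p))"
      unfolding Lp_norm_def using p W0
      by (subst epowr_ennreal[symmetric]) (auto intro!: epowr_mono)
    also have "((2 * C * ?A) powr p * ?W) powr (1 / p) = 2 * C * ?W powr (1 / p) * ?A"
      using p C(1) A0 W0 by (simp add: powr_mult powr_powr mult_ac)
    finally show ?thesis
      unfolding dist_Lp_norm_def by (intro INF_lower2[of ?g]) (use rep in auto)
  qed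
  moreover have "0 \<le> 2 * C * ?W powr (1 / p)" using C(1) by simp
  ultimately show ?thesis by blast
qed

end

subsection \<open>Lower bounds for differences\<close>

text \<open>Hoelder's inequality, obtained from Young's inequality for the normalised functions. If
  the \<open>p\<close>-th power of \<open>F\<close> has infinite integral, the right-hand side is
  top.\<close>

lemma Lp_norm_dual_bound:
  fixes F G :: "'a::euclidean_space \<Rightarrow> complex"
  assumes p: "1 < p" "1 < p'" "1 / p + 1 / p' = 1"
    and [measurable]: "F \<in> borel_measurable borel"
    and FG: "integrable lborel (\<lambda>x. F x * G x)"
    and G: "integrable lborel (\<lambda>x. norm (G x) powr p')" "(\<integral>x. norm (G x) powr p' \<partial>lborel) \<le> B powr p'"
    and B: "0 < B"
  shows "ennreal (norm (\<integral>x. F x * G x \<partial>lborel) / B) \<le> Lp_norm p F"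
proof (cases "(\<integral>\<^sup>+x. ennreal (norm (F x) powr p) \<partial>lborel) = \<infinity>")
  case True
  then show ?thesis by (simp add: Lp_norm_def)
next
  case False
  let ?V = "norm (\<integral>x. F x * G x \<partial>lborel)"
  have int: "integrable lborel (\<lambda>x. norm (F x) powr p)"
    using False by (intro integrableI_bounded) (auto simp: less_top)
  define I where "I = (\<integral>x. norm (F x) powr p \<partial>lborel)"
  have I0: "0 \<le> I" unfolding I_def by simp
  define L where "L = I powr (1 / p)"
  have L: "0 \<le> L" "L powr p = I" using I0 p by (auto simp: L_def powr_powr)
  have "(\<integral>\<^sup>+x. ennreal (norm (F x) powr p) \<partial>lborel) = ennreal I"
    unfolding I_def by (intro nn_integral_eq_integral int) auto
  then have Lp: "Lp_norm p F = ennreal L"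
    using I0 by (simp add: Lp_norm_def epowr_ennreal L_def)
  have "?V / B \<le> L"
  proof (rule field_le_epsilon)
    fix \<delta> :: real assume \<delta>: "0 < \<delta>"
    \<comment> \<open>Adding \<delta> permits division by \<open>M\<close> even when
      \<open>L = 0\<close>.\<close>
    define M where "M = L + \<delta>"
    have M: "0 < M" "L \<le> M" using \<delta> L by (auto simp: M_def)
    have le: "norm (F x * G x) \<le> M * B * (norm (F x) powr p / (M powr p * p) + norm (G x) powr p' / (B powr p' * p'))" for x
    proof -
      have "norm (F x) / M * (norm (G x) / B) \<le> (norm (F x) / M) powr p / p + (norm (G x) / B) powr p' / p'"
        using M B p by (intro Youngs_inequality) auto
      also have "\<dots> = norm (F x) powr p / (M powr p * p) + norm (G x) powr p' / (B powr p' * p')"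
        using M B by (simp add: powr_divide)
      finally have "(M * B) * (norm (F x) / M * (norm (G x) / B)) \<le> (M * B) * (norm (F x) powr p / (M powr p * p) + norm (G x) powr p' / (B powr p' * p'))"
        using M B by (intro mult_left_mono) auto
      then show ?thesis using M B by (simp add: norm_mult)
    qed
    have "?V \<le> (\<integral>x. M * B * (norm (F x) powr p / (M powr p * p) + norm (G x) powr p' / (B powr p' * p')) \<partial>lborel)"
      by (intro order_trans[OF integral_norm_bound] integral_mono integrable_norm FG le
          integrable_mult_right Bochner_Integration.integrable_add integrable_divide int G)
    also have "\<dots> = M * B * (I / (M powr p * p) + (\<integral>x. norm (G x) powr p' \<partial>lborel) / (B powr p' * p'))"
      using int G(1) by (simp add: I_def)
    also have "\<dots> \<le> M * B * (1 / p + 1 / p')"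
    proof -
      have "I \<le> M powr p" unfolding L(2)[symmetric] using L M p by (intro powr_mono2) auto
      then have "I / (M powr p * p) \<le> M powr p / (M powr p * p)"
        using p by (intro divide_right_mono) auto
      moreover have "(\<integral>x. norm (G x) powr p' \<partial>lborel) / (B powr p' * p') \<le> B powr p' / (B powr p' * p')"
        using p G by (intro divide_right_mono) auto
      ultimately have "I / (M powr p * p) + (\<integral>x. norm (G x) powr p' \<partial>lborel) / (B powr p' * p') \<le> 1 / p + 1 / p'"
        using M B by simp
      then show ?thesis using M B by (intro mult_left_mono) auto
    qed
    finally have "?V \<le> M * B" using p by simp
    then show "?V / B \<le> L + \<delta>" using B by (simp add: pos_divide_le_eq M_def)
  qed
  then show ?thesis unfolding Lp by (intro ennreal_leI)
qed

lemma diff_op_measurable: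
  fixes f :: "'a::euclidean_space \<Rightarrow> complex"
  assumes [measurable]: "f \<in> borel_measurable borel"
  shows "diff_op k h f \<in> borel_measurable borel"
proof (induction k)
  case (Suc k)
  note [measurable] = Suc
  show ?case by simp measurable
qed simp

text \<open>If the translates of \<open>f\<close> along \<open>h\<close> pair with \<open>G\<close> to numbers of alternating sign, then
  the terms of the iterated difference cannot cancel.\<close>

lemma diff_op_alternating:
  fixes f G :: "'a::euclidean_space \<Rightarrow> complex"
  assumes "\<And>m::nat. has_bochner_integral lborel (\<lambda>x. f (x + real m *\<^sub>R h) * G x) (complex_of_real ((-1) ^ m * V m))"
    and V: "\<And>m. 0 \<le> V m"
  shows "\<exists>W\<ge>V m. has_bochner_integral lborel (\<lambda>x. diff_op k h f (x + real m *\<^sub>R h) * G x) (complex_of_real ((-1) ^ (m + k) * W))"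
proof (induction k arbitrary: m)
  case 0
  show ?case using assms(1)[of m] by (intro exI[of _ "V m"]) simp
next
  case (Suc k)
  obtain W where W: "V m \<le> W" "has_bochner_integral lborel (\<lambda>x. diff_op k h f (x + real m *\<^sub>R h) * G x) (complex_of_real ((-1) ^ (m + k) * W))"
    using Suc by blast
  obtain W' where W': "V (Suc m) \<le> W'" "has_bochner_integral lborel (\<lambda>x. diff_op k h f (x + real (Suc m) *\<^sub>R h) * G x) (complex_of_real ((-1) ^ (Suc m + k) * W'))"
    using Suc by blast
  have "x + real m *\<^sub>R h + h = x + real (Suc m) *\<^sub>R h" for x by (simp add: scaleR_add_left)
  then have "has_bochner_integral lborel (\<lambda>x. diff_op (Suc k) h f (x + real m *\<^sub>R h) * G x)
      (complex_of_real ((-1) ^ (Suc m + k) * W') - complex_of_real ((-1) ^ (m + k) * W))"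
    using has_bochner_integral_diff[OF W'(2) W(2)] by (simp only: diff_op.simps left_diff_distrib)
  moreover have "complex_of_real ((-1) ^ (Suc m + k) * W') - complex_of_real ((-1) ^ (m + k) * W) = complex_of_real ((-1) ^ (m + Suc k) * (W' + W))"
    by (simp add: algebra_simps)
  moreover have "V m \<le> W' + W" using W W' V[of "Suc m"] by linarith
  ultimately show ?case by (intro exI[of _ "W' + W"]) simp
qed

text \<open>On the open unit cube the cosines have arguments in (0, 1), so every factor is positive,
  and the cube has measure 1.\<close>

lemma integral_envelope_square_pos:
  "0 < (\<integral>x. envelope (x::'a::euclidean_space) * envelope x \<partial>lborel)"
proof -
  have int: "integrable lborel (\<lambda>x::'a. envelope x * envelope x)"
    using integrable_envelope_mult[of "0::'a" 0] by simp
  have pos: "0 < envelope x" if "x \<in> box 0 One" for x :: 'a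
    unfolding envelope_def
  proof (intro prod_pos)
    fix b :: 'a assume b: "b \<in> Basis"
    let ?r = "1 / (4 * real DIM('a))"
    have x: "0 < x \<bullet> b" "x \<bullet> b < 1" using that b by (auto simp: mem_box)
    then have "0 < ?r * (x \<bullet> b)" "?r * (x \<bullet> b) < 1"
      using envelope_width[where 'a='a] mult_strict_right_mono[of ?r 1 "x \<bullet> b"] mult_right_mono[of ?r 1 "x \<bullet> b"] by auto
    moreover have "cos y < cos 0" if "0 < y" "y < 1" for y :: real
      using that pi_gt3 by (intro cos_monotone_0_pi) auto
    ultimately have "cos (?r * (x \<bullet> b)) < cos 0" by blast
    then show "0 < fejer ?r (x \<bullet> b)"
      using x \<open>0 < ?r * (x \<bullet> b)\<close> by (auto simp: fejer_def intro!: divide_pos_pos)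
  qed
  have "(\<integral>x. envelope (x::'a) * envelope x \<partial>lborel) \<noteq> 0"
  proof
    assume "(\<integral>x. envelope (x::'a) * envelope x \<partial>lborel) = 0"
    then have "AE x in (lborel :: 'a measure). envelope x * envelope x = 0"
      using integral_nonneg_eq_0_iff_AE[OF int] by auto
    then have "AE x in (lborel :: 'a measure). x \<notin> box 0 One"
      by eventually_elim (use pos in force)
    then have "emeasure lborel (box (0::'a) One) = 0"
      by (subst (asm) AE_iff_measurable[where N="box 0 One"]) auto
    moreover have "emeasure lborel (box (0::'a) One) = 1"
      by (subst emeasure_lborel_box) auto
    ultimately show False by simp
  qed
  moreover have "0 \<le> (\<integral>x. envelope (x::'a) * envelope x \<partial>lborel)"
    by (intro integral_nonneg_AE) auto
  ultimately show ?thesis by linarith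
qed

section \<open>Steps in resonance with a block, and the pairing with differences\<close>

text \<open>For \<open>l\<close> in block \<open>n\<close> the frequency is
  \<open>2 ^ (2 ^ n) * (2 ^ (l - 2 ^ n) + 1/4)\<close>; multiplied by this step it is an odd
  multiple of \<open>pi\<close>.\<close>

definition step :: "nat \<Rightarrow> real" where
  "step n = 4 * pi / 2 ^ (2 ^ n)"

lemma floor_log_block: "l \<in> {2 ^ n..<2 ^ Suc n} \<Longrightarrow> floor_log l = n"
  by (intro floor_log_eqI) auto

lemma cis_freq_step:
  assumes "l \<in> {2 ^ n..<2 ^ Suc n}"
  shows "cis (freq l * (real m * step n)) = complex_of_real ((-1) ^ m)"
proof -
  have l: "l = 2 ^ n + (l - 2 ^ n)" using assms by auto
  have "(2::real) ^ l = 2 ^ (2 ^ n) * 2 ^ (l - 2 ^ n)"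
    by (subst l) (rule power_add)
  then have "freq l * step n = 2 * pi * real (2 * 2 ^ (l - 2 ^ n)) + pi"
    unfolding freq_def step_def floor_log_block[OF assms] by (simp add: field_simps)
  then have "freq l * (real m * step n) = real m * (2 * pi * real (2 * 2 ^ (l - 2 ^ n)) + pi)"
    by (simp add: mult_ac)
  then have "cis (freq l * (real m * step n)) = cis (2 * pi * real (2 * 2 ^ (l - 2 ^ n)) + pi) ^ m"
    by (simp only: Complex.DeMoivre)
  also have "cis (2 * pi * real (2 * 2 ^ (l - 2 ^ n)) + pi) = -1"
    using cis_multiple_2pi[of "real (2 * 2 ^ (l - 2 ^ n))"] by (simp add: cis_mult[symmetric])
  finally show ?thesis by simp
qed

context lacunary
begin

definition test :: "nat set \<Rightarrow> 'a \<Rightarrow> complex" where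
  "test S x = (\<Sum>l\<in>S. cnj (wave l x))"

lemma test_measurable [measurable]: "test S \<in> borel_measurable borel"
  unfolding test_def wave_def cis_cnj complex_cnj_mult complex_cnj_complex_of_real by measurable

lemma norm_test_le: "norm (test S x) \<le> (\<Sum>l\<in>S. envelope (x - \<rho> l *\<^sub>R e))"
  unfolding test_def by (rule order_trans[OF norm_sum]) (simp add: norm_wave)

text \<open>Only \<open>V 0\<close> is evaluated; for the other translates nonnegative overlaps
  suffice, since the signs \<open>(-1) ^ m\<close> produced by the step match the alternating signs
  of the difference operator.\<close>

theorem diff_op_norm_ge:
  assumes S: "S \<subseteq> {2 ^ n..<2 ^ Suc n}"
    and p: "1 < p" "1 < p'" "1 / p + 1 / p' = 1"
    and G: "integrable lborel (\<lambda>x. norm (test S x) powr p')" "(\<integral>x. norm (test S x) powr p' \<partial>lborel) \<le> B powr p'"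
    and B: "0 < B"
  shows "ennreal ((\<Sum>l\<in>S. a l) * (\<integral>x. envelope (x::'a) * envelope x \<partial>lborel) / B) \<le> Lp_norm p (diff_op k (step n *\<^sub>R e) series)"
proof -
  let ?h = "step n *\<^sub>R e"
  define \<Psi> where "\<Psi> l u = (\<integral>x. envelope (x - \<rho> l *\<^sub>R e) * envelope (x - (\<rho> l + u) *\<^sub>R e) \<partial>lborel)" for l u
  define V where "V m = (\<Sum>l\<in>S. a l * \<Psi> l (real m * step n))" for m :: nat
  have \<Psi>0: "0 \<le> \<Psi> l u" for l u
    unfolding \<Psi>_def by (intro integral_nonneg_AE AE_I2 mult_nonneg_nonneg envelope_nonneg)
  have V: "0 \<le> V m" for m
    unfolding V_def by (intro sum_nonneg mult_nonneg_nonneg \<Psi>0 a_nonneg)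
  have pair: "has_bochner_integral lborel (\<lambda>x. series (x + real m *\<^sub>R ?h) * test S x) (complex_of_real ((-1) ^ m * V m))" for m
  proof -
    have "has_bochner_integral lborel (\<lambda>x. \<Sum>l\<in>S. series (x + (real m * step n) *\<^sub>R e) * cnj (wave l x))
        (\<Sum>l\<in>S. complex_of_real (a l * \<Psi> l (real m * step n)) * cis (freq l * (real m * step n)))"
      unfolding \<Psi>_def by (intro has_bochner_integral_sum wave_correlation)
    moreover have "(\<Sum>l\<in>S. complex_of_real (a l * \<Psi> l (real m * step n)) * cis (freq l * (real m * step n))) =
        (\<Sum>l\<in>S. complex_of_real (a l * \<Psi> l (real m * step n)) * complex_of_real ((-1) ^ m))"
      using S by (intro sum.cong refl) (metis cis_freq_step subsetD)
    moreover have "\<dots> = complex_of_real ((-1) ^ m * V m)"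
      unfolding V_def of_real_mult of_real_sum sum_distrib_left by (simp add: mult_ac)
    ultimately show ?thesis by (simp add: test_def sum_distrib_left)
  qed
  obtain W where W: "V 0 \<le> W" "has_bochner_integral lborel (\<lambda>x. diff_op k ?h series (x + real 0 *\<^sub>R ?h) * test S x) (complex_of_real ((-1) ^ (0 + k) * W))"
    using diff_op_alternating[where V=V and m=0, OF pair V] by blast
  let ?F = "diff_op k ?h series"
  have FG: "integrable lborel (\<lambda>x. ?F x * test S x)" "(\<integral>x. ?F x * test S x \<partial>lborel) = complex_of_real ((-1) ^ k * W)"
    using W(2) by (auto simp: has_bochner_integral_iff)
  have "norm (\<integral>x. ?F x * test S x \<partial>lborel) = \<bar>W\<bar>"
    unfolding FG by (simp add: norm_mult norm_power)
  moreover have "V 0 = (\<Sum>l\<in>S. a l) * (\<integral>x. envelope (x::'a) * envelope x \<partial>lborel)"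
  proof -
    have "\<Psi> l 0 = (\<integral>x. envelope (x::'a) * envelope x \<partial>lborel)" for l
      using lborel_integral_shift[OF integrable_envelope_mult[of "0::'a" 0], of "- \<rho> l *\<^sub>R e"] by (simp add: \<Psi>_def)
    then show ?thesis by (simp add: V_def sum_distrib_right)
  qed
  ultimately have "(\<Sum>l\<in>S. a l) * (\<integral>x. envelope (x::'a) * envelope x \<partial>lborel) / B \<le> norm (\<integral>x. ?F x * test S x \<partial>lborel) / B"
    using W(1) B by (intro divide_right_mono) auto
  also have "ennreal \<dots> \<le> Lp_norm p ?F"
    by (rule Lp_norm_dual_bound[OF p diff_op_measurable FG(1) G B]) measurable
  finally show ?thesis by (simp add: ennreal_leI)
qed

section \<open>Norms of unweighted blocks in the dual exponent\<close>

lemma integrable_norm_test: "integrable lborel (\<lambda>x. norm (test S x))"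
proof (rule Bochner_Integration.integrable_bound)
  show "integrable lborel (\<lambda>x. \<Sum>l\<in>S. envelope (x - \<rho> l *\<^sub>R e))"
    by (intro Bochner_Integration.integrable_sum integrable_envelope_shift)
qed (use norm_test_le in \<open>auto intro!: AE_I2 order_trans[OF norm_test_le abs_ge_self]\<close>)

lemma integral_norm_test_le: "(\<integral>x. norm (test S x) \<partial>lborel) \<le> card S * integral\<^sup>L lborel (envelope :: 'a \<Rightarrow> real)"
proof -
  have "(\<integral>x. norm (test S x) \<partial>lborel) \<le> (\<integral>x. (\<Sum>l\<in>S. envelope (x - \<rho> l *\<^sub>R e)) \<partial>lborel)"
    by (intro integral_mono integrable_norm_test norm_test_le Bochner_Integration.integrable_sum integrable_envelope_shift)
  then show ?thesis
    by (simp add: Bochner_Integration.integral_sum integrable_envelope_shift integral_envelope_shift)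
qed

text \<open>Envelopes at distinct integers have a bounded sum by \<open>sum_decay_le\<close>. A
  function bounded by \<open>M\<close> satisfies
  \<open>|u| powr q \<le> M powr (q - 1) * |u|\<close>, and the \<open>L_1\<close> norm is at most
  proportional to \<open>card S\<close>.\<close>

lemma test_norm_spread:
  assumes q: "1 \<le> q" and spread: "\<And>j. \<rho> j = real j"
  shows "\<exists>C>0. \<forall>S. finite S \<longrightarrow> integrable lborel (\<lambda>x. norm (test S x) powr q) \<and>
    (\<integral>x. norm (test S x) powr q \<partial>lborel) \<le> (C * real (card S) powr (1 / q)) powr q"
proof -
  obtain C where C: "C > 0" "\<And>x::'a. envelope x \<le> C * weight x" using envelope_le_weight by blast
  define M where "M = C * (2 * (\<Sum>n. decay (real n))) + 1"
  have M0: "0 < M"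
    unfolding M_def using C(1) by (intro add_nonneg_pos mult_nonneg_nonneg suminf_nonneg summable_decay less_imp_le[OF decay_pos]) auto
  let ?E = "integral\<^sup>L lborel (envelope :: 'a \<Rightarrow> real)"
  have E0: "0 \<le> ?E" by (intro integral_nonneg_AE AE_I2 envelope_nonneg)
  define D where "D = (M powr (q - 1) * (?E + 1)) powr (1 / q)"
  have "integrable lborel (\<lambda>x. norm (test S x) powr q) \<and>
      (\<integral>x. norm (test S x) powr q \<partial>lborel) \<le> (D * real (card S) powr (1 / q)) powr q" if S: "finite S" for S
  proof -
    have bd: "norm (test S x) \<le> M" for x
    proof -
      have "norm (test S x) \<le> (\<Sum>l\<in>S. C * decay (x \<bullet> e - real l))"
      proof (rule order_trans[OF norm_test_le sum_mono])
        fix l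
        have "(\<Prod>b\<in>Basis - {e}. decay (x \<bullet> b)) \<le> 1"
          by (intro prod_le_1) (auto intro: decay_le_1 less_imp_le[OF decay_pos])
        then have "weight (x - \<rho> l *\<^sub>R e) \<le> decay (x \<bullet> e - real l) * 1"
          unfolding weight_axis[OF e] spread by (intro mult_left_mono) (auto intro: less_imp_le[OF decay_pos])
        then show "envelope (x - \<rho> l *\<^sub>R e) \<le> C * decay (x \<bullet> e - real l)"
          using C by (intro order_trans[OF C(2)] mult_left_mono) auto
      qed
      also have "\<dots> \<le> C * (2 * (\<Sum>n. decay (real n)))"
        unfolding sum_distrib_left[symmetric] using C(1) by (intro mult_left_mono sum_decay_le S) auto
      finally show ?thesis by (simp add: M_def)
    qed
    have le: "norm (test S x) powr q \<le> M powr (q - 1) * norm (test S x)" for x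
    proof -
      have "norm (test S x) powr q = norm (test S x) powr (q - 1) * norm (test S x)"
        by (cases "norm (test S x) = 0") (auto simp: powr_diff)
      also have "\<dots> \<le> M powr (q - 1) * norm (test S x)"
        using q bd by (intro mult_right_mono powr_mono2) auto
      finally show ?thesis .
    qed
    have int: "integrable lborel (\<lambda>x. norm (test S x) powr q)"
      by (rule Bochner_Integration.integrable_bound[OF integrable_mult_right[OF integrable_norm_test[of S], of "M powr (q - 1)"]])
        (use le in auto)
    have "(\<integral>x. norm (test S x) powr q \<partial>lborel) \<le> (\<integral>x. M powr (q - 1) * norm (test S x) \<partial>lborel)"
      by (intro integral_mono int integrable_mult_right integrable_norm_test le)
    then have "(\<integral>x. norm (test S x) powr q \<partial>lborel) \<le> M powr (q - 1) * (\<integral>x. norm (test S x) \<partial>lborel)" by simp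
    also have "\<dots> \<le> M powr (q - 1) * (card S * (?E + 1))"
      by (intro mult_left_mono order_trans[OF integral_norm_test_le]) auto
    also have "\<dots> = (D * real (card S) powr (1 / q)) powr q"
      using q E0 by (simp add: D_def powr_mult powr_powr)
    finally show ?thesis using int by simp
  qed
  moreover have "0 < D" using M0 E0 by (auto simp: D_def)
  ultimately show ?thesis by blast
qed

lemma test_norm_single:
  assumes q: "1 \<le> q"
  shows "\<exists>C>0. \<forall>l. integrable lborel (\<lambda>x. norm (test {l} x) powr q) \<and>
    (\<integral>x. norm (test {l} x) powr q \<partial>lborel) \<le> C powr q"
proof -
  let ?E = "integral\<^sup>L lborel (envelope :: 'a \<Rightarrow> real)"
  have E0: "0 \<le> ?E" by (intro integral_nonneg_AE AE_I2 envelope_nonneg)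
  have le: "norm (test {l} x) powr q \<le> envelope (x - \<rho> l *\<^sub>R e)" for l x
  proof -
    have "norm (test {l} x) powr q = envelope (x - \<rho> l *\<^sub>R e) powr q"
      by (simp add: test_def norm_wave)
    also have "\<dots> \<le> envelope (x - \<rho> l *\<^sub>R e) powr 1"
      using q by (intro powr_mono') (auto intro: envelope_nonneg envelope_le_1)
    finally show ?thesis by (simp add: envelope_nonneg)
  qed
  have int: "integrable lborel (\<lambda>x. norm (test {l} x) powr q)" for l
    by (rule Bochner_Integration.integrable_bound[OF integrable_envelope_shift[of "\<rho> l *\<^sub>R e"]])
      (use le in \<open>auto simp: abs_of_nonneg[OF envelope_nonneg]\<close>)
  have "(\<integral>x. norm (test {l} x) powr q \<partial>lborel) \<le> ((?E + 1) powr (1 / q)) powr q" for l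
  proof -
    have "(\<integral>x. norm (test {l} x) powr q \<partial>lborel) \<le> ?E"
      using integral_mono[OF int integrable_envelope_shift le] by (simp add: integral_envelope_shift)
    then show ?thesis using q E0 by (simp add: powr_powr)
  qed
  then show ?thesis using int E0 by (intro exI[of _ "(?E + 1) powr (1 / q)"]) auto
qed

text \<open>For waves with a common centre the square function is computed exactly by orthogonality;
  since \<open>t\<^sup>q \<le> 1 + t\<^sup>2\<close> for \<open>q \<le> 2\<close> this controls the \<open>L\<^sub>q\<close> norm.\<close>

lemma test_square:
  assumes S: "finite S" and z: "\<And>l. l \<in> S \<Longrightarrow> \<rho> l = z"
  defines "E \<equiv> \<lambda>x. \<Sum>l\<in>S. cis (- (freq l * (x \<bullet> e)))"
  shows "has_bochner_integral lborel (\<lambda>x. envelope (x - z *\<^sub>R e) * (norm (E x))\<^sup>2)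
      (real (card S) * integral\<^sup>L lborel (envelope :: 'a \<Rightarrow> real))"
proof -
  let ?I = "integral\<^sup>L lborel (envelope :: 'a \<Rightarrow> real)"
  let ?g = "\<lambda>l m x. complex_of_real (envelope (x - z *\<^sub>R e)) * cis (x \<bullet> ((freq m - freq l) *\<^sub>R e))"
  have g: "has_bochner_integral lborel (?g l m) (if l = m then complex_of_real ?I else 0)" for l m
  proof -
    have int: "integrable lborel (?g l m)"
      by (intro integrable_cis_mult integrable_of_real integrable_envelope_shift) auto
    show ?thesis
    proof (cases "l = m")
      case True
      then show ?thesis using int by (simp add: has_bochner_integral_iff integral_envelope_shift)
    next
      case False
      then have "norm ((freq m - freq l) *\<^sub>R e) \<ge> 1 / 4" using freq_gap[of m l] e by simp
      from fourier_envelope[OF this] show ?thesis using int False by (simp add: has_bochner_integral_iff)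
    qed
  qed
  have "has_bochner_integral lborel (\<lambda>x. \<Sum>l\<in>S. \<Sum>m\<in>S. ?g l m x) (\<Sum>l\<in>S. \<Sum>m\<in>S. if l = m then complex_of_real ?I else 0)"
    by (intro has_bochner_integral_sum g)
  moreover have "(\<Sum>l\<in>S. \<Sum>m\<in>S. if l = m then complex_of_real ?I else 0) = complex_of_real (real (card S) * ?I)"
    using S by (simp add: sum.delta)
  moreover have "(\<Sum>l\<in>S. \<Sum>m\<in>S. ?g l m x) = complex_of_real (envelope (x - z *\<^sub>R e) * (norm (E x))\<^sup>2)" for x
  proof -
    have "complex_of_real ((norm (E x))\<^sup>2) = E x * cnj (E x)"
      by (rule complex_norm_square)
    also have "\<dots> = (\<Sum>l\<in>S. \<Sum>m\<in>S. cis (x \<bullet> ((freq m - freq l) *\<^sub>R e)))"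
      unfolding E_def cnj_sum sum_product cis_cnj cis_mult by (simp add: algebra_simps)
    finally show ?thesis by (simp add: sum_distrib_left)
  qed
  ultimately have "has_bochner_integral lborel (\<lambda>x. complex_of_real (envelope (x - z *\<^sub>R e) * (norm (E x))\<^sup>2)) (complex_of_real (real (card S) * ?I))"
    by simp
  then show ?thesis
    unfolding has_bochner_integral_iff complex_of_real_integrable_eq integral_complex_of_real of_real_eq_iff .
qed

lemma test_norm_concentrated:
  assumes q: "1 \<le> q" "q \<le> 2"
  shows "\<exists>C>0. \<forall>S z. finite S \<longrightarrow> (\<forall>l\<in>S. \<rho> l = z) \<longrightarrow> integrable lborel (\<lambda>x. norm (test S x) powr q) \<and>
    (\<integral>x. norm (test S x) powr q \<partial>lborel) \<le> (C * sqrt (real (card S))) powr q"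
proof -
  let ?I = "integral\<^sup>L lborel (envelope :: 'a \<Rightarrow> real)"
  have I0: "0 \<le> ?I" by (intro integral_nonneg_AE AE_I2 envelope_nonneg)
  have "integrable lborel (\<lambda>x. norm (test S x) powr q) \<and>
    (\<integral>x. norm (test S x) powr q \<partial>lborel) \<le> ((2 * ?I + 1) powr (1 / q) * sqrt (real (card S))) powr q"
    if S: "finite S" and z: "\<forall>l\<in>S. \<rho> l = z" for S z
  proof (cases "S = {}")
    case True
    then show ?thesis using q by (simp add: test_def)
  next
    case False
    define s where "s = sqrt (real (card S))"
    have s: "0 < s" "s\<^sup>2 = real (card S)" using False S by (auto simp: s_def card_gt_0_iff)
    let ?E = "\<lambda>x. \<Sum>l\<in>S. cis (- (freq l * (x \<bullet> e)))"
    let ?v = "\<lambda>x. envelope (x - z *\<^sub>R e)"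
    have test: "test S x = complex_of_real (?v x) * ?E x" for x
      using z by (simp add: test_def wave_def cis_cnj sum_distrib_left mult.commute)
    have le: "norm (test S x) powr q \<le> s powr q * (?v x + ?v x * (norm (?E x))\<^sup>2 / s\<^sup>2)" for x
    proof -
      \<comment> \<open>Division by the expected size \<open>s\<close> gives
        \<open>?v * t\<^sup>2\<close> the same integral as \<open>?v\<close>; this is the origin of
        \<open>2 * ?I\<close>.\<close>
      define t where "t = norm (?E x) / s"
      have t: "0 \<le> t" "norm (?E x) = s * t" using s by (auto simp: t_def)
      have "norm (test S x) = ?v x * (s * t)" unfolding test norm_mult t(2) by (simp add: envelope_nonneg)
      then have "norm (test S x) powr q = s powr q * (?v x powr q * t powr q)"
        using s t by (simp add: powr_mult envelope_nonneg)
      also have "\<dots> \<le> s powr q * (?v x * (1 + t\<^sup>2))"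
      proof (intro mult_left_mono mult_mono)
        have "?v x powr q \<le> ?v x powr 1"
          using q by (intro powr_mono') (auto intro: envelope_nonneg envelope_le_1)
        then show "?v x powr q \<le> ?v x" by (simp add: envelope_nonneg)
        show "t powr q \<le> 1 + t\<^sup>2"
        proof (cases "t \<le> 1")
          case True
          then have "t powr q \<le> 1" using t q by (intro powr_le1) auto
          then show ?thesis by (simp add: add_increasing2)
        next
          case False
          then have "t powr q \<le> t powr 2" using q by (intro powr_mono) auto
          then show ?thesis using False by simp
        qed
      qed (auto intro: envelope_nonneg)
      also have "\<dots> = s powr q * (?v x + ?v x * (norm (?E x))\<^sup>2 / s\<^sup>2)"
        using s by (simp add: t_def power_divide distrib_left)
      finally show ?thesis .
    qed
    have sq: "has_bochner_integral lborel (\<lambda>x. ?v x * (norm (?E x))\<^sup>2) (s\<^sup>2 * ?I)"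
      unfolding s(2) by (rule test_square[OF S]) (use z in auto)
    have "has_bochner_integral lborel (\<lambda>x. ?v x + ?v x * (norm (?E x))\<^sup>2 / s\<^sup>2) (?I + s\<^sup>2 * ?I / s\<^sup>2)"
      using integrable_envelope_shift[of "z *\<^sub>R e"] integral_envelope_shift[of "z *\<^sub>R e"]
      by (intro has_bochner_integral_add has_bochner_integral_divide sq) (auto simp: has_bochner_integral_iff)
    from has_bochner_integral_mult_right[of "s powr q", OF this]
    have R: "has_bochner_integral lborel (\<lambda>x. s powr q * (?v x + ?v x * (norm (?E x))\<^sup>2 / s\<^sup>2)) (s powr q * (2 * ?I))"
    proof -
      have "?I + s\<^sup>2 * ?I / s\<^sup>2 = 2 * ?I" using s(1) by simp
      with \<open>has_bochner_integral lborel _ (s powr q * (?I + s\<^sup>2 * ?I / s\<^sup>2))\<close> show ?thesis by (simp only:)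
    qed
    have int: "integrable lborel (\<lambda>x. norm (test S x) powr q)"
      by (rule Bochner_Integration.integrable_bound[OF integrable.intros[OF R]])
        (use order_trans[OF le abs_ge_self] in \<open>auto simp del: abs_mult\<close>)
    have "(\<integral>x. norm (test S x) powr q \<partial>lborel) \<le> s powr q * (2 * ?I)"
      unfolding has_bochner_integral_integral_eq[OF R, symmetric] by (rule integral_mono[OF int integrable.intros[OF R] le])
    also have "\<dots> \<le> s powr q * (2 * ?I + 1)" by (intro mult_left_mono) auto
    also have "\<dots> = ((2 * ?I + 1) powr (1 / q) * s) powr q"
      using s q I0 by (simp add: powr_mult powr_powr)
    finally show ?thesis using int by (simp add: s_def)
  qed
  then show ?thesis using I0 by (intro exI[of _ "(2 * ?I + 1) powr (1 / q)"]) auto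
qed

end

subsection \<open>Divergence and convergence of the logarithmic quasi-norms\<close>

lemma eq_top_if_geometric_lower_bound:
  fixes X :: ennreal
  assumes "0 < K" "0 < \<delta>" and le: "\<And>n::nat. ennreal (K * 2 powr (real n * \<delta>)) \<le> X"
  shows "X = top"
proof (cases X)
  case (real r)
  obtain n :: nat where n: "log 2 (r / K + 1) / \<delta> < real n" using reals_Archimedean2 by blast
  have pos: "0 < r / K + 1" using real(1) assms(1) by (simp add: add_nonneg_pos)
  have "log 2 (r / K + 1) < real n * \<delta>" using n assms(2) by (simp add: pos_divide_less_eq)
  then have "r / K + 1 < 2 powr (real n * \<delta>)" using pos by (simp add: log_less_iff)
  then have "r < K * 2 powr (real n * \<delta>)"
    using assms(1) by (simp add: field_simps)
  moreover have "ennreal (K * 2 powr (real n * \<delta>)) \<le> ennreal r" using le[of n] real by simp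
  ultimately show ?thesis using real(1) by (simp add: ennreal_le_iff)
qed simp

text \<open>With \<open>M = 2 ^ n\<close>, both \<open>exp (2 * M)\<close> and \<open>4 * pi\<close>
  are at most \<open>2 ^ (4 * M)\<close>. Their product is at most \<open>2 ^ (8 * M)\<close>, which
  is \<open>2 ^ (2 ^ (n + 3))\<close>: hence the offset 3.\<close>

lemma step_le_exp: "step (n + 3) \<le> exp (- (2 * 2 ^ n))"
proof -
  define M :: nat where "M = 2 ^ n"
  have M: "1 \<le> M" by (simp add: M_def)
  have "exp (2 * real M) = exp 1 ^ (2 * M)"
    by (simp add: exp_of_nat_mult[symmetric])
  also have "\<dots> \<le> 4 ^ (2 * M)"
    using exp_le by (intro power_mono) auto
  also have "\<dots> = (2 ^ 2) ^ (2 * M)" by simp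
  also have "\<dots> = 2 ^ (4 * M)" unfolding power_mult[symmetric] by (simp add: mult.assoc)
  finally have "exp (2 * real M) \<le> 2 ^ (4 * M)" .
  moreover have "4 * pi \<le> 2 ^ (4 * M)"
  proof -
    have "4 * pi \<le> 2 ^ 4" using pi_less_4 by simp
    also have "\<dots> \<le> 2 ^ (4 * M)" using M by (intro power_increasing) auto
    finally show ?thesis .
  qed
  ultimately have "4 * pi * exp (2 * real M) \<le> 2 ^ (4 * M) * 2 ^ (4 * M)"
    by (intro mult_mono) auto
  also have "\<dots> = 2 ^ (2 ^ (n + 3))"
    unfolding power_add[symmetric] by (simp add: M_def power_add)
  finally have "4 * pi \<le> 2 ^ (2 ^ (n + 3)) * exp (- (2 * real M))"
    by (simp add: exp_minus field_simps)
  then show ?thesis by (simp add: step_def M_def pos_divide_le_eq mult.commute)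
qed

text \<open>The window \<open>exp (- (2 * 2 ^ n)) \<le> t \<le> exp (- (2 ^ n))\<close> lies above
  \<open>step (n + 3)\<close>, has mass \<open>2 ^ n\<close> for \<open>dt / t\<close>, and its
  logarithmic weight is comparable to \<open>2 powr (n * b)\<close>. For finite \<open>q\<close>
  this window alone contributes a multiple of \<open>2 powr (n * \<delta> * q)\<close>.\<close>

lemma log_diff_seminorm_top:
  fixes f :: "'a::euclidean_space \<Rightarrow> complex"
  assumes q: "0 < q" and c: "0 < c" and \<delta>: "0 < \<delta>"
    and \<omega>: "\<And>n t. step n \<le> t \<Longrightarrow>
      ennreal (c * 2 powr (- (real n * (b + 1 / real_of_ereal q - \<delta>)))) \<le> modulus_smooth k p f t"
  shows "log_diff_seminorm k b p q f = top"
proof -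
  let ?r = "real_of_ereal q"
  let ?\<beta> = "b + 1 / ?r - \<delta>"
  \<comment> \<open>\<open>1 - ln t\<close> lies between \<open>2 ^ n\<close> and
    \<open>3 * 2 ^ n\<close>; the lower end matters for \<open>b \<ge> 0\<close>, the upper end for
    \<open>b < 0\<close>.\<close>
  define c' where "c' = min 1 (3 powr b)"
  \<comment> \<open>The power of 2 corrects the index from \<open>n + 3\<close> back to
    \<open>n\<close>.\<close>
  define K where "K = c' * c * 2 powr (- (3 * ?\<beta>))"
  have c': "0 < c'" by (simp add: c'_def)
  have K: "0 < K" using c' c by (simp add: K_def)
  have weight: "ennreal (K * 2 powr (real n * (\<delta> - 1 / ?r))) \<le> ennreal ((1 - ln t) powr b) * modulus_smooth k p f t"
    if t: "exp (- (2 * 2 ^ n)) \<le> t" "t \<le> exp (- (2 ^ n))" for n t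
  proof -
    define M :: real where "M = 2 ^ n"
    have M: "1 \<le> M" by (simp add: M_def)
    have t0: "0 < t" using t(1) exp_gt_zero[of "- (2 * 2 ^ n)"] by linarith
    have "- (2 * M) \<le> ln t" "ln t \<le> - M"
      using t t0 by (auto simp: M_def ln_ge_iff) (metis exp_gt_zero ln_exp ln_le_cancel_iff)
    then have u: "M \<le> 1 - ln t" "1 - ln t \<le> 3 * M" using M by linarith+
    have "c' * M powr b \<le> (1 - ln t) powr b"
    proof (cases "0 \<le> b")
      case True
      then have "M powr b \<le> (1 - ln t) powr b" using u M by (intro powr_mono2) auto
      moreover have "c' * M powr b \<le> 1 * M powr b" by (intro mult_right_mono) (auto simp: c'_def)
      ultimately show ?thesis by simp
    next
      case False
      have "c' * M powr b \<le> 3 powr b * M powr b" by (intro mult_right_mono) (auto simp: c'_def)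
      also have "\<dots> = (3 * M) powr b" using M by (simp add: powr_mult)
      also have "\<dots> \<le> (1 - ln t) powr b" using u M False by (intro powr_mono2') auto
      finally show ?thesis .
    qed
    moreover have "M powr b = 2 powr (real n * b)"
      by (simp add: M_def powr_powr[symmetric] powr_realpow)
    ultimately have "c' * 2 powr (real n * b) \<le> (1 - ln t) powr b" by simp
    moreover have "step (n + 3) \<le> t" using step_le_exp[of n] t(1) by linarith
    note \<omega>[OF this]
    ultimately have "ennreal (c' * 2 powr (real n * b)) * ennreal (c * 2 powr (- (real (n + 3) * ?\<beta>)))
        \<le> ennreal ((1 - ln t) powr b) * modulus_smooth k p f t"
      by (intro mult_mono ennreal_leI) auto
    also have "ennreal (c' * 2 powr (real n * b)) * ennreal (c * 2 powr (- (real (n + 3) * ?\<beta>))) =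
        ennreal (c' * c * (2 powr (real n * b) * 2 powr (- (real (n + 3) * ?\<beta>))))"
      using c' c by (simp add: ennreal_mult'[symmetric] mult_ac)
    also have "2 powr (real n * b) * 2 powr (- (real (n + 3) * ?\<beta>)) = 2 powr (- (3 * ?\<beta>)) * 2 powr (real n * (\<delta> - 1 / ?r))"
      unfolding powr_add[symmetric] by (rule arg_cong[of _ _ "(powr) 2"]) (simp add: algebra_simps)
    finally show ?thesis by (simp add: K_def mult_ac)
  qed
  show ?thesis
  proof (cases "q = \<infinity>")
    case True
    let ?g = "\<lambda>t. ennreal ((1 - ln t) powr b) * modulus_smooth k p f t"
    have "(SUP t\<in>{0<..<1}. ?g t) = top"
    proof (rule eq_top_if_geometric_lower_bound[OF K \<delta>])
      fix n :: nat
      \<comment> \<open>\<open>real_of_ereal \<infinity> = 0\<close>, so \<open>1 / ?r\<close> is 0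
        and the exponent in \<open>weight\<close> is \<open>n * \<delta>\<close>.\<close>
      have "ennreal (K * 2 powr (real n * \<delta>)) \<le> ?g (exp (- (2 ^ n)))"
        using weight[of n "exp (- (2 ^ n))"] True by simp
      also have "\<dots> \<le> (SUP t\<in>{0<..<1}. ?g t)" by (intro SUP_upper) auto
      finally show "ennreal (K * 2 powr (real n * \<delta>)) \<le> (SUP t\<in>{0<..<1}. ?g t)" .
    qed
    then show ?thesis using True by (simp add: log_diff_seminorm_def)
  next
    case False
    then have r: "0 < ?r" using q by (cases q) auto
    let ?g = "\<lambda>t. epowr (ennreal ((1 - ln t) powr b) * modulus_smooth k p f t) ?r * ennreal (1 / t)"
    have "(\<integral>\<^sup>+ t\<in>{0<..<1}. ?g t \<partial>lborel) = top"
    proof (rule eq_top_if_geometric_lower_bound)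
      show "0 < K powr ?r" "0 < \<delta> * ?r" using K \<delta> r by auto
      fix n :: nat
      define M :: real where "M = 2 ^ n"
      have M: "1 \<le> M" by (simp add: M_def)
      define A where "A = (K * 2 powr (real n * (\<delta> - 1 / ?r))) powr ?r"
      have "(\<integral>\<^sup>+ t. ennreal (1 / t) * indicator {exp (- (2 * M))..exp (- M)} t \<partial>lborel) = ennreal (ln (exp (- M)) - ln (exp (- (2 * M))))"
      proof (rule nn_integral_FTC_Icc)
        fix t assume "t \<in> {exp (- (2 * M))..exp (- M)}"
        then have "0 < t" using exp_gt_zero[of "- (2 * M)"] by (auto simp del: exp_gt_zero intro: less_le_trans)
        then show "(ln has_real_derivative 1 / t) (at t)" "0 \<le> 1 / t" by (auto intro!: derivative_eq_intros)
      qed (use M in auto)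
      then have "ennreal A * ennreal M = (\<integral>\<^sup>+ t. ennreal A * (ennreal (1 / t) * indicator {exp (- (2 * M))..exp (- M)} t) \<partial>lborel)"
        by (subst nn_integral_cmult) auto
      also have "\<dots> \<le> (\<integral>\<^sup>+ t\<in>{0<..<1}. ?g t \<partial>lborel)"
      proof (intro nn_integral_mono)
        fix t :: real
        show "ennreal A * (ennreal (1 / t) * indicator {exp (- (2 * M))..exp (- M)} t) \<le> ?g t * indicator {0<..<1} t"
        proof (cases "t \<in> {exp (- (2 * M))..exp (- M)}")
          case True
          have "0 < exp (- (2 * M))" "exp (- M) < 1" using M by auto
          then have t: "t \<in> {0<..<1}"
            using True unfolding atLeastAtMost_iff greaterThanLessThan_iff by linarith
          have "ennreal A = epowr (ennreal (K * 2 powr (real n * (\<delta> - 1 / ?r)))) ?r"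
            unfolding A_def using K by (intro epowr_ennreal[symmetric]) auto
          also have "\<dots> \<le> epowr (ennreal ((1 - ln t) powr b) * modulus_smooth k p f t) ?r"
            using True r by (intro epowr_mono weight) (auto simp: M_def)
          finally have "ennreal A * ennreal (1 / t) \<le> ?g t" by (rule mult_right_mono) simp
          then show ?thesis using True t by simp
        qed simp
      qed
      also have "ennreal A * ennreal M = ennreal (K powr ?r * 2 powr (real n * (\<delta> * ?r)))"
      proof -
        have "A = K powr ?r * 2 powr (real n * (\<delta> - 1 / ?r) * ?r)"
          unfolding A_def using K by (simp add: powr_mult powr_powr)
        moreover have "M = 2 powr (real n)" by (simp add: M_def powr_realpow)
        moreover have "real n * (\<delta> - 1 / ?r) * ?r + real n = real n * (\<delta> * ?r)"
          using r by (simp add: field_simps)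
        ultimately have "A * M = K powr ?r * 2 powr (real n * (\<delta> * ?r))"
          by (simp add: powr_add[symmetric] mult.assoc)
        then show ?thesis using M by (simp add: ennreal_mult''[symmetric])
      qed
      finally show "ennreal (K powr ?r * 2 powr (real n * (\<delta> * ?r))) \<le> (\<integral>\<^sup>+ t\<in>{0<..<1}. ?g t \<partial>lborel)" .
    qed
    then show ?thesis using False by (simp add: log_diff_seminorm_def)
  qed
qed

section \<open>Finiteness of the Fourier-side quasi-norm\<close>

lemma shifted_weight_le: "(1 + real i) powr s \<le> max 1 (2 powr s) * (1 + real (i - 1)) powr s"
proof (cases "0 \<le> s")
  case True
  have "(1 + real i) powr s \<le> (2 * (1 + real (i - 1))) powr s"
    using True by (intro powr_mono2) auto
  also have "\<dots> = 2 powr s * (1 + real (i - 1)) powr s" by (rule powr_mult)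
  also have "\<dots> \<le> max 1 (2 powr s) * (1 + real (i - 1)) powr s" by (intro mult_right_mono) auto
  finally show ?thesis .
next
  case False
  then have "(1 + real i) powr s \<le> 1 * (1 + real (i - 1)) powr s"
    by (simp, intro powr_mono2') auto
  also have "\<dots> \<le> max 1 (2 powr s) * (1 + real (i - 1)) powr s" by (intro mult_right_mono) auto
  finally show ?thesis .
qed

lemma besov_norm_finite:
  fixes T :: "('a::euclidean_space \<Rightarrow> complex) \<Rightarrow> complex" and a :: "nat \<Rightarrow> real"
  assumes q: "0 < q" and a: "\<And>i. 0 \<le> a i" and C: "0 \<le> C"
    and le: "\<And>i. dist_Lp_norm p (dist_inv_fourier (dist_mult (dyadic \<phi>0 i) (dist_fourier T))) \<le> ennreal (C * (a i + a (i - 1)))"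
    and fin: "q \<noteq> \<infinity> \<Longrightarrow> summable (\<lambda>i. ((1 + real i) powr s * a i) powr real_of_ereal q)"
    and inf: "q = \<infinity> \<Longrightarrow> bounded (range (\<lambda>i. (1 + real i) powr s * a i))"
  shows "besov_norm \<phi>0 0 s p q T < top"
proof -
  define u where "u i = (1 + real i) powr s * a i" for i
  have u: "0 \<le> u i" for i using a by (simp add: u_def)
  define K where "K = C * max 1 (2 powr s)"
  have K: "0 \<le> K" using C by (simp add: K_def)
  let ?a = "\<lambda>j::nat. ennreal (2 powr (real j * 0) * (1 + real j) powr s) *
      dist_Lp_norm p (dist_inv_fourier (dist_mult (dyadic \<phi>0 j) (dist_fourier T)))"
  have le': "?a i \<le> ennreal (K * (u i + u (i - 1)))" for i
  proof -
    have "?a i \<le> ennreal ((1 + real i) powr s) * ennreal (C * (a i + a (i - 1)))"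
      using le[of i] by (simp add: mult_left_mono)
    also have "\<dots> = ennreal (C * ((1 + real i) powr s * a i + (1 + real i) powr s * a (i - 1)))"
      by (simp add: ennreal_mult'[symmetric] algebra_simps)
    also have "\<dots> \<le> ennreal (C * (max 1 (2 powr s) * u i + max 1 (2 powr s) * u (i - 1)))"
    proof (intro ennreal_leI mult_left_mono add_mono C)
      show "(1 + real i) powr s * a i \<le> max 1 (2 powr s) * u i"
        using mult_right_mono[of 1 "max 1 (2 powr s)" "u i"] u by (simp add: u_def)
      show "(1 + real i) powr s * a (i - 1) \<le> max 1 (2 powr s) * u (i - 1)"
        using mult_right_mono[OF shifted_weight_le[of i s] a[of "i - 1"]] by (simp add: u_def mult.assoc)
    qed
    finally show ?thesis by (simp add: K_def algebra_simps)
  qed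
  show ?thesis
  proof (cases "q = \<infinity>")
    case True
    obtain B where B: "\<And>i. \<bar>u i\<bar> \<le> B"
      using inf[OF True] by (auto simp: bounded_iff u_def)
    have "(SUP j. ?a j) \<le> ennreal (K * (B + B))"
    proof (rule SUP_least)
      fix i
      have "u i + u (i - 1) \<le> B + B" using B[of i] B[of "i - 1"] by linarith
      then show "?a i \<le> ennreal (K * (B + B))"
        using K by (intro order_trans[OF le'] ennreal_leI mult_left_mono)
    qed
    then have "(SUP j. ?a j) < top" by (rule le_less_trans) simp
    then show ?thesis unfolding besov_norm_def Let_def if_P[OF True] .
  next
    case False
    let ?r = "real_of_ereal q"
    have r: "0 < ?r" using q False by (cases q) auto
    have sum: "summable (\<lambda>i. u i powr ?r)" using fin[OF False] by (simp add: u_def)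
    then have sum': "summable (\<lambda>i. u (i - 1) powr ?r)"
      by (subst summable_Suc_iff[symmetric]) simp
    have le'': "epowr (?a i) ?r \<le> ennreal ((2 * K) powr ?r * (u i powr ?r + u (i - 1) powr ?r))" for i
    proof -
      have "epowr (?a i) ?r \<le> epowr (ennreal (K * (u i + u (i - 1)))) ?r"
        using r by (intro epowr_mono le') auto
      also have "\<dots> = ennreal ((K * (u i + u (i - 1))) powr ?r)"
        using K u by (intro epowr_ennreal) (auto intro!: mult_nonneg_nonneg add_nonneg_nonneg)
      \<comment> \<open>Bounding the sum by twice the maximum works for every \<open>?r > 0\<close>,
        including \<open>?r < 1\<close>.\<close>
      also have "(K * (u i + u (i - 1))) powr ?r \<le> (K * (2 * max (u i) (u (i - 1)))) powr ?r"
        using K u r by (intro powr_mono2 mult_left_mono) (auto intro!: mult_nonneg_nonneg add_nonneg_nonneg)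
      also have "\<dots> = (2 * K) powr ?r * max (u i) (u (i - 1)) powr ?r"
        using K u by (simp add: powr_mult[symmetric] mult_ac le_max_iff_disj)
      also have "max (u i) (u (i - 1)) powr ?r \<le> u i powr ?r + u (i - 1) powr ?r"
        by (auto simp: max_def)
      finally show ?thesis by (simp add: ennreal_leI mult_left_mono)
    qed
    have "(\<Sum>i. epowr (?a i) ?r) \<le> (\<Sum>i. ennreal ((2 * K) powr ?r * (u i powr ?r + u (i - 1) powr ?r)))"
      by (intro suminf_le le'') auto
    also have "\<dots> < top"
      using summable_mult[OF summable_add[OF sum sum'], of "(2 * K) powr ?r"]
      by (subst suminf_ennreal2) auto
    finally have "(\<Sum>i. epowr (?a i) ?r) \<noteq> top" by simp
    then show ?thesis using False by (simp add: besov_norm_def epowr_def)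
  qed
qed

context lacunary
begin

lemma series_in_besov_fun:
  assumes gen: "dyadic_generator \<phi>0" and p: "1 < p" and q: "0 < q"
    and fin: "q \<noteq> \<infinity> \<Longrightarrow> summable (\<lambda>i. ((1 + real i) powr s * a i) powr real_of_ereal q)"
    and inf: "q = \<infinity> \<Longrightarrow> bounded (range (\<lambda>i. (1 + real i) powr s * a i))"
  shows "series \<in> besov_fun \<phi>0 0 s p q"
proof -
  obtain C where C: "C \<ge> 0" "\<And>i. dist_Lp_norm p (dist_inv_fourier (dist_mult (dyadic \<phi>0 i) (dist_fourier functional)))
    \<le> ennreal (C * (a i + a (i - 1)))"
    using dyadic_piece_norm_le[OF gen p] by blast
  have "besov_norm \<phi>0 0 s p q functional < top"
    by (rule besov_norm_finite[OF q a_nonneg C fin inf])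
  then show ?thesis
    using represents_series tempered_functional by (auto simp: besov_fun_def besov_def)
qed

text \<open>\<open>N n\<close> is the dual norm of block \<open>n\<close> up to a constant. The
  second condition on \<open>N\<close> says that the quotient left by duality decays at the very
  rate at which \<open>log_diff_seminorm_top\<close> yields divergence.\<close>

lemma series_notin_besov_diff:
  assumes S: "\<And>n. S n \<subseteq> {2 ^ n..<2 ^ Suc n}"
    and p: "1 < p" "1 < p'" "1 / p + 1 / p' = 1" and q: "0 < q" and c: "0 < c" and \<delta>: "0 < \<delta>"
    and G: "\<And>n. integrable lborel (\<lambda>x. norm (test (S n) x) powr p')"
      "\<And>n. (\<integral>x. norm (test (S n) x) powr p' \<partial>lborel) \<le> (c * N n) powr p'"
    and N: "\<And>n. 0 < N n" "\<And>n. (\<Sum>l\<in>S n. a l) = N n * 2 powr (- (real n * (b + 1 / real_of_ereal q - \<delta>)))"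
  shows "series \<notin> besov_diff k b p q"
proof -
  let ?Q = "\<integral>x. envelope (x::'a) * envelope x \<partial>lborel"
  have "log_diff_seminorm k b p q series = top"
  proof (rule log_diff_seminorm_top[OF q _ \<delta>])
    show "0 < ?Q / c" using integral_envelope_square_pos c by (intro divide_pos_pos)
    fix n t assume t: "step n \<le> t"
    have "(\<Sum>l\<in>S n. a l) * ?Q / (c * N n) = ?Q / c * 2 powr (- (real n * (b + 1 / real_of_ereal q - \<delta>)))"
      using N(1)[of n] c by (simp add: N(2))
    moreover have "0 < c * N n" using c N(1) by simp
    ultimately have "ennreal (?Q / c * 2 powr (- (real n * (b + 1 / real_of_ereal q - \<delta>)))) \<le> Lp_norm p (diff_op k (step n *\<^sub>R e) series)"
      using diff_op_norm_ge[OF S p G(1) G(2), of n k] by simp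
    also have "\<dots> \<le> modulus_smooth k p series t"
    proof -
      have "0 \<le> step n" by (simp add: step_def)
      then have "norm (step n *\<^sub>R e) \<le> t" using t e by simp
      then show ?thesis unfolding modulus_smooth_def by (intro SUP_upper) auto
    qed
    finally show "ennreal (?Q / c * 2 powr (- (real n * (b + 1 / real_of_ereal q - \<delta>)))) \<le> modulus_smooth k p series t" .
  qed
  then show ?thesis by (simp add: besov_diff_def)
qed

end

section \<open>Coefficient sequences constant on blocks or supported on powers of two\<close>

lemma floor_log_bounds: "2 ^ floor_log j \<le> real j + 1" "1 + real j \<le> 2 * 2 ^ floor_log j"
proof -
  have "real (2 ^ floor_log j) \<le> real (j + 1)"
    unfolding of_nat_le_iff using floor_log_exp2_le[of j] by (cases "j = 0") auto
  then show "2 ^ floor_log j \<le> real j + 1" by simp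
  have "real (Suc j) \<le> real (2 * 2 ^ floor_log j)"
    unfolding of_nat_le_iff using floor_log_exp2_gt[of j] by simp
  then show "1 + real j \<le> 2 * 2 ^ floor_log j" by simp
qed

lemma floor_log_powr_le:
  assumes "0 < \<kappa>"
  shows "2 powr (- (\<kappa> * real (floor_log j))) \<le> 2 powr \<kappa> * (1 + real j) powr (- \<kappa>)"
proof -
  have "(2 * 2 ^ floor_log j) powr (- \<kappa>) \<le> (1 + real j) powr (- \<kappa>)"
    using floor_log_bounds(2)[of j] assms by (intro powr_mono2') auto
  also have "(2 * 2 ^ floor_log j) powr (- \<kappa>) = 2 powr (- \<kappa>) * 2 powr (- (\<kappa> * real (floor_log j)))"
    by (simp add: powr_mult powr_powr powr_realpow[symmetric] mult.commute)
  finally have "2 powr \<kappa> * (2 powr (- \<kappa>) * 2 powr (- (\<kappa> * real (floor_log j)))) \<le> 2 powr \<kappa> * (1 + real j) powr (- \<kappa>)"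
    by (intro mult_left_mono) auto
  then show ?thesis by (simp add: powr_minus mult.assoc[symmetric])
qed

text \<open>Coefficients constant on dyadic blocks are at most a multiple of
  \<open>(1 + i) powr (- \<kappa>)\<close>, and the condition on \<open>s\<close> pushes the
  exponent of the resulting power series of integers below -1. For \<open>q = \<infinity>\<close> it
  reads \<open>s < \<kappa>\<close>.\<close>

lemma block_summable:
  assumes \<kappa>: "0 < \<kappa>" and q: "0 < q" and s: "s < \<kappa> - 1 / real_of_ereal q"
  defines "u \<equiv> \<lambda>i. (1 + real i) powr s * 2 powr (- (\<kappa> * real (floor_log i)))"
  shows "q \<noteq> \<infinity> \<Longrightarrow> summable (\<lambda>i. u i powr real_of_ereal q)" "q = \<infinity> \<Longrightarrow> bounded (range u)"
proof -
  have u0: "0 \<le> u i" for i by (simp add: u_def)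
  have u: "u i \<le> 2 powr \<kappa> * (1 + real i) powr (s - \<kappa>)" for i
  proof -
    have "u i \<le> (1 + real i) powr s * (2 powr \<kappa> * (1 + real i) powr (- \<kappa>))"
      unfolding u_def by (intro mult_left_mono floor_log_powr_le \<kappa>) auto
    also have "\<dots> = 2 powr \<kappa> * (1 + real i) powr (s - \<kappa>)"
      by (simp add: powr_diff powr_minus divide_inverse)
    finally show ?thesis .
  qed
  let ?r = "real_of_ereal q"
  show "summable (\<lambda>i. u i powr ?r)" if "q \<noteq> \<infinity>"
  proof (rule summable_comparison_test')
    have r: "0 < ?r" using q that by (cases q) auto
    have "(s - \<kappa>) * ?r < (- (1 / ?r)) * ?r" using s r by (intro mult_strict_right_mono) auto
    then have "(s - \<kappa>) * ?r < -1" using r by simp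
    then have "summable (\<lambda>n. real n powr ((s - \<kappa>) * ?r))" by (simp add: summable_real_powr_iff)
    then have "summable (\<lambda>n. real (Suc n) powr ((s - \<kappa>) * ?r))" by (subst summable_Suc_iff)
    then show "summable (\<lambda>n. (2 powr \<kappa>) powr ?r * (1 + real n) powr ((s - \<kappa>) * ?r))"
      by (intro summable_mult) simp
    show "norm (u n powr ?r) \<le> (2 powr \<kappa>) powr ?r * (1 + real n) powr ((s - \<kappa>) * ?r)" for n
      using powr_mono2[OF less_imp_le[OF r] u0 u, of n] by (simp add: powr_mult powr_powr)
  qed
  show "bounded (range u)" if "q = \<infinity>"
  proof -
    have "norm (u i) \<le> 2 powr \<kappa>" for i
    proof -
      have "(1 + real i) powr (s - \<kappa>) \<le> (1 + real i) powr 0" using s that by (intro powr_mono) auto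
      then have "2 powr \<kappa> * (1 + real i) powr (s - \<kappa>) \<le> 2 powr \<kappa> * 1" by (intro mult_left_mono) auto
      then have "u i \<le> 2 powr \<kappa>" using u[of i] by linarith
      then show ?thesis using u0[of i] by simp
    qed
    then show ?thesis unfolding bounded_iff by blast
  qed
qed

text \<open>With one index per block the sum is dominated by a geometric series of ratio
  \<open>2 powr ((s - \<kappa>) * r)\<close>, so \<open>s < \<kappa>\<close> is enough and the loss
  \<open>1 / q\<close> of full blocks disappears.\<close>

lemma sparse_summable:
  assumes r: "0 < r" and s: "s < \<kappa>"
  shows "summable (\<lambda>i. ((1 + real i) powr s * (if i \<in> range ((^) 2) then 2 powr (- (\<kappa> * real (floor_log i))) else 0)) powr r)"
    (is "summable ?u")
proof -
  have mono: "strict_mono (\<lambda>n. 2 ^ n :: nat)" by (simp add: strict_mono_def)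
  have "summable (\<lambda>n. ?u (2 ^ n))"
  proof (rule summable_comparison_test')
    define c where "c = max 1 (2 powr s) powr r"
    define \<theta> where "\<theta> = 2 powr ((s - \<kappa>) * r)"
    have "(s - \<kappa>) * r < 0" using r s by (simp add: mult_neg_pos)
    then have "2 powr ((s - \<kappa>) * r) < 2 powr 0" by (intro powr_less_mono) auto
    then have \<theta>: "0 < \<theta>" "\<theta> < 1" by (auto simp: \<theta>_def)
    then show "summable (\<lambda>n. c * \<theta> ^ n)" by (intro summable_mult summable_geometric) auto
    fix n
    have "(1 + real (2 ^ n)) powr s \<le> max 1 (2 powr s) * 2 powr (real n * s)"
    proof (cases "0 \<le> s")
      case True
      then have "(1 + real (2 ^ n)) powr s \<le> (2 * 2 ^ n) powr s" by (intro powr_mono2) auto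
      also have "\<dots> = 2 powr s * 2 powr (real n * s)" by (simp add: powr_mult powr_powr powr_realpow[symmetric])
      also have "\<dots> \<le> max 1 (2 powr s) * 2 powr (real n * s)" by (intro mult_right_mono) auto
      finally show ?thesis .
    next
      case False
      then have "(1 + real (2 ^ n)) powr s \<le> (2 ^ n) powr s" by (intro powr_mono2') auto
      also have "\<dots> = 1 * 2 powr (real n * s)" by (simp add: powr_powr powr_realpow[symmetric])
      also have "\<dots> \<le> max 1 (2 powr s) * 2 powr (real n * s)" by (intro mult_right_mono) auto
      finally show ?thesis .
    qed
    then have "(1 + real (2 ^ n)) powr s * 2 powr (- (\<kappa> * real n)) \<le> max 1 (2 powr s) * 2 powr (real n * s) * 2 powr (- (\<kappa> * real n))"
      by (intro mult_right_mono) auto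
    also have "\<dots> = max 1 (2 powr s) * 2 powr (real n * (s - \<kappa>))"
      unfolding mult.assoc powr_add[symmetric] by (simp add: algebra_simps)
    finally have "((1 + real (2 ^ n)) powr s * 2 powr (- (\<kappa> * real n))) powr r \<le> (max 1 (2 powr s) * 2 powr (real n * (s - \<kappa>))) powr r"
      using r by (intro powr_mono2) auto
    also have "\<dots> = c * 2 powr (real n * (s - \<kappa>) * r)"
      by (simp add: c_def powr_mult powr_powr)
    also have "2 powr (real n * (s - \<kappa>) * r) = \<theta> ^ n"
      by (simp add: \<theta>_def powr_powr powr_realpow[symmetric] mult_ac)
    finally show "norm (?u (2 ^ n)) \<le> c * \<theta> ^ n" by simp
  qed
  moreover have "?u i = 0" if "i \<notin> range (\<lambda>n. 2 ^ n :: nat)" for i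
    using that by auto
  ultimately show ?thesis using summable_mono_reindex[OF mono, of ?u] by blast
qed

lemma sum_block:
  "(\<Sum>l\<in>{2 ^ n..<2 ^ Suc n}. 2 powr (- (\<kappa> * real (floor_log l)))) = 2 powr (real n * (1 - \<kappa>))"
proof -
  have "(\<Sum>l\<in>{2 ^ n..<2 ^ Suc n}. 2 powr (- (\<kappa> * real (floor_log l)))) = (\<Sum>l\<in>{2 ^ n..<2 ^ Suc n :: nat}. 2 powr (- (\<kappa> * real n)))"
    by (intro sum.cong refl) (simp add: floor_log_block)
  also have "\<dots> = 2 powr real n * 2 powr (- (\<kappa> * real n))"
    by (simp add: powr_realpow)
  also have "\<dots> = 2 powr (real n * (1 - \<kappa>))"
    unfolding powr_add[symmetric] by (simp add: algebra_simps)
  finally show ?thesis .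
qed

lemma decay_position: "1 + real j \<le> 2 * (1 + \<bar>real j\<bar>)" "1 + real j \<le> 2 * (1 + \<bar>2 ^ floor_log j\<bar>)"
  using floor_log_bounds(2)[of j] by auto

theorem proposition9p1:
  fixes \<phi>0 :: "real ^ 'd \<Rightarrow> complex"
    and k :: nat
    and p b \<epsilon> :: real
    and q :: ereal
  assumes "dyadic_generator \<phi>0"
    and "k \<ge> 1"
    and "\<epsilon> > 0"
    and "(2 * real CARD('d) / (real CARD('d) + 1) < p \<and> 0 < q \<and> ereal b > - (1 / q)
            \<and> ereal p = min 2 (min (ereal p) q))
       \<or> (1 < p \<and> 0 < q \<and> ereal b > - (1 / q) \<and> 2 = min 2 (min (ereal p) q))
       \<or> (1 < p \<and> 0 < q \<and> ereal b > - (1 / q) \<and> q = min 2 (min (ereal p) q))"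
  shows "\<exists>f :: real ^ 'd \<Rightarrow> complex.
           f \<in> besov_fun \<phi>0 0 (b + 1 / real_of_ereal (min 2 (min (ereal p) q)) - \<epsilon>) p q
         \<and> f \<notin> besov_diff k b p q"
proof -
  define \<mu> where "\<mu> = real_of_ereal (min 2 (min (ereal p) q))"
  have "0 < CARD('d)" by simp
  then have "1 \<le> real CARD('d)" by linarith
  \<comment> \<open>The lower bound for \<open>p\<close> in case (a) is at least 1 because
    \<open>d \<ge> 1\<close>; so \<open>p > 1\<close> in every case.\<close>
  then have "1 \<le> 2 * real CARD('d) / (real CARD('d) + 1)" by (simp add: pos_le_divide_eq)
  moreover from assms(4) have "2 * real CARD('d) / (real CARD('d) + 1) < p \<or> 1 < p" by blast
  ultimately have p: "1 < p" by linarith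
  have q: "0 < q" using assms(4) by blast
  have bq: "0 < b + 1 / real_of_ereal q"
  proof -
    have "- (1 / q) < ereal b" using assms(4) by blast
    then show ?thesis using q by (cases q) (auto simp: one_ereal_def zero_ereal_def)
  qed
  define p' where "p' = p / (p - 1)"
  have p': "1 < p'" "1 / p + 1 / p' = 1"
    using p by (auto simp: p'_def field_simps)
  \<comment> \<open>The first bound gives \<delta> < \<epsilon>, on which convergence of the Besov
    sum rests; the second keeps \<beta> positive, so that the coefficients are at most 1.\<close>
  define \<delta> where "\<delta> = min (\<epsilon> / 2) ((b + 1 / real_of_ereal q) / 2)"
  have \<delta>: "0 < \<delta>" "\<delta> < \<epsilon>" "0 < b + 1 / real_of_ereal q - \<delta>"
    using assms(3) bq by (auto simp: \<delta>_def min_def)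
  obtain e :: "real ^ 'd" where e: "e \<in> Basis" using nonempty_Basis by blast
  define \<beta> where "\<beta> = b + 1 / real_of_ereal q - \<delta>"
  have goal: ?thesis
    if lac: "lacunary e a \<rho>"
      and fin: "q \<noteq> \<infinity> \<Longrightarrow> summable (\<lambda>i. ((1 + real i) powr (b + 1 / \<mu> - \<epsilon>) * a i) powr real_of_ereal q)"
      and inf: "q = \<infinity> \<Longrightarrow> bounded (range (\<lambda>i. (1 + real i) powr (b + 1 / \<mu> - \<epsilon>) * a i))"
      and S: "\<And>n. S n \<subseteq> {2 ^ n..<2 ^ Suc n}" and c: "0 < c"
      and G: "\<And>n. integrable lborel (\<lambda>x. norm (lacunary.test e \<rho> (S n) x) powr p') \<and>
        (\<integral>x. norm (lacunary.test e \<rho> (S n) x) powr p' \<partial>lborel) \<le> (c * N n) powr p'"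
      and N: "\<And>n. 0 < N n" "\<And>n. (\<Sum>l\<in>S n. a l) = N n * 2 powr (- (real n * \<beta>))"
    for a \<rho> :: "nat \<Rightarrow> real" and S c N
  proof -
    interpret lacunary e a \<rho> by (rule lac)
    have "series \<in> besov_fun \<phi>0 0 (b + 1 / \<mu> - \<epsilon>) p q"
      by (rule series_in_besov_fun[OF assms(1) p q fin inf])
    moreover have "series \<notin> besov_diff k b p q"
      by (rule series_notin_besov_diff[OF S p p' q c \<delta>(1)]) (use G N in \<open>auto simp: \<beta>_def\<close>)
    ultimately show ?thesis unfolding \<mu>_def by blast
  qed
  have full: ?thesis
    if \<mu>: "0 < \<mu>" and \<rho>: "\<And>j. 1 + real j \<le> 2 * (1 + \<bar>\<rho> j\<bar>)" and c: "0 < c"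
      and G: "\<And>n. integrable lborel (\<lambda>x. norm (lacunary.test e \<rho> {2 ^ n..<2 ^ Suc n} x) powr p') \<and>
        (\<integral>x. norm (lacunary.test e \<rho> {2 ^ n..<2 ^ Suc n} x) powr p' \<partial>lborel) \<le> (c * 2 powr (real n * (1 - 1 / \<mu>))) powr p'"
    for \<rho> :: "nat \<Rightarrow> real" and c
  proof -
    \<comment> \<open>By \<open>sum_block\<close> a block sums to
      \<open>2 powr (n * (1 - \<kappa>))\<close>; this value of \<kappa> makes it
      \<open>N n * 2 powr (- (n * \<beta>))\<close> for
      \<open>N n = 2 powr (n * (1 - 1 / \<mu>))\<close>.\<close>
    define \<kappa> where "\<kappa> = \<beta> + 1 / \<mu>"
    have \<kappa>: "0 < \<kappa>" using \<mu> \<delta> by (auto simp: \<kappa>_def \<beta>_def intro!: add_pos_pos)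
    have s: "b + 1 / \<mu> - \<epsilon> < \<kappa> - 1 / real_of_ereal q" using \<delta> by (simp add: \<kappa>_def \<beta>_def)
    let ?a = "\<lambda>j. 2 powr (- (\<kappa> * real (floor_log j)))"
    show ?thesis
    proof (rule goal[where a="?a" and \<rho>=\<rho> and S="\<lambda>n. {2 ^ n..<2 ^ Suc n}" and N="\<lambda>n. 2 powr (real n * (1 - 1 / \<mu>))"])
      show "lacunary e ?a \<rho>"
        using e \<rho> \<kappa> powr_mono[of _ 0 2] by unfold_locales (auto simp: mult_nonneg_nonneg)
      show "(\<Sum>l\<in>{2 ^ n..<2 ^ Suc n}. ?a l) = 2 powr (real n * (1 - 1 / \<mu>)) * 2 powr (- (real n * \<beta>))" for n
        unfolding sum_block powr_add[symmetric] by (simp add: \<kappa>_def algebra_simps)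
    qed (use block_summable[OF \<kappa> q s] G c in auto)
  qed
  have card: "card {2 ^ n..<2 ^ Suc n :: nat} = 2 ^ n" for n by simp
  from assms(4) consider
      (p) "ereal p = min 2 (min (ereal p) q)"
    | (two) "2 = min 2 (min (ereal p) q)"
    | (q) "q = min 2 (min (ereal p) q)" by blast
  then show ?thesis
  proof cases
    case p
    then have \<mu>: "\<mu> = p" unfolding \<mu>_def by (metis real_of_ereal.simps(1))
    \<comment> \<open>\<open>test\<close> depends on \<open>e\<close> and \<open>\<rho>\<close>
      only, so its norm bounds may be taken from the instance with zero coefficients.\<close>
    interpret lacunary e "\<lambda>_. 0" real
      using e decay_position(1) by unfold_locales auto
    obtain C where C: "C > 0" "\<And>S. finite S \<Longrightarrow> integrable lborel (\<lambda>x. norm (test S x) powr p') \<and>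
        (\<integral>x. norm (test S x) powr p' \<partial>lborel) \<le> (C * real (card S) powr (1 / p')) powr p'"
      using test_norm_spread[of p'] p' by auto
    have "1 / p' = 1 - 1 / \<mu>" using p'(2) \<mu> by simp
    then have "real (card {2 ^ n..<2 ^ Suc n :: nat}) powr (1 / p') = 2 powr (real n * (1 - 1 / \<mu>))" for n
      by (simp only: card) (simp add: powr_realpow[symmetric] powr_powr)
    then have "integrable lborel (\<lambda>x. norm (test {2 ^ n..<2 ^ Suc n} x) powr p') \<and>
        (\<integral>x. norm (test {2 ^ n..<2 ^ Suc n} x) powr p' \<partial>lborel) \<le> (C * 2 powr (real n * (1 - 1 / \<mu>))) powr p'" for n
      using C(2)[of "{2 ^ n..<2 ^ Suc n}"] by (simp only: finite_atLeastLessThan simp_thms)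
    then show ?thesis
      using C(1) \<open>1 < p\<close> decay_position(1) by (intro full[of real C]) (auto simp: \<mu>)
  next
    case two
    then have \<mu>: "\<mu> = 2" unfolding \<mu>_def by (metis real_of_ereal.simps(1) numeral_eq_ereal)
    have "2 \<le> ereal p" using two by (metis min.cobounded1 min.cobounded2 min.coboundedI2)
    then have "2 \<le> p" by (simp add: numeral_eq_ereal)
    \<comment> \<open>The minimum being 2 forces \<open>p \<ge> 2\<close>, which puts the dual
      exponent in the range of \<open>test_norm_concentrated\<close>.\<close>
    then have "p' \<le> 2" using p by (simp add: p'_def pos_divide_le_eq)
    \<comment> \<open>Block \<open>n\<close> has the single centre \<open>2 ^ n\<close>, which still
      escapes to infinity with \<open>n\<close>.\<close>
    interpret lacunary e "\<lambda>_. 0" "\<lambda>j. 2 ^ floor_log j"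
      using e decay_position(2) by unfold_locales auto
    obtain C where C: "C > 0" "\<And>S z. finite S \<Longrightarrow> \<forall>l\<in>S. 2 ^ floor_log l = (z::real) \<Longrightarrow> integrable lborel (\<lambda>x. norm (test S x) powr p') \<and>
        (\<integral>x. norm (test S x) powr p' \<partial>lborel) \<le> (C * sqrt (real (card S))) powr p'"
      using test_norm_concentrated[of p'] p' \<open>p' \<le> 2\<close> by auto
    have "integrable lborel (\<lambda>x. norm (test {2 ^ n..<2 ^ Suc n} x) powr p') \<and>
        (\<integral>x. norm (test {2 ^ n..<2 ^ Suc n} x) powr p' \<partial>lborel) \<le> (C * 2 powr (real n * (1 - 1 / \<mu>))) powr p'" for n
    proof -
      have "sqrt (real (card {2 ^ n..<2 ^ Suc n :: nat})) = 2 powr (real n * (1 - 1 / \<mu>))"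
        by (simp add: \<mu> powr_half_sqrt[symmetric] powr_realpow[symmetric] powr_powr)
      moreover have "\<forall>l\<in>{2 ^ n..<2 ^ Suc n}. 2 ^ floor_log l = (2 ^ n :: real)"
        using floor_log_block by blast
      ultimately show ?thesis using C(2)[of "{2 ^ n..<2 ^ Suc n}" "2 ^ n"] by simp
    qed
    then show ?thesis using C(1) decay_position(2) by (intro full[of "\<lambda>j. 2 ^ floor_log j" C]) (auto simp: \<mu>)
  next
    case q
    then have fin: "q \<noteq> \<infinity>" by (metis min.cobounded1 ereal_infty_less_eq(1) numeral_eq_ereal PInfty_neq_ereal(2))
    have \<mu>: "\<mu> = real_of_ereal q" unfolding \<mu>_def using q by simp
    have r: "0 < real_of_ereal q" using \<open>0 < q\<close> fin by (cases q) auto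
    have \<beta>: "0 < \<beta>" "b + 1 / \<mu> - \<epsilon> < \<beta>" using \<delta> by (auto simp: \<beta>_def \<mu>)
    \<comment> \<open>Block \<open>n\<close> keeps the index \<open>2 ^ n\<close> alone, and
      \<open>floor_log (2 ^ n) = n\<close>; its sum is \<open>2 powr (- (\<beta> * n))\<close>,
      which matches \<open>N n = 1\<close>.\<close>
    let ?a = "\<lambda>i. if i \<in> range ((^) 2) then 2 powr (- (\<beta> * real (floor_log i))) else 0"
    have lac: "lacunary e ?a real"
      using e decay_position(1) \<beta> powr_mono[of _ 0 2] by unfold_locales (auto simp: mult_nonneg_nonneg)
    interpret lacunary e ?a real by (rule lac)
    obtain C where C: "C > 0" "\<And>l. integrable lborel (\<lambda>x. norm (test {l} x) powr p') \<and>
        (\<integral>x. norm (test {l} x) powr p' \<partial>lborel) \<le> C powr p'"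
      using test_norm_single[of p'] p' by auto
    show ?thesis
    proof (rule goal[OF lac, where S="\<lambda>n. {2 ^ n}" and N="\<lambda>_. 1" and c=C])
      show "summable (\<lambda>i. ((1 + real i) powr (b + 1 / \<mu> - \<epsilon>) * ?a i) powr real_of_ereal q)"
        by (rule sparse_summable[OF r \<beta>(2)])
    qed (use C fin in \<open>auto simp: mult.commute\<close>)
  qed
qed

end
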